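(* Let $n\ge2$, let $B_1\subset\mathbb R^n$ be the open unit ball centered at the origin, and let $s\in(0,1)$. Assume that $u\in\mathcal L^{2s}(\mathbb R^n)$ satisfies $u\ge0$ a.e. in $B_1$ and $$\mathscr{L}_su+cu\ge0\qquad\text{in }\mathcal D'(B_1\setminus\{0\}),$$ where $c\in L^\infty(B_1)$. Then there exist $a\ge0$ and a nonnegative Radon measure $\mu$ in $B_1$, with $\mu(\{0\})=0$, such that $$\mathscr{L}_su+cu=\mu+a\delta_0\qquad\text{in }\mathcal D'(B_1).$$
   Context: $\mathscr{L}_s=-\Delta+(-\Delta)^s$, where the fractional Laplacian is normalized by $(-\Delta)^s\phi(x)=C_{n,s}\,\mathrm{PV}\int_{\mathbb R^n}\frac{\phi(x)-\phi(y)}{|x-y|^{n+2s}}\,dy$ with $C_{n,s}=\frac{2^{2s}\Gamma(s+n/2)}{\pi^{n/2}|\Gamma(-s)|}$. Define $$\mathcal L^{2s}(\mathbb R^n)=\left\{u\in L^1_{\mathrm{loc}}(\mathbb R^n)\ \middle|\ \int_{\mathbb R^n}\frac{|u(x)|}{1+|x|^{n+2s}}\,dx<\infty\right\}$$ (real-valued functions). For $\Omega\subset\mathbb R^n$ open and $u\in\mathcal L^{2s}(\mathbb R^n)$, the distribution $\mathscr{L}_su$ in $\Omega$ is defined by $\langle\mathscr{L}_su,\phi\rangle=\int_{\mathbb R^n}u(x)\,\mathscr{L}_s\phi(x)\,dx$ for $\phi\in C_c^\infty(\Omega)$. An inequality $T\ge0$ in $\mathcal D'(\Omega)$ means $\langle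 T,\phi\rangle\ge0$ for all $0\le\phi\in C_c^\infty(\Omega)$. $\delta_0$ is the Dirac mass at the origin. *)

theory Defs
  imports "HOL-Analysis.Analysis"
begin

definition partial_deriv :: "'a::euclidean_space \<Rightarrow> ('a \<Rightarrow> real) \<Rightarrow> 'a \<Rightarrow> real" where
  "partial_deriv i f x = frechet_derivative f (at x) i"

primrec C_k :: "nat \<Rightarrow> ('a::euclidean_space \<Rightarrow> real) \<Rightarrow> bool" where
  "C_k 0 f \<longleftrightarrow> continuous_on UNIV f"
| "C_k (Suc k) f \<longleftrightarrow> f differentiable_on UNIV \<and> (\<forall>i\<in>Basis. C_k k (partial_deriv i f))"

text \<open>Elements of \<open>C\<^sub>c\<^sup>\<infinity>(\<Omega>)\<close> are identified with their extensions by zero to the whole space.\<close>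

definition test_functions :: "'a::euclidean_space set \<Rightarrow> ('a \<Rightarrow> real) set" where
  "test_functions \<Omega> =
     {\<phi>. (\<forall>k. C_k k \<phi>) \<and> compact (closure {x. \<phi> x \<noteq> 0}) \<and> closure {x. \<phi> x \<noteq> 0} \<subseteq> \<Omega>}"

definition laplacian :: "('a::euclidean_space \<Rightarrow> real) \<Rightarrow> 'a \<Rightarrow> real" where
  "laplacian \<phi> x = (\<Sum>i\<in>Basis. partial_deriv i (partial_deriv i \<phi>) x)"

definition frac_const :: "nat \<Rightarrow> real \<Rightarrow> real" where
  "frac_const n s =
     2 powr (2 * s) * Gamma (s + real n / 2) / (pi powr (real n / 2) * \<bar>Gamma (- s)\<bar>)"

text \<open>The principal value is the limit, as \<open>\<epsilon>\<close> decreases to 0, of the integrals over the complement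
  of the ball of radius \<open>\<epsilon>\<close> around \<open>x\<close>.\<close>

definition frac_laplacian :: "real \<Rightarrow> ('a::euclidean_space \<Rightarrow> real) \<Rightarrow> 'a \<Rightarrow> real" where
  "frac_laplacian s \<phi> x =
     frac_const DIM('a) s *
     Lim (at_right 0) (\<lambda>\<epsilon>. LINT y : - ball x \<epsilon> | lebesgue.
       (\<phi> x - \<phi> y) / norm (x - y) powr (real DIM('a) + 2 * s))"

definition mixed_op :: "real \<Rightarrow> ('a::euclidean_space \<Rightarrow> real) \<Rightarrow> 'a \<Rightarrow> real" where
  "mixed_op s \<phi> x = - laplacian \<phi> x + frac_laplacian s \<phi> x"

definition L1_loc :: "('a::euclidean_space \<Rightarrow> real) set" where
  "L1_loc = {u. \<forall>K. compact K \<longrightarrow> set_integrable lebesgue K u}"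

definition weighted_L1 :: "real \<Rightarrow> ('a::euclidean_space \<Rightarrow> real) set" where
  "weighted_L1 s =
     {u \<in> L1_loc. integrable lebesgue (\<lambda>x. \<bar>u x\<bar> / (1 + norm x powr (real DIM('a) + 2 * s)))}"

definition L_infty :: "'a::euclidean_space set \<Rightarrow> ('a \<Rightarrow> real) set" where
  "L_infty \<Omega> =
     {c \<in> borel_measurable (lebesgue_on \<Omega>). \<exists>M. AE x in lebesgue_on \<Omega>. \<bar>c x\<bar> \<le> M}"

text \<open>Distributions are given by their pairing with test functions. Continuity plays no role in
  comparing them, so they are plain functionals here; the set \<open>\<Omega>\<close> on which they are compared is an
  argument of the two comparison relations.\<close>

type_synonym 'a distr = "('a \<Rightarrow> real) \<Rightarrow> real"

definition distr_nonneg :: "'a::euclidean_space set \<Rightarrow> 'a distr \<Rightarrow> bool" where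
  "distr_nonneg \<Omega> T \<longleftrightarrow> (\<forall>\<phi>\<in>test_functions \<Omega>. (\<forall>x. 0 \<le> \<phi> x) \<longrightarrow> 0 \<le> T \<phi>)"

definition distr_eq :: "'a::euclidean_space set \<Rightarrow> 'a distr \<Rightarrow> 'a distr \<Rightarrow> bool" where
  "distr_eq \<Omega> T S \<longleftrightarrow> (\<forall>\<phi>\<in>test_functions \<Omega>. T \<phi> = S \<phi>)"

definition mixed_op_distr :: "real \<Rightarrow> ('a::euclidean_space \<Rightarrow> real) \<Rightarrow> 'a distr" where
  "mixed_op_distr s u \<phi> = (LINT x | lebesgue. u x * mixed_op s \<phi> x)"

definition function_distr :: "'a::euclidean_space set \<Rightarrow> ('a \<Rightarrow> real) \<Rightarrow> 'a distr" where
  "function_distr \<Omega> f \<phi> = (LINT x : \<Omega> | lebesgue. f x * \<phi> x)"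

definition measure_distr :: "'a::euclidean_space measure \<Rightarrow> 'a distr" where
  "measure_distr \<mu> \<phi> = (LINT x | \<mu>. \<phi> x)"

definition dirac_distr :: "'a::euclidean_space \<Rightarrow> 'a distr" where
  "dirac_distr p \<phi> = \<phi> p"

text \<open>A nonnegative Radon measure in \<open>\<Omega>\<close> is a Borel measure on \<open>\<Omega>\<close> that is finite on compact
  subsets of \<open>\<Omega>\<close> and inner regular; it need not have finite total mass.\<close>

definition radon_measure_on :: "'a::euclidean_space set \<Rightarrow> 'a measure \<Rightarrow> bool" where
  "radon_measure_on \<Omega> \<mu> \<longleftrightarrow>
     sets \<mu> = sets (restrict_space borel \<Omega>) \<and>
     (\<forall>K. compact K \<and> K \<subseteq> \<Omega> \<longrightarrow> emeasure \<mu> K < \<infinity>) \<and>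
     (\<forall>A\<in>sets \<mu>. emeasure \<mu> A = (SUP K\<in>{K. compact K \<and> K \<subseteq> A}. emeasure \<mu> K))"

end

theory Submission
  imports Defs
begin

text \<open>
  Write \<open>L\<close> for the mixed operator. The assertion is equivalent to nonnegativity of \<open>T = L u + c u\<close> on
  all of \<open>B\<^sub>1\<close>: a nonnegative distribution is a Radon measure \<open>\<nu>\<close>, and one takes \<open>a = \<nu>{0}\<close> and
  \<open>\<mu> = \<nu> - a \<delta>\<^sub>0\<close>. Adding a small multiple of a bump, it suffices to consider test functions \<open>\<phi> \<ge> 0\<close> with
  \<open>\<phi>(0) > 0\<close>. Test with \<open>\<phi> \<eta>\<close>, where \<open>\<eta>(x) = \<Phi>(\<ell>(x))\<close>, \<open>\<ell>(x) = ln \<bar>x\<bar>\<^sup>2\<close>,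
  \<open>\<Phi>(t) = F(1 + \<epsilon> (t + exp (\<gamma> t)))\<close>, \<open>F(t) = t exp (-1/t)\<close> for \<open>t > 0\<close> and 0 otherwise, and
  \<open>\<gamma> = (1 - s)/2\<close>. The function \<open>\<eta>\<close> vanishes near the origin and tends to \<open>F(1) > 0\<close> elsewhere as
  \<open>\<epsilon> \<rightarrow> 0\<close>. Since \<open>\<Phi>\<close> is convex and increasing, \<open>\<eta>(x) - \<eta>(y) \<le> \<Phi>'(\<ell>(x)) (\<ell>(x) - \<ell>(y))\<close>, so the
  error of the nonlocal part is at most \<open>C \<Phi>' \<bar>x\<bar>\<^sup>-\<^sup>2\<^sup>s\<close>; that of the gradient term is at most
  \<open>C \<Phi>' \<bar>x\<bar>\<^sup>-\<^sup>1\<close>. As \<open>\<ell>\<close> is subharmonic away from the origin for \<open>n \<ge> 2\<close>, the summand \<open>exp (\<gamma> t)\<close> makes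
  \<open>- \<phi> \<Delta>\<eta>\<close> at most \<open>- C' F' \<epsilon> \<bar>x\<bar>\<^sup>-\<^sup>1\<^sup>-\<^sup>s\<close> near the origin, which absorbs both errors because \<open>s < 1\<close>.
  Hence \<open>L(\<phi> \<eta>) \<le> \<eta> L\<phi> + \<epsilon> C\<close> on \<open>B\<^sub>1 - {0}\<close>, where \<open>u \<ge> 0\<close>, and \<open>\<epsilon> \<rightarrow> 0\<close> gives \<open>T \<phi> \<ge> 0\<close>.
\<close>

section \<open>Smooth functions\<close>

text \<open>A convex profile cannot level off, so \<open>\<eta>\<close> is not a cutoff with values
  in [0,1]. Convexity is kept because it makes the nonlocal error one-sided, with the same factor
  \<open>\<Phi>1\<close> as the local errors; the growth is harmless, since \<phi> is supported in
  the ball, where \<eta> stays below 2. With ell alone in the profile nothing of order \<epsilon>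
  would absorb the errors: in dimension two ell is harmonic, and the term from F'' carries
  \<epsilon>^2. The summand exp (\<gamma> t) contributes |x|^(2\<gamma> - 2) at order \<epsilon>.
  This beats |x|^(-1) and |x|^(-2s) exactly when 2\<gamma> < 1 and 2\<gamma> < 2 - 2s, and 2\<gamma>
  = 1 - s meets both. Absorption requires \<phi> to be bounded below near the origin, whence the
  condition \<phi>(0) > 0. Outside the ball u has no sign, so an upper bound for L(\<phi> \<eta>)
  says nothing; there the limit is taken by dominated convergence with majorant 2 |u L\<phi>|. The
  potential produces no error, because c \<phi> \<eta> is \<eta> times c \<phi>; thus c may have
  either sign.\<close>

primrec Ck_on :: "nat \<Rightarrow> 'a::euclidean_space set \<Rightarrow> ('a \<Rightarrow> real) \<Rightarrow> bool" where
  "Ck_on 0 S f \<longleftrightarrow> continuous_on S f"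
| "Ck_on (Suc k) S f \<longleftrightarrow>
     (\<forall>x\<in>S. f differentiable (at x)) \<and> (\<forall>i\<in>Basis. Ck_on k S (partial_deriv i f))"

lemma C_k_eq_Ck_on: "C_k k f = Ck_on k UNIV f"
  by (induction k arbitrary: f) (auto simp: differentiable_on_def)

lemma partial_deriv_eq: "(f has_derivative f') (at x) \<Longrightarrow> partial_deriv i f x = f' i"
  unfolding partial_deriv_def by (metis frechet_derivative_at)

text \<open>Derivatives in \<open>Ck_on\<close> are taken at points, not within \<open>S\<close>. On
  an open \<open>S\<close> agreement therefore passes to all partial derivatives, and smoothness can
  be checked on pieces, as it must be for functions of ln |x|^2, which are smooth only off the
  origin.\<close>

lemma Ck_on_cong:
  assumes "open S" "\<And>x. x \<in> S \<Longrightarrow> f x = g x" "Ck_on k S f"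
  shows "Ck_on k S g"
  using assms(2,3)
proof (induction k arbitrary: f g)
  case 0
  then show ?case by (auto cong: continuous_on_cong)
next
  case (Suc k)
  have d: "(g has_derivative frechet_derivative f (at x)) (at x)" if "x \<in> S" for x
    using Suc.prems that assms(1)
    by (intro has_derivative_transform_within_open[of f _ x UNIV S g]) (auto simp: frechet_derivative_works)
  show ?case
  proof (simp, intro conjI ballI)
    fix x assume "x \<in> S" then show "g differentiable (at x)" using d by (auto simp: differentiable_def)
  next
    fix i :: 'a assume "i \<in> Basis"
    show "Ck_on k S (partial_deriv i g)"
    proof (rule Suc.IH[of "partial_deriv i f"])
      show "partial_deriv i f x = partial_deriv i g x" if "x \<in> S" for x
        using partial_deriv_eq[OF d[OF that]] by (simp add: partial_deriv_def)
      show "Ck_on k S (partial_deriv i f)" using Suc.prems \<open>i \<in> Basis\<close> by simp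
    qed
  qed
qed

lemma Ck_on_SucI:
  assumes "open S" "\<And>x. x \<in> S \<Longrightarrow> (f has_derivative f' x) (at x)"
    "\<And>i. i \<in> Basis \<Longrightarrow> Ck_on k S (\<lambda>x. f' x i)"
  shows "Ck_on (Suc k) S f"
proof (simp, intro conjI ballI)
  fix x assume "x \<in> S" then show "f differentiable (at x)"
    using assms(2) by (auto simp: differentiable_def)
next
  fix i :: 'a assume "i \<in> Basis"
  then show "Ck_on k S (partial_deriv i f)"
    using assms by (intro Ck_on_cong[OF assms(1) _ assms(3)]) (auto simp: partial_deriv_eq[OF assms(2)])
qed

text \<open>The expansion in partial derivatives expresses the whole derivative by the functions
  that \<open>Ck_on\<close> controls, so that the product and chain rules lead back to the induction
  hypothesis.\<close>

lemma Ck_on_has_derivative: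
  assumes "Ck_on (Suc k) S f" "x \<in> S"
  shows "(f has_derivative (\<lambda>v. \<Sum>i\<in>Basis. (v \<bullet> i) * partial_deriv i f x)) (at x)"
proof -
  have d: "(f has_derivative frechet_derivative f (at x)) (at x)"
    using assms by (simp add: frechet_derivative_works)
  have "frechet_derivative f (at x) v = (\<Sum>i\<in>Basis. (v \<bullet> i) * partial_deriv i f x)" for v
  proof -
    interpret bounded_linear "frechet_derivative f (at x)" using d by (rule has_derivative_bounded_linear)
    have "frechet_derivative f (at x) v = frechet_derivative f (at x) (\<Sum>i\<in>Basis. (v \<bullet> i) *\<^sub>R i)"
      by (simp add: euclidean_representation)
    also have "\<dots> = (\<Sum>i\<in>Basis. (v \<bullet> i) * partial_deriv i f x)"
      by (simp add: sum scaleR partial_deriv_def)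
    finally show ?thesis .
  qed
  then show ?thesis using d by (metis (no_types, lifting) ext)
qed

lemma Ck_on_Suc_imp: "Ck_on (Suc k) S f \<Longrightarrow> Ck_on k S f"
proof (induction k arbitrary: f)
  case 0
  then show ?case
    by (auto intro!: continuous_at_imp_continuous_on differentiable_imp_continuous_within)
qed auto

lemma Ck_on_imp_continuous_on: "Ck_on k S f \<Longrightarrow> continuous_on S f"
  by (induction k) (simp, metis Ck_on_Suc_imp)

lemma Ck_on_subset: "Ck_on k S f \<Longrightarrow> T \<subseteq> S \<Longrightarrow> Ck_on k T f"
  by (induction k arbitrary: f) (auto intro: continuous_on_subset)

lemma Ck_on_Un: "open S \<Longrightarrow> open T \<Longrightarrow> Ck_on k S f \<Longrightarrow> Ck_on k T f \<Longrightarrow> Ck_on k (S \<union> T) f"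
  by (induction k arbitrary: f) (auto intro: continuous_on_open_Un)

lemma Ck_on_const: "Ck_on k S (\<lambda>x. c)"
proof (rule Ck_on_subset[of _ UNIV])
  \<comment> \<open>\<open>Ck_on_SucI\<close> asks for an open set; hence the detour through
    \<open>UNIV\<close> for an arbitrary \<open>S\<close>.\<close>
  show "Ck_on k UNIV (\<lambda>x. c)"
    by (induction k arbitrary: c) (auto intro!: Ck_on_SucI[where f'="\<lambda>_ _. 0"] simp del: Ck_on.simps(2))
qed simp

lemma Ck_on_add:
  "open S \<Longrightarrow> Ck_on k S f \<Longrightarrow> Ck_on k S g \<Longrightarrow> Ck_on k S (\<lambda>x. f x + g x)"
proof (induction k arbitrary: f g)
  case 0
  then show ?case by (auto intro: continuous_intros)
next
  case (Suc k)
  \<comment> \<open>In the direction of a basis vector \<open>i\<close> each sum collapses to its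
    term with j = i.\<close>
  have *: "Ck_on k S (\<lambda>x. (\<Sum>j\<in>Basis. (i \<bullet> j) * partial_deriv j f x) + (\<Sum>j\<in>Basis. (i \<bullet> j) * partial_deriv j g x))"
    if "i \<in> Basis" for i
    using Suc that by (simp add: inner_Basis if_distrib[of "\<lambda>a. a * _"] sum.If_cases cong: if_cong)
  show ?case
    by (rule Ck_on_SucI[where f'="\<lambda>x v. (\<Sum>j\<in>Basis. (v \<bullet> j) * partial_deriv j f x) + (\<Sum>j\<in>Basis. (v \<bullet> j) * partial_deriv j g x)"])
      (rule Suc.prems, rule has_derivative_add[OF Ck_on_has_derivative[OF Suc.prems(2)] Ck_on_has_derivative[OF Suc.prems(3)]], assumption+, rule *)
qed

lemma Ck_on_mult:
  "open S \<Longrightarrow> Ck_on k S f \<Longrightarrow> Ck_on k S g \<Longrightarrow> Ck_on k S (\<lambda>x. f x * g x)"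
proof (induction k arbitrary: f g)
  case 0
  then show ?case by (auto intro: continuous_intros)
next
  case (Suc k)
  have *: "Ck_on k S (\<lambda>x. f x * (\<Sum>j\<in>Basis. (i \<bullet> j) * partial_deriv j g x) + (\<Sum>j\<in>Basis. (i \<bullet> j) * partial_deriv j f x) * g x)"
    if "i \<in> Basis" for i
    using Suc that Suc.prems(2,3)[THEN Ck_on_Suc_imp]
    by (auto simp add: inner_Basis if_distrib[of "\<lambda>a. a * _"] sum.If_cases cong: if_cong intro!: Ck_on_add)
  show ?case
    by (rule Ck_on_SucI[where f'="\<lambda>x v. f x * (\<Sum>j\<in>Basis. (v \<bullet> j) * partial_deriv j g x) + (\<Sum>j\<in>Basis. (v \<bullet> j) * partial_deriv j f x) * g x"])
      (rule Suc.prems, rule has_derivative_mult[OF Ck_on_has_derivative[OF Suc.prems(2)] Ck_on_has_derivative[OF Suc.prems(3)]], assumption+, rule *)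
qed

lemma Ck_on_sum:
  "open S \<Longrightarrow> (\<And>i. i \<in> I \<Longrightarrow> Ck_on k S (f i)) \<Longrightarrow> Ck_on k S (\<lambda>x. \<Sum>i\<in>I. f i x)"
  by (induction I rule: infinite_finite_induct) (auto intro!: Ck_on_add Ck_on_const)

lemma Ck_on_minus: "open S \<Longrightarrow> Ck_on k S f \<Longrightarrow> Ck_on k S (\<lambda>x. - f x)"
  using Ck_on_mult[OF _ Ck_on_const[of k S "-1"], of f] by simp

lemma Ck_on_diff:
  "open S \<Longrightarrow> Ck_on k S f \<Longrightarrow> Ck_on k S g \<Longrightarrow> Ck_on k S (\<lambda>x. f x - g x)"
  using Ck_on_add[OF _ _ Ck_on_minus, of S k f g] by simp

lemma Ck_on_inner_left: "Ck_on k S (\<lambda>x. x \<bullet> v)"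
proof (rule Ck_on_subset[of _ UNIV])
  show "Ck_on k UNIV (\<lambda>x. x \<bullet> v)"
  proof (cases k)
    case 0
    then show ?thesis by (auto intro: continuous_intros)
  next
    case (Suc m)
    show ?thesis unfolding Suc
      by (rule Ck_on_SucI[where f'="\<lambda>x h. h \<bullet> v"])
        (auto intro!: derivative_eq_intros Ck_on_const simp del: Ck_on.simps)
  qed
qed simp

lemma Ck_on_inner_self: "Ck_on k S (\<lambda>x. x \<bullet> x)"
proof (rule Ck_on_subset[of _ UNIV])
  show "Ck_on k UNIV (\<lambda>x::'a. x \<bullet> x)"
    by (subst euclidean_inner) (intro Ck_on_sum Ck_on_mult Ck_on_inner_left open_UNIV)
qed simp

lemma Ck_on_real_SucI:
  fixes F :: "real \<Rightarrow> real"
  assumes "open S" "\<And>x. x \<in> S \<Longrightarrow> (F has_real_derivative F' x) (at x)" "Ck_on k S F'"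
  shows "Ck_on (Suc k) S F"
proof (rule Ck_on_SucI[where f'="\<lambda>x h. F' x * h"])
  show "(F has_derivative (\<lambda>h. F' x * h)) (at x)" if "x \<in> S" for x
    using assms(2)[OF that] by (simp add: has_field_derivative_def)
  show "Ck_on k S (\<lambda>x. F' x * i)" if "i \<in> Basis" for i
    using assms(3) that by simp
qed (rule assms(1))

lemma Ck_on_compose:
  fixes F :: "real \<Rightarrow> real"
  shows "open S \<Longrightarrow> open T \<Longrightarrow> f ` S \<subseteq> T \<Longrightarrow> Ck_on k T F \<Longrightarrow> Ck_on k S f \<Longrightarrow> Ck_on k S (\<lambda>x. F (f x))"
proof (induction k arbitrary: f F)
  case 0
  then show ?case by (auto intro: continuous_on_compose2)
next
  case (Suc k)
  have "(\<lambda>x. F (f x)) = (F \<circ> f)" by auto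
  moreover have "Ck_on (Suc k) S (F \<circ> f)"
  proof (rule Ck_on_SucI)
    fix x assume x: "x \<in> S"
    have F: "(F has_derivative (\<lambda>v. \<Sum>i\<in>Basis. (v \<bullet> i) * partial_deriv i F (f x))) (at (f x))"
      by (rule Ck_on_has_derivative[OF Suc.prems(4)]) (rule subsetD[OF Suc.prems(3) imageI[OF x]])
    have f: "(f has_derivative (\<lambda>v. \<Sum>i\<in>Basis. (v \<bullet> i) * partial_deriv i f x)) (at x)"
      by (rule Ck_on_has_derivative[OF Suc.prems(5) x])
    show "(F \<circ> f has_derivative (\<lambda>v. (\<Sum>i\<in>Basis. (v \<bullet> i) * partial_deriv i f x) * partial_deriv 1 F (f x))) (at x)"
      using diff_chain_at[OF f F] by (simp add: o_def)
  next
    fix i :: 'a assume i: "i \<in> Basis"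
    have "Ck_on k S (\<lambda>x. partial_deriv i f x * partial_deriv 1 F (f x))"
    proof (rule Ck_on_mult[OF Suc.prems(1)])
      show "Ck_on k S (partial_deriv i f)" using Suc.prems(5) i by simp
      show "Ck_on k S (\<lambda>x. partial_deriv 1 F (f x))"
        using Suc.prems(4) by (intro Suc.IH[OF Suc.prems(1-3) _ Ck_on_Suc_imp[OF Suc.prems(5)]]) simp
    qed
    then show "Ck_on k S (\<lambda>x. (\<Sum>j\<in>Basis. (i \<bullet> j) * partial_deriv j f x) * partial_deriv 1 F (f x))"
      using i by (simp add: inner_Basis if_distrib[of "\<lambda>a. a * _"] sum.If_cases cong: if_cong)
  qed (use Suc.prems in auto)
  ultimately show ?case by metis
qed

section \<open>Exponential, logarithm and reciprocal\<close>

lemma Ck_on_exp: "Ck_on k S (exp :: real \<Rightarrow> real)"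
proof (rule Ck_on_subset[of _ UNIV])
  show "Ck_on k UNIV (exp :: real \<Rightarrow> real)"
  proof (induction k)
    case (Suc k)
    show ?case by (rule Ck_on_real_SucI[OF _ _ Suc]) (auto intro!: derivative_eq_intros)
  qed (auto intro: continuous_intros)
qed simp

lemma Ck_on_ln: "Ck_on k {0<..} (ln :: real \<Rightarrow> real)"
proof (induction k)
  case (Suc k)
  \<comment> \<open>Writing 1/x as exp (- ln x) reduces the derivative of ln to ln itself at the
    previous order, where the induction hypothesis applies.\<close>
  have "Ck_on k {0<..} (\<lambda>x::real. exp (- ln x))"
    by (rule Ck_on_compose[of _ UNIV]) (auto intro: Ck_on_exp Ck_on_minus Suc)
  then show ?case
    by (intro Ck_on_real_SucI[where F'="\<lambda>x. exp (- ln x)"])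
      (auto intro!: derivative_eq_intros simp: exp_minus inverse_eq_divide)
qed (auto intro!: continuous_intros)

lemma Ck_on_inverse:
  assumes "open S" "Ck_on k S f" "\<And>x. x \<in> S \<Longrightarrow> f x > (0::real)"
  shows "Ck_on k S (\<lambda>x. inverse (f x))"
proof -
  have "Ck_on k S (\<lambda>x. exp (- ln (f x)))"
    using assms by (intro Ck_on_compose[of S UNIV "\<lambda>x. - ln (f x)" k exp] Ck_on_minus Ck_on_exp
        Ck_on_compose[of S "{0<..}" f k ln] Ck_on_ln) auto
  then show ?thesis
    by (rule Ck_on_cong[OF assms(1), rotated]) (use assms in \<open>auto simp: exp_minus\<close>)
qed

text \<open>The powers of t are included because the family is then closed under differentiation up
  to linear combinations (\<open>DERIV_flat\<close>), so smoothness becomes an induction on the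
  order with m arbitrary.\<close>

definition flat :: "nat \<Rightarrow> real \<Rightarrow> real" where
  "flat m t = (if t > 0 then exp (- (1 / t)) / t ^ m else 0)"

lemma flat_nonneg: "flat m t \<ge> 0" by (simp add: flat_def)

lemma power_times_exp_le: "(y::real) \<ge> 0 \<Longrightarrow> y ^ p * exp (- y) \<le> fact p"
proof -
  assume y: "y \<ge> 0"
  \<comment> \<open>A single term of the exponential series is at most its sum.\<close>
  have "(\<Sum>k\<in>{p}. y ^ k /\<^sub>R fact k) \<le> (\<Sum>k. y ^ k /\<^sub>R fact k)"
    by (rule sum_le_suminf[OF summable_exp_generic]) (use y in auto)
  then have "y ^ p / fact p \<le> exp y" by (simp add: exp_def divide_inverse mult.commute)
  then show ?thesis by (simp add: exp_minus field_simps)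
qed

text \<open>Quadratic vanishing at 0 is what forces the derivative there to be 0. The bound is
  \<open>power_times_exp_le\<close> at y = 1/t with exponent m + 2.\<close>

lemma flat_le: "flat m t \<le> fact (m + 2) * t\<^sup>2"
proof (cases "t > 0")
  case True
  have "(1/t) ^ (m+2) * exp (- (1/t)) \<le> fact (m + 2)"
    by (rule power_times_exp_le) (use True in auto)
  then have "(1/t) ^ (m+2) * exp (- (1/t)) * t^2 \<le> fact (m + 2) * t^2" by (rule mult_right_mono) simp
  moreover have "(1/t) ^ (m+2) * exp (- (1/t)) * t^2 = flat m t"
    using True by (simp add: flat_def power_add field_simps power2_eq_square)
  ultimately show ?thesis by simp
qed (simp add: flat_def)

lemma DERIV_flat: "(flat m has_real_derivative flat (m + 2) t - m * flat (m + 1) t) (at t)"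
proof -
  consider "t > 0" | "t < 0" | "t = 0" by linarith
  then show ?thesis
  proof cases
    case 1
    have "((\<lambda>t. exp (- (1 / t)) / t ^ m) has_real_derivative flat (m + 2) t - m * flat (m + 1) t) (at t)"
      using 1 by (cases m) (auto intro!: derivative_eq_intros simp: flat_def field_simps power2_eq_square, metis One_nat_def power_eq_if)
    then show ?thesis
      by (rule has_field_derivative_transform_within_open[of _ _ _ "{0<..}"]) (use 1 in \<open>auto simp: flat_def\<close>)
  next
    case 2
    have "((\<lambda>t. 0) has_real_derivative flat (m + 2) t - m * flat (m + 1) t) (at t)"
      using 2 by (simp add: flat_def)
    then show ?thesis
      by (rule has_field_derivative_transform_within_open[of _ _ _ "{..<0}"]) (use 2 in \<open>auto simp: flat_def\<close>)
  next
    case 3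
    have "((\<lambda>h. (flat m (0 + h) - flat m 0) / h) \<longlongrightarrow> 0) (at 0)"
    proof (rule Lim_null_comparison)
      show "\<forall>\<^sub>F h in at 0. norm ((flat m (0 + h) - flat m 0) / h) \<le> fact (m + 2) * \<bar>h\<bar>"
      proof (intro always_eventually allI)
        fix h :: real
        show "norm ((flat m (0 + h) - flat m 0) / h) \<le> fact (m + 2) * \<bar>h\<bar>"
        proof (cases "h = 0")
          case False
          have "flat m h \<le> (fact (m + 2) * \<bar>h\<bar>) * \<bar>h\<bar>"
            using flat_le[of m h] by (simp add: power2_eq_square mult.assoc abs_mult_self_eq del: fact_Suc)
          then have "flat m h / \<bar>h\<bar> \<le> fact (m + 2) * \<bar>h\<bar>"
            using False by (subst pos_divide_le_eq) auto
          then show ?thesis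
            using flat_nonneg[of m h] by (simp add: flat_def[of _ 0] abs_divide del: fact_Suc)
        qed simp
      qed
      show "((\<lambda>h. fact (m + 2) * \<bar>h\<bar>) \<longlongrightarrow> 0) (at (0::real))"
        by (auto intro!: tendsto_eq_intros)
    qed
    then show ?thesis using 3 by (simp add: DERIV_def flat_def)
  qed
qed

lemma Ck_on_flat: "Ck_on k S (flat m)"
proof (rule Ck_on_subset[of _ UNIV])
  show "Ck_on k UNIV (flat m)"
  proof (induction k arbitrary: m)
    case 0
    show ?case by (auto intro!: continuous_at_imp_continuous_on DERIV_isCont[OF DERIV_flat])
  next
    case (Suc k)
    show ?case
      by (rule Ck_on_real_SucI[OF _ DERIV_flat]) (auto intro!: Ck_on_diff Ck_on_mult Ck_on_const Suc)
  qed
qed simp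

section \<open>Test functions\<close>

lemma test_functionI:
  assumes "\<And>k. Ck_on k UNIV f" "compact K" "K \<subseteq> \<Omega>" "\<And>x. x \<notin> K \<Longrightarrow> f x = 0"
  shows "f \<in> test_functions \<Omega>"
proof -
  have "closure {x. f x \<noteq> 0} \<subseteq> K"
    using assms by (intro closure_minimal compact_imp_closed) auto
  moreover then have "compact (closure {x. f x \<noteq> 0})"
    by (metis assms(2) closed_closure compact_Int_closed inf.absorb_iff2)
  ultimately show ?thesis using assms by (auto simp: test_functions_def C_k_eq_Ck_on)
qed

lemma test_Ck: "f \<in> test_functions \<Omega> \<Longrightarrow> Ck_on k UNIV f"
  by (simp add: test_functions_def C_k_eq_Ck_on)

lemma test_support:
  assumes "f \<in> test_functions \<Omega>"
  obtains K where "compact K" "K \<subseteq> \<Omega>" "\<And>x. x \<notin> K \<Longrightarrow> f x = 0"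
proof (rule that)
  show "f x = 0" if "x \<notin> closure {x. f x \<noteq> 0}" for x
    using closure_subset[of "{x. f x \<noteq> 0}"] that by auto
qed (use assms in \<open>simp_all add: test_functions_def\<close>)

lemma test_mono: "f \<in> test_functions A \<Longrightarrow> A \<subseteq> B \<Longrightarrow> f \<in> test_functions B"
  by (auto simp: test_functions_def)

lemma test_continuous: "f \<in> test_functions \<Omega> \<Longrightarrow> continuous_on S f"
  using Ck_on_imp_continuous_on[OF test_Ck] continuous_on_subset by blast

lemma test_measurable [measurable (raw)]:
  "f \<in> test_functions \<Omega> \<Longrightarrow> f \<in> borel_measurable borel"
  by (intro borel_measurable_continuous_onI test_continuous)

lemma test_mult:
  assumes "f \<in> test_functions \<Omega>" "\<And>k. Ck_on k UNIV g"
  shows "(\<lambda>x. f x * g x) \<in> test_functions \<Omega>"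
proof -
  obtain K where K: "compact K" "K \<subseteq> \<Omega>" "\<And>x. x \<notin> K \<Longrightarrow> f x = 0"
    using test_support[OF assms(1)] by blast
  show ?thesis
    by (rule test_functionI[OF _ K(1,2)]) (auto intro!: Ck_on_mult test_Ck[OF assms(1)] assms(2) simp: K)
qed

lemma test_scale: "f \<in> test_functions \<Omega> \<Longrightarrow> (\<lambda>x. c * f x) \<in> test_functions \<Omega>"
  using test_mult[OF _ Ck_on_const, of f \<Omega> c] by (simp add: mult.commute)

lemma test_add:
  assumes "f \<in> test_functions \<Omega>" "g \<in> test_functions \<Omega>"
  shows "(\<lambda>x. f x + g x) \<in> test_functions \<Omega>"
proof -
  obtain K where K: "compact K" "K \<subseteq> \<Omega>" "\<And>x. x \<notin> K \<Longrightarrow> f x = 0"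
    using test_support[OF assms(1)] by blast
  obtain L where L: "compact L" "L \<subseteq> \<Omega>" "\<And>x. x \<notin> L \<Longrightarrow> g x = 0"
    using test_support[OF assms(2)] by blast
  show ?thesis
    by (rule test_functionI[where K="K \<union> L"])
      (auto intro!: Ck_on_add test_Ck[OF assms(1)] test_Ck[OF assms(2)] simp: K L subsetD[OF K(2)] subsetD[OF L(2)])
qed

lemma test_zero: "(\<lambda>x. 0) \<in> test_functions \<Omega>"
  by (rule test_functionI[where K="{}"]) (auto intro: Ck_on_const)

lemma test_sum:
  "(\<And>i. i \<in> I \<Longrightarrow> f i \<in> test_functions \<Omega>) \<Longrightarrow> (\<lambda>x. \<Sum>i\<in>I. f i x) \<in> test_functions \<Omega>"
  by (induction I rule: infinite_finite_induct) (auto intro!: test_add test_zero)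

lemma test_bounded:
  assumes "f \<in> test_functions \<Omega>"
  obtains B where "0 \<le> B" "\<And>x. \<bar>f x\<bar> \<le> B"
proof -
  obtain K where K: "compact K" "K \<subseteq> \<Omega>" "\<And>x. x \<notin> K \<Longrightarrow> f x = 0"
    using test_support[OF assms] by blast
  have "bounded (f ` K)"
    by (intro compact_imp_bounded compact_continuous_image test_continuous[OF assms] K)
  then obtain B where B: "\<And>x. x \<in> K \<Longrightarrow> \<bar>f x\<bar> \<le> B" by (auto simp: bounded_iff)
  show ?thesis
  proof (rule that[of "max 0 B"])
    show "\<bar>f x\<bar> \<le> max 0 B" for x using B[of x] K(3)[of x] by (cases "x \<in> K") auto
  qed simp
qed

lemma test_partial_deriv:
  assumes "f \<in> test_functions \<Omega>" "i \<in> Basis"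
  shows "partial_deriv i f \<in> test_functions \<Omega>"
proof -
  obtain K where K: "compact K" "K \<subseteq> \<Omega>" "\<And>x. x \<notin> K \<Longrightarrow> f x = 0"
    using test_support[OF assms(1)] by blast
  have "partial_deriv i f x = 0" if "x \<notin> K" for x
  proof -
    have "(f has_derivative (\<lambda>_. 0)) (at x)"
      by (rule has_derivative_transform_within_open[of "\<lambda>_. 0" _ _ _ "- K"])
        (use that K in \<open>auto intro: compact_imp_closed\<close>)
    then show ?thesis by (rule partial_deriv_eq)
  qed
  moreover have "Ck_on k UNIV (partial_deriv i f)" for k
    using test_Ck[OF assms(1), of "Suc k"] assms(2) by simp
  ultimately show ?thesis using K by (intro test_functionI) auto
qed

text \<open>The usual transition from 0 to 1 across [0,1]. The denominator is positive everywhere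
  because t and 1 - t are never both nonpositive.\<close>

definition smooth_step :: "real \<Rightarrow> real" where
  "smooth_step t = flat 0 t * inverse (flat 0 t + flat 0 (1 - t))"

lemma flat_pos_iff: "flat m t > 0 \<longleftrightarrow> t > 0"
  by (simp add: flat_def)

lemma Ck_on_smooth_step: "Ck_on k UNIV smooth_step"
proof -
  have "flat 0 t + flat 0 (1 - t) > 0" for t
    using flat_nonneg[of 0 t] flat_nonneg[of 0 "1 - t"] flat_pos_iff[of 0 t] flat_pos_iff[of 0 "1 - t"]
    by (cases "t > 0") (auto intro: add_pos_nonneg add_nonneg_pos)
  moreover have "Ck_on k UNIV (\<lambda>t. flat 0 (1 - t))"
    by (rule Ck_on_compose[of _ UNIV])
      (use Ck_on_inner_left[of k UNIV "1::real"] in \<open>auto intro!: Ck_on_flat Ck_on_diff Ck_on_const\<close>)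
  ultimately show ?thesis
    unfolding smooth_step_def[abs_def]
    by (intro Ck_on_mult Ck_on_inverse Ck_on_add Ck_on_flat) auto
qed

lemma smooth_step_0: "t \<le> 0 \<Longrightarrow> smooth_step t = 0"
  by (simp add: smooth_step_def flat_def)

lemma smooth_step_1: "t \<ge> 1 \<Longrightarrow> smooth_step t = 1"
  by (simp add: smooth_step_def flat_def)

lemma smooth_step_bounds: "0 \<le> smooth_step t" "smooth_step t \<le> 1"
  using flat_nonneg[of 0 t] flat_nonneg[of 0 "1 - t"]
  by (auto simp: smooth_step_def divide_inverse[symmetric] divide_le_eq_1)

text \<open>The argument is r^2 - |x - a|^2 expanded into inner products, so that smoothness is read
  off from the rules for sums and products.\<close>

definition bump :: "'a::euclidean_space \<Rightarrow> real \<Rightarrow> 'a \<Rightarrow> real" where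
  "bump a r x = flat 0 (r\<^sup>2 - (x \<bullet> x - 2 * (x \<bullet> a) + a \<bullet> a))"

lemma bump_eq: "bump a r x = flat 0 (r\<^sup>2 - (norm (x - a))\<^sup>2)"
  by (simp add: bump_def power2_norm_eq_inner inner_diff inner_commute algebra_simps)

lemma bump_nonneg: "bump a r x \<ge> 0" by (simp add: bump_def flat_nonneg)

lemma bump_pos_iff: "r > 0 \<Longrightarrow> bump a r x > 0 \<longleftrightarrow> x \<in> ball a r"
  by (auto simp: bump_eq flat_pos_iff dist_norm norm_minus_commute intro: power_strict_mono dest: power2_less_imp_less)

lemma bump_test_function:
  assumes "r > 0" "cball a r \<subseteq> \<Omega>"
  shows "bump a r \<in> test_functions \<Omega>"
proof (rule test_functionI[OF _ compact_cball assms(2)])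
  show "Ck_on k UNIV (bump a r)" for k
    unfolding bump_def[abs_def]
    by (rule Ck_on_compose[of _ UNIV])
      (auto intro!: Ck_on_flat Ck_on_add Ck_on_diff Ck_on_mult Ck_on_const Ck_on_inner_left Ck_on_inner_self)
  show "bump a r x = 0" if "x \<notin> cball a r" for x
    using that bump_pos_iff[OF assms(1), of a x] bump_nonneg[of a r x] by force
qed

text \<open>Finitely many bumps cover \<open>K\<close>, so their sum is positive there. Dividing the
  sum by its minimum over \<open>K\<close> before applying \<open>smooth_step\<close> makes the
  value exactly 1 on \<open>K\<close> and leaves 0 where the sum vanishes.\<close>

lemma test_urysohn:
  assumes "compact K" "open U" "K \<subseteq> U"
  obtains f where "f \<in> test_functions U" "\<And>x. 0 \<le> f x" "\<And>x. f x \<le> 1" "\<And>x. x \<in> K \<Longrightarrow> f x = 1"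
proof (cases "K = {}")
  case True
  then show ?thesis using that[of "\<lambda>_. 0"] by (simp add: test_zero)
next
  case False
  have "\<exists>r>0. cball x r \<subseteq> U" if "x \<in> K" for x
    using assms that open_contains_cball by blast
  then obtain r where r: "\<And>x. x \<in> K \<Longrightarrow> r x > 0 \<and> cball x (r x) \<subseteq> U" by metis
  have "K \<subseteq> (\<Union>x\<in>K. ball x (r x))" using r by force
  then obtain D where D: "D \<subseteq> K" "finite D" "K \<subseteq> (\<Union>x\<in>D. ball x (r x))"
    using compactE_image[OF assms(1), of K "\<lambda>x. ball x (r x)"] by auto
  define f0 where "f0 = (\<lambda>x. \<Sum>a\<in>D. bump a (r a) x)"
  have f0: "f0 \<in> test_functions U"
    unfolding f0_def using r D by (intro test_sum bump_test_function) auto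
  have pos: "f0 x > 0" if x: "x \<in> K" for x
  proof -
    obtain a where a: "a \<in> D" "x \<in> ball a (r a)" using D x by blast
    have "0 < bump a (r a) x" using a bump_pos_iff r D by blast
    also have "\<dots> \<le> f0 x" unfolding f0_def
      using a D by (intro member_le_sum) (auto simp: bump_nonneg)
    finally show ?thesis .
  qed
  obtain x0 where x0: "x0 \<in> K" "\<And>x. x \<in> K \<Longrightarrow> f0 x0 \<le> f0 x"
    using continuous_attains_inf[OF assms(1) False test_continuous[OF f0]] by blast
  define f where "f = (\<lambda>x. smooth_step (inverse (f0 x0) * f0 x))"
  obtain L where L: "compact L" "L \<subseteq> U" "\<And>x. x \<notin> L \<Longrightarrow> f0 x = 0"
    using test_support[OF f0] by blast
  show ?thesis
  proof (rule that)
    show "f \<in> test_functions U"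
    proof (rule test_functionI[OF _ L(1,2)])
      show "Ck_on k UNIV f" for k
        unfolding f_def
        by (rule Ck_on_compose[of _ UNIV])
          (auto intro!: Ck_on_smooth_step Ck_on_mult Ck_on_const test_Ck[OF f0])
      show "f x = 0" if "x \<notin> L" for x using L that by (simp add: f_def smooth_step_0)
    qed
    show "f x = 1" if "x \<in> K" for x
      unfolding f_def using x0(2)[OF that] pos[OF x0(1)]
      by (intro smooth_step_1) (simp add: field_simps)
  qed (simp_all add: f_def smooth_step_bounds)
qed

section \<open>Positive distributions are Radon measures\<close>

text \<open>The interval [0,t] is cut into unit slices, and the slice above j contributes its
  length. This compares a function with a sum of cutoffs at its integer levels.\<close>

lemma sum_clamp:
  fixes t :: real
  assumes "t \<ge> 0"
  shows "(\<Sum>j<J. max 0 (min 1 (t - real j))) = min t (real J)"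
  using assms by (induction J) (auto simp: min_def max_def)

text \<open>The setting of the Riesz-Markov construction. The axioms speak of test functions only,
  so every auxiliary function below has to be smooth with compact support in
  \<open>\<Omega>\<close>.\<close>

locale positive_distribution =
  fixes \<Omega> :: "'a::euclidean_space set" and T :: "('a \<Rightarrow> real) \<Rightarrow> real"
  assumes open_domain: "open \<Omega>"
    and T_add: "f \<in> test_functions \<Omega> \<Longrightarrow> g \<in> test_functions \<Omega> \<Longrightarrow> T (\<lambda>x. f x + g x) = T f + T g"
    and T_scale: "f \<in> test_functions \<Omega> \<Longrightarrow> T (\<lambda>x. c * f x) = c * T f"
    and T_nonneg: "f \<in> test_functions \<Omega> \<Longrightarrow> (\<And>x. 0 \<le> f x) \<Longrightarrow> 0 \<le> T f"
begin

lemma T_mono: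
  assumes "f \<in> test_functions \<Omega>" "g \<in> test_functions \<Omega>" "\<And>x. f x \<le> g x"
  shows "T f \<le> T g"
proof -
  have "T (\<lambda>x. g x + (-1) * f x) = T g + (-1) * T f"
    using T_add[OF assms(2) test_scale[OF assms(1), of "-1"]] T_scale[OF assms(1), of "-1"] by simp
  moreover have "0 \<le> T (\<lambda>x. g x + (-1) * f x)"
    using assms by (intro T_nonneg test_add test_scale) auto
  ultimately show ?thesis by simp
qed

lemma T_sum:
  "finite I \<Longrightarrow> (\<And>i. i \<in> I \<Longrightarrow> f i \<in> test_functions \<Omega>) \<Longrightarrow> T (\<lambda>x. \<Sum>i\<in>I. f i x) = (\<Sum>i\<in>I. T (f i))"
proof (induction I rule: finite_induct)
  case empty
  then show ?case using T_scale[OF test_zero, of 0] by simp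
next
  case (insert i I)
  then show ?case by (simp add: T_add test_sum)
qed

text \<open>The Riesz content of an open set. Intersecting with \<open>\<Omega>\<close> makes it
  meaningful in the whole space, so that the resulting measure lives on all Borel sets and open sets
  missing \<open>\<Omega>\<close> get mass 0.\<close>

definition open_mass :: "'a set \<Rightarrow> ennreal" where
  "open_mass U = (SUP f\<in>{f \<in> test_functions (U \<inter> \<Omega>). \<forall>x. 0 \<le> f x \<and> f x \<le> 1}. ennreal (T f))"

lemma open_mass_upper:
  "f \<in> test_functions (U \<inter> \<Omega>) \<Longrightarrow> (\<And>x. 0 \<le> f x) \<Longrightarrow> (\<And>x. f x \<le> 1) \<Longrightarrow> ennreal (T f) \<le> open_mass U"
  unfolding open_mass_def by (intro SUP_upper) auto

lemma open_mass_least: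
  assumes "\<And>f. f \<in> test_functions (U \<inter> \<Omega>) \<Longrightarrow> (\<And>x. 0 \<le> f x) \<Longrightarrow> (\<And>x. f x \<le> 1) \<Longrightarrow> ennreal (T f) \<le> c"
  shows "open_mass U \<le> c"
  unfolding open_mass_def using assms by (intro SUP_least) auto

lemma open_mass_mono: "U \<subseteq> V \<Longrightarrow> open_mass U \<le> open_mass V"
  by (intro open_mass_least open_mass_upper) (auto elim: test_mono)

lemma test_Int_domain: "f \<in> test_functions (U \<inter> \<Omega>) \<Longrightarrow> f \<in> test_functions \<Omega>"
  by (erule test_mono) auto

text \<open>A function competing in \<open>open_mass U\<close> vanishes off \<open>U\<close> and is
  at most 1, so it lies below \<open>g\<close>.\<close>

lemma open_mass_le:
  assumes "g \<in> test_functions \<Omega>" "\<And>x. 0 \<le> g x" "\<And>x. x \<in> U \<Longrightarrow> 1 \<le> g x"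
  shows "open_mass U \<le> ennreal (T g)"
proof (rule open_mass_least)
  fix f assume f: "f \<in> test_functions (U \<inter> \<Omega>)" "\<And>x. 0 \<le> f x" "\<And>x. f x \<le> (1::real)"
  obtain K where K: "compact K" "K \<subseteq> U \<inter> \<Omega>" "\<And>x. x \<notin> K \<Longrightarrow> f x = 0"
    using test_support[OF f(1)] by blast
  have "f x \<le> g x" for x
    using f(3)[of x] assms(2,3)[of x] K by (cases "x \<in> K") force+
  then show "ennreal (T f) \<le> ennreal (T g)"
    by (intro ennreal_leI T_mono assms test_Int_domain[OF f(1)])
qed

text \<open>A partition of unity on the support \<open>K\<close>. It is found by splitting
  \<open>K\<close> at the level 1/2 of a function \<open>g\<close> that is supported in
  \<open>U\<close> and equals 1 on \<open>K - V\<close>: the part with g >= 1/2 lies in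
  \<open>U\<close>, and the part with g <= 1/2 lies in \<open>V\<close>.\<close>

lemma open_mass_Un:
  assumes "open U" "open V"
  shows "open_mass (U \<union> V) \<le> open_mass U + open_mass V"
proof (rule open_mass_least)
  fix f assume f: "f \<in> test_functions ((U \<union> V) \<inter> \<Omega>)" "\<And>x. 0 \<le> f x" "\<And>x. f x \<le> (1::real)"
  obtain K where K: "compact K" "K \<subseteq> (U \<union> V) \<inter> \<Omega>" "\<And>x. x \<notin> K \<Longrightarrow> f x = 0"
    using test_support[OF f(1)] by blast
  have 1: "compact (K - V)" "K - V \<subseteq> U \<inter> \<Omega>" using K assms by (auto intro: compact_diff)
  obtain g where g: "g \<in> test_functions (U \<inter> \<Omega>)" "\<And>x. x \<in> K - V \<Longrightarrow> g x = 1"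
    using test_urysohn[OF 1(1) open_Int[OF assms(1) open_domain] 1(2)] by metis
  have gc: "continuous_on UNIV g" by (rule test_continuous[OF g(1)])
  define K1 where "K1 = K \<inter> {x. 1/2 \<le> g x}"
  define K2 where "K2 = K \<inter> {x. g x \<le> 1/2}"
  have cl: "closed {x. 1/2 \<le> g x}" "closed {x. g x \<le> 1/2}"
    by (rule closed_Collect_le; intro continuous_on_const gc)+
  obtain L where L: "L \<subseteq> U \<inter> \<Omega>" "\<And>x. x \<notin> L \<Longrightarrow> g x = 0"
    using test_support[OF g(1)] by metis
  have *: "x \<in> L" if "1/2 \<le> g x" for x using L(2)[of x] that by force
  have K1: "compact K1" "K1 \<subseteq> U \<inter> \<Omega>" unfolding K1_def
    using compact_Int_closed[OF K(1) cl(1)] L(1) * by auto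
  have "x \<in> V" if "x \<in> K" "g x \<le> 1/2" for x
    using g(2)[of x] that by force
  then have K2: "compact K2" "K2 \<subseteq> V \<inter> \<Omega>" unfolding K2_def
    using compact_Int_closed[OF K(1) cl(2)] K(2) by auto
  obtain g1 where g1: "g1 \<in> test_functions (U \<inter> \<Omega>)" "\<And>x. 0 \<le> g1 x" "\<And>x. g1 x \<le> 1" "\<And>x. x \<in> K1 \<Longrightarrow> g1 x = 1"
    using test_urysohn[OF K1(1) open_Int[OF assms(1) open_domain] K1(2)] by metis
  obtain g2 where g2: "g2 \<in> test_functions (V \<inter> \<Omega>)" "\<And>x. 0 \<le> g2 x" "\<And>x. g2 x \<le> 1" "\<And>x. x \<in> K2 \<Longrightarrow> g2 x = 1"
    using test_urysohn[OF K2(1) open_Int[OF assms(2) open_domain] K2(2)] by metis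
  \<comment> \<open>The factor \<open>1 - g1\<close> makes the two pieces add up to
    \<open>f\<close>: on \<open>K1\<close> the second one vanishes because g1 = 1, and on
    \<open>K2\<close> the factor \<open>g2\<close> is 1.\<close>
  let ?f1 = "\<lambda>x. g1 x * f x" and ?f2 = "\<lambda>x. g2 x * ((1 - g1 x) * f x)"
  have C: "Ck_on k UNIV f" "Ck_on k UNIV g1" for k
    using f(1) g1(1) by (auto intro: test_Ck)
  have f1: "?f1 \<in> test_functions (U \<inter> \<Omega>)" "\<And>x. 0 \<le> ?f1 x" "\<And>x. ?f1 x \<le> 1"
    using test_mult[OF g1(1) C(1)] mult_nonneg_nonneg[OF g1(2) f(2)] mult_le_one[OF g1(3) f(2) f(3)]
    by auto
  have "Ck_on k UNIV (\<lambda>x. (1 - g1 x) * f x)" for k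
    by (intro Ck_on_mult Ck_on_diff Ck_on_const C open_UNIV)
  from test_mult[OF g2(1) this]
  have f2: "?f2 \<in> test_functions (V \<inter> \<Omega>)" "\<And>x. 0 \<le> ?f2 x" "\<And>x. ?f2 x \<le> 1"
    using g1 g2 f by (auto intro!: mult_le_one mult_nonneg_nonneg)
  have "f x = ?f1 x + ?f2 x" for x
  proof (cases "x \<in> K")
    case True
    then consider "x \<in> K1" | "x \<in> K2" unfolding K1_def K2_def by force
    then show ?thesis using g1(4) g2(4) by cases (auto simp: algebra_simps)
  qed (simp add: K)
  then have "f = (\<lambda>x. ?f1 x + ?f2 x)" by (rule ext)
  then have "T f = T (\<lambda>x. ?f1 x + ?f2 x)" by (rule arg_cong)
  then have "T f = T ?f1 + T ?f2"
    by (simp only: T_add[OF test_Int_domain[OF f1(1)] test_Int_domain[OF f2(1)]])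
  then have "ennreal (T f) = ennreal (T ?f1) + ennreal (T ?f2)"
    using T_nonneg[OF test_Int_domain[OF f1(1)] f1(2)] T_nonneg[OF test_Int_domain[OF f2(1)] f2(2)]
    by (simp add: ennreal_plus)
  also have "\<dots> \<le> open_mass U + open_mass V"
    using f1 f2 by (intro add_mono open_mass_upper) auto
  finally show "ennreal (T f) \<le> open_mass U + open_mass V" .
qed

lemma open_mass_empty: "open_mass {} = 0"
  using open_mass_le[OF test_zero, of "{}"] T_scale[OF test_zero, of 0] by simp

lemma open_mass_UN_finite:
  assumes "finite I" "\<And>i. i \<in> I \<Longrightarrow> open (U i)"
  shows "open_mass (\<Union>i\<in>I. U i) \<le> (\<Sum>i\<in>I. open_mass (U i))"
  using assms
proof (induction I rule: finite_induct)
  case (insert i I)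
  have "open_mass (U i \<union> (\<Union>i\<in>I. U i)) \<le> open_mass (U i) + open_mass (\<Union>i\<in>I. U i)"
    using insert by (intro open_mass_Un) auto
  also have "\<dots> \<le> open_mass (U i) + (\<Sum>i\<in>I. open_mass (U i))"
    using insert by (intro add_left_mono) auto
  finally show ?case using insert by simp
qed (simp add: open_mass_empty)

text \<open>Compactness of the support reduces the countable cover to a finite one.\<close>

lemma open_mass_UN:
  fixes U :: "nat \<Rightarrow> 'a set"
  assumes "\<And>i. open (U i)"
  shows "open_mass (\<Union>i. U i) \<le> (\<Sum>i. open_mass (U i))"
proof (rule open_mass_least)
  fix f assume f: "f \<in> test_functions ((\<Union>i. U i) \<inter> \<Omega>)" "\<And>x. 0 \<le> f x" "\<And>x. f x \<le> (1::real)"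
  obtain K where K: "compact K" "K \<subseteq> (\<Union>i. U i) \<inter> \<Omega>" "\<And>x. x \<notin> K \<Longrightarrow> f x = 0"
    using test_support[OF f(1)] by blast
  obtain D where D: "finite D" "K \<subseteq> (\<Union>i\<in>D. U i)"
    using compactE_image[OF K(1), of UNIV U] assms K by auto
  have "f \<in> test_functions ((\<Union>i\<in>D. U i) \<inter> \<Omega>)"
    by (rule test_functionI[OF _ K(1)]) (use test_Ck[OF f(1)] K D in auto)
  then have "ennreal (T f) \<le> open_mass (\<Union>i\<in>D. U i)"
    using f by (intro open_mass_upper) auto
  also have "\<dots> \<le> (\<Sum>i\<in>D. open_mass (U i))" by (intro open_mass_UN_finite D assms)
  also have "\<dots> \<le> (\<Sum>i. open_mass (U i))" by (intro sum_le_suminf D) auto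
  finally show "ennreal (T f) \<le> (\<Sum>i. open_mass (U i))" .
qed

section \<open>The outer measure and measurability of open sets\<close>

definition mass :: "'a set \<Rightarrow> ennreal" where
  "mass A = (INF U\<in>{U. open U \<and> A \<subseteq> U}. open_mass U)"

lemma mass_open: "open U \<Longrightarrow> mass U = open_mass U"
  unfolding mass_def by (intro antisym INF_greatest INF_lower) (auto intro: open_mass_mono)

lemma mass_mono: "A \<subseteq> B \<Longrightarrow> mass A \<le> mass B"
  unfolding mass_def by (intro INF_superset_mono) auto

lemma mass_le: "open U \<Longrightarrow> A \<subseteq> U \<Longrightarrow> mass A \<le> open_mass U"
  unfolding mass_def by (intro INF_lower) auto

lemma mass_UN:
  fixes A :: "nat \<Rightarrow> 'a set"
  shows "mass (\<Union>i. A i) \<le> (\<Sum>i. mass (A i))"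
proof (rule ennreal_le_epsilon)
  fix e :: real assume e: "0 < e" "(\<Sum>n. mass (A n)) < top"
  then have *: "\<And>n. mass (A n) < mass (A n) + e * (1/2)^Suc n"
    by (auto simp add: less_top dest!: ennreal_suminf_lessD)
  have "\<exists>U. open U \<and> A n \<subseteq> U \<and> open_mass U < mass (A n) + e * (1/2)^Suc n" for n
    using *[of n] unfolding mass_def[of "A n"] INF_less_iff by auto
  then obtain U where U: "\<And>n. open (U n)" "\<And>n. A n \<subseteq> U n"
    "\<And>n. open_mass (U n) \<le> mass (A n) + e * (1/2)^Suc n"
    by (metis less_imp_le)
  have "mass (\<Union>i. A i) \<le> open_mass (\<Union>i. U i)"
    using U by (intro mass_le) auto
  also have "\<dots> \<le> (\<Sum>i. open_mass (U i))" by (intro open_mass_UN U)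
  also have "\<dots> \<le> (\<Sum>n. mass (A n) + e * (1/2) ^ Suc n)"
    by (intro suminf_le allI U) auto
  also have "... = (\<Sum>n. mass (A n)) + (\<Sum>n. ennreal e * ennreal ((1/2) ^ Suc n))"
    using \<open>0 < e\<close> by (subst suminf_add[symmetric])
                     (auto simp del: ennreal_suminf_cmult simp add: ennreal_mult[symmetric])
  also have "\<dots> = (\<Sum>n. mass (A n)) + e"
    unfolding ennreal_suminf_cmult
    by (subst suminf_ennreal_eq[OF zero_le_power power_half_series]) auto
  finally show "mass (\<Union>i. A i) \<le> (\<Sum>n. mass (A n)) + e" .
qed

lemma outer_measure_space_mass: "outer_measure_space UNIV mass"
  unfolding outer_measure_space_def positive_def increasing_def countably_subadditive_def
  using mass_UN mass_mono mass_open[of "{}"] by (auto simp: open_mass_empty)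

text \<open>Let \<open>V\<close> be an open set containing \<open>A\<close>. If \<open>f\<close> has
  its support \<open>K\<close> in V \<inter> U, then \<open>V - K\<close> is an open neighbourhood
  of \<open>A - U\<close>, and any \<open>g\<close> supported in \<open>V - K\<close> has support
  disjoint from that of \<open>f\<close>. So \<open>f + g\<close> still competes for
  \<open>V\<close>. Taking suprema first over \<open>g\<close>, then over \<open>f\<close>, gives
  the claim.\<close>

lemma mass_split_open:
  assumes "open U"
  shows "mass (A \<inter> U) + mass (A - U) \<le> mass A"
proof -
  have "mass (A \<inter> U) + mass (A - U) \<le> open_mass V" if V: "open V" "A \<subseteq> V" for V
  proof -
    have *: "ennreal (T f) + mass (A - U) \<le> open_mass V"
      if f: "f \<in> test_functions ((V \<inter> U) \<inter> \<Omega>)" "\<And>x. 0 \<le> f x" "\<And>x. f x \<le> 1" for f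
    proof -
      obtain K where K: "compact K" "K \<subseteq> (V \<inter> U) \<inter> \<Omega>" "\<And>x. x \<notin> K \<Longrightarrow> f x = 0"
        using test_support[OF f(1)] by blast
      have "ennreal (T f) + mass (A - U) \<le> ennreal (T f) + open_mass (V - K)"
      proof (intro add_left_mono mass_le)
        show "open (V - K)" using V K by (intro open_Diff compact_imp_closed)
        show "A - U \<subseteq> V - K" using V K(2) by blast
      qed
      also have "\<dots> = (SUP g\<in>{g \<in> test_functions ((V - K) \<inter> \<Omega>). \<forall>x. 0 \<le> g x \<and> g x \<le> 1}. ennreal (T f) + ennreal (T g))"
        unfolding open_mass_def
        by (rule ennreal_SUP_add_right) (auto intro!: exI[of _ "\<lambda>_. 0"] test_zero)
      also have "\<dots> \<le> open_mass V"
      proof (rule SUP_least, clarify)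
        fix g assume g: "g \<in> test_functions ((V - K) \<inter> \<Omega>)" "\<forall>x. 0 \<le> g x \<and> g x \<le> 1"
        obtain L where L: "L \<subseteq> (V - K) \<inter> \<Omega>" "\<And>x. x \<notin> L \<Longrightarrow> g x = 0"
          using test_support[OF g(1)] by metis
        have fg: "f \<in> test_functions (V \<inter> \<Omega>)" "g \<in> test_functions (V \<inter> \<Omega>)"
          using f(1) g(1) by (auto elim!: test_mono)
        have "ennreal (T f) + ennreal (T g) = ennreal (T (\<lambda>x. f x + g x))"
          using fg[THEN test_Int_domain] f g by (simp add: T_add T_nonneg ennreal_plus)
        also have "\<dots> \<le> open_mass V"
        proof (rule open_mass_upper)
          show "f x + g x \<le> 1" for x
          proof (cases "x \<in> K")
            case True
            then have "x \<notin> L" using L(1) by blast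
            then show ?thesis using f(3)[of x] L(2) by simp
          next
            case False
            then show ?thesis using g(2) K(3) by simp
          qed
        qed (use f g fg in \<open>auto intro: test_add\<close>)
        finally show "ennreal (T f) + ennreal (T g) \<le> open_mass V" .
      qed
      finally show ?thesis .
    qed
    have "mass (A \<inter> U) + mass (A - U) \<le> open_mass (V \<inter> U) + mass (A - U)"
      using V assms by (intro add_right_mono mass_le) auto
    also have "\<dots> = (SUP f\<in>{f \<in> test_functions ((V \<inter> U) \<inter> \<Omega>). \<forall>x. 0 \<le> f x \<and> f x \<le> 1}. ennreal (T f) + mass (A - U))"
      unfolding open_mass_def
      by (rule ennreal_SUP_add_left[symmetric]) (auto intro!: exI[of _ "\<lambda>_. 0"] test_zero)
    also have "\<dots> \<le> open_mass V" using * by (intro SUP_least) auto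
    finally show ?thesis .
  qed
  then show ?thesis unfolding mass_def[of A] by (intro INF_greatest) auto
qed

lemma measure_space_mass: "measure_space UNIV (sets borel) mass"
proof -
  have "U \<in> lambda_system UNIV UNIV mass" if "open U" for U
  proof -
    have "mass A \<le> mass (A \<inter> U) + mass (A - U)" for A
    proof -
      \<comment> \<open>\<open>binaryset\<close> continues two sets by empty ones, which turns
        countable subadditivity into subadditivity for two sets.\<close>
      have "mass A = mass (\<Union>i. binaryset (A \<inter> U) (A - U) i)"
        by (simp only: UN_binaryset_eq Int_Diff_Un)
      also have "\<dots> \<le> (\<Sum>i. mass (binaryset (A \<inter> U) (A - U) i))" by (rule mass_UN)
      also have "\<dots> = mass (A \<inter> U) + mass (A - U)"
        by (rule suminf_binaryset_eq) (simp add: mass_open open_mass_empty)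
      finally show ?thesis .
    qed
    then have "mass (A \<inter> U) + mass (A - U) = mass A" for A
      by (intro antisym mass_split_open that)
    then show ?thesis unfolding lambda_system_def by (auto simp: Int_commute Diff_eq)
  qed
  moreover have ms: "measure_space UNIV (lambda_system UNIV UNIV mass) mass"
    using sigma_algebra.caratheodory_lemma[OF sigma_algebra_Pow, of UNIV mass] outer_measure_space_mass by simp
  then have sa: "sigma_algebra UNIV (lambda_system UNIV UNIV mass)" by (simp add: measure_space_def)
  ultimately have "sigma_sets UNIV {U. open U} \<subseteq> lambda_system UNIV UNIV mass"
    by (intro sigma_algebra.sigma_sets_subset) auto
  then have "sets borel \<subseteq> lambda_system UNIV UNIV mass"
    by (simp add: borel_def)
  then show ?thesis
    using sets.sigma_algebra_axioms[of borel] by (intro measure_down[OF ms]) auto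
qed

section \<open>The representing measure\<close>

definition rep_measure :: "'a measure" where
  "rep_measure = measure_of UNIV (sets borel) mass"

lemma sets_rep_measure [simp, measurable_cong]: "sets rep_measure = sets borel"
  unfolding rep_measure_def by (metis sets.sets_measure_of_eq space_borel)

lemma space_rep_measure [simp]: "space rep_measure = UNIV"
  unfolding rep_measure_def by (metis sets.space_measure_of_eq space_borel)

lemma emeasure_rep_measure: "A \<in> sets borel \<Longrightarrow> emeasure rep_measure A = mass A"
  using measure_space_mass unfolding rep_measure_def
  by (intro emeasure_measure_of_sigma) (auto simp: measure_space_def)

lemma emeasure_rep_measure_open: "open U \<Longrightarrow> emeasure rep_measure U = open_mass U"
  by (simp add: emeasure_rep_measure mass_open)

lemma rep_measure_compact:
  assumes "compact K" "K \<subseteq> \<Omega>"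
  shows "emeasure rep_measure K < \<infinity>"
proof -
  obtain f where f: "f \<in> test_functions \<Omega>" "\<And>x. 0 \<le> f x" "\<And>x. x \<in> K \<Longrightarrow> f x = 1"
    using test_urysohn[OF assms(1) open_domain assms(2)] by metis
  \<comment> \<open>The content can be estimated on open sets; on this neighbourhood of
    \<open>K\<close> the test function 2 f is at least 1.\<close>
  have o: "open {x. 1/2 < f x}"
    by (intro open_Collect_less continuous_intros test_continuous[OF f(1)])
  have "emeasure rep_measure K \<le> emeasure rep_measure {x. 1/2 < f x}"
    using o f assms by (intro emeasure_mono) auto
  also have "\<dots> \<le> ennreal (T (\<lambda>x. 2 * f x))"
    unfolding emeasure_rep_measure_open[OF o]
    using f by (intro open_mass_le test_scale) auto
  finally show ?thesis by (rule le_less_trans) simp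
qed

text \<open>The functions \<open>\<theta> j\<close> lie between the indicators of \<open>{N f > j + 1}\<close> and \<open>{N f > j - 1}\<close>, and their sum
  differs from \<open>N f\<close> by at most 1. Hence \<open>N T(f)\<close> and \<open>N \<integral> f\<close> differ by a bound independent of \<open>N\<close>.\<close>

lemma rep_measure_nn_integral:
  assumes f: "f \<in> test_functions \<Omega>" "\<And>x. 0 \<le> f x"
  shows "(\<integral>\<^sup>+x. ennreal (f x) \<partial>rep_measure) = ennreal (T f)"
proof -
  obtain K where K: "compact K" "K \<subseteq> \<Omega>" "\<And>x. x \<notin> K \<Longrightarrow> f x = 0"
    using test_support[OF f(1)] by blast
  obtain B where B: "0 \<le> B" "\<And>x. \<bar>f x\<bar> \<le> B" using test_bounded[OF f(1)] by blast
  obtain \<xi> where \<xi>: "\<xi> \<in> test_functions \<Omega>" "\<And>x. 0 \<le> \<xi> x" "\<And>x. \<xi> x \<le> 1" "\<And>x. x \<in> K \<Longrightarrow> \<xi> x = 1"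
    using test_urysohn[OF K(1) open_domain K(2)] by metis
  have fK: "f x > 0 \<Longrightarrow> x \<in> K" for x using K(3)[of x] by force
  let ?I = "\<integral>\<^sup>+x. ennreal (f x) \<partial>rep_measure"
  \<comment> \<open>Three copies of \<open>\<xi>\<close> cover all losses: one for rounding
    \<open>N * f\<close> to the sum of the \<open>\<theta> j\<close>, and two for shifting the index
    of the levels by one, once in \<open>\<theta>\<close> and once in \<open>L\<close>.\<close>
  have main: "of_nat N * ?I \<le> ennreal (N * T f + 3 * T \<xi>) \<and> ennreal (N * T f) \<le> of_nat N * ?I + ennreal (3 * T \<xi>)"
    if N: "N > 0" for N :: nat
  proof -
    \<comment> \<open>Large enough that the levels below \<open>J\<close> exhaust the range of
      \<open>N * f\<close>.\<close>
    define J where "J = nat \<lceil>N * B\<rceil>"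
    have J: "N * f x \<le> J" for x
    proof -
      have "N * f x \<le> N * B" using B(2)[of x] by (intro mult_left_mono) auto
      then show ?thesis unfolding J_def by linarith
    qed
    define L where "L = (\<lambda>j::nat. {x. real j < N * f x})"
    have oL: "open (L j)" for j unfolding L_def
      by (intro open_Collect_less continuous_intros test_continuous[OF f(1)])
    have mL: "emeasure rep_measure (L j) = open_mass (L j)" for j
      by (rule emeasure_rep_measure_open[OF oL])
    define \<theta> where "\<theta> = (\<lambda>(j::nat) x. smooth_step (N * f x - real j))"
    have z: "\<theta> j x = 0" if "N * f x \<le> j" for j x
      using that by (simp add: \<theta>_def smooth_step_0)
    have TF: "\<theta> j \<in> test_functions \<Omega>" for j
    proof (rule test_functionI[OF _ K(1,2)])
      show "Ck_on k UNIV (\<theta> j)" for k unfolding \<theta>_def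
        by (rule Ck_on_compose[OF open_UNIV open_UNIV _ Ck_on_smooth_step])
          (auto intro!: Ck_on_diff Ck_on_mult Ck_on_const test_Ck[OF f(1)])
      show "\<theta> j x = 0" if "x \<notin> K" for x using that K(3) by (intro z) simp
    qed
    have \<theta>01: "0 \<le> \<theta> j x" "\<theta> j x \<le> 1" for j x by (simp_all add: \<theta>_def smooth_step_bounds)
    \<comment> \<open>\<open>\<theta> (Suc j)\<close> vanishes where N f <= j + 1, so its support
      lies in the closed set N f >= j + 1, which is contained in the open set
      \<open>L j\<close>.\<close>
    have a: "ennreal (T (\<theta> (Suc j))) \<le> open_mass (L j)" for j
    proof (rule open_mass_upper[OF _ \<theta>01])
      have cl: "closed {x. real (Suc j) \<le> N * f x}"
        by (intro closed_Collect_le continuous_intros test_continuous[OF f(1)])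
      have "x \<in> K" if "real (Suc j) \<le> N * f x" for x
        using that N fK[of x] by (smt (verit) of_nat_0_less_iff zero_less_mult_pos of_nat_Suc of_nat_0_le_iff)
      then have "{x. real (Suc j) \<le> N * f x} \<subseteq> K" by auto
      then have "compact {x. real (Suc j) \<le> N * f x}" "{x. real (Suc j) \<le> N * f x} \<subseteq> \<Omega>"
        using compact_Int_closed[OF K(1) cl] K(2) by (auto simp: Int_absorb1)
      then show "\<theta> (Suc j) \<in> test_functions (L j \<inter> \<Omega>)"
        by (rule_tac test_functionI[OF test_Ck[OF TF]]) (auto simp: L_def intro!: z)
    qed
    have b: "open_mass (L (Suc j)) \<le> ennreal (T (\<theta> j))" for j
      by (rule open_mass_le[OF TF \<theta>01(1)]) (auto simp: L_def \<theta>_def smooth_step_1)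
    have \<xi>L: "open_mass (L 0) \<le> ennreal (T \<xi>)"
      by (rule open_mass_le[OF \<xi>(1,2)]) (use N fK \<xi>(4) in \<open>auto simp: L_def zero_less_mult_iff\<close>)
    have T\<xi>: "T \<xi> \<ge> 0" and Tf: "T f \<ge> 0" and T\<theta>: "T (\<theta> j) \<ge> 0" for j
      using \<xi> f TF \<theta>01 by (auto intro: T_nonneg)
    \<comment> \<open>Where N f <= 1 the function \<open>\<xi>\<close> suffices. Elsewhere one unit
      is given to \<open>\<xi>\<close>; each slice of N f - 1 is then below
      \<open>\<theta> j\<close>, because \<open>smooth_step\<close> is already 1 where the slice
      begins.\<close>
    have c: "N * f x \<le> \<xi> x + (\<Sum>j<J. \<theta> j x)" for x
    proof (cases "N * f x \<le> 1")
      case True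
      have "0 \<le> (\<Sum>j<J. \<theta> j x)" by (intro sum_nonneg \<theta>01)
      then show ?thesis using True \<xi>(2,4)[of x] K(3)[of x] by (cases "x \<in> K") auto
    next
      case False
      then have "f x \<noteq> 0" by auto
      then have "x \<in> K" using K(3) by blast
      have "N * f x - 1 = min (N * f x - 1) J" using J[of x] by simp
      also have "\<dots> = (\<Sum>j<J. max 0 (min 1 (N * f x - 1 - real j)))"
        using False by (intro sum_clamp[symmetric]) simp
      also have "\<dots> \<le> (\<Sum>j<J. \<theta> j x)"
      proof (intro sum_mono)
        fix j
        show "max 0 (min 1 (N * f x - 1 - real j)) \<le> \<theta> j x"
          using \<theta>01(1)[of j x] smooth_step_1[of "N * f x - real j"]
          by (cases "N * f x - real j \<ge> 1") (auto simp: \<theta>_def)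
      qed
      finally show ?thesis using \<xi>(4)[OF \<open>x \<in> K\<close>] by simp
    qed
    have d: "(\<Sum>j<J. \<theta> j x) \<le> N * f x + \<xi> x" for x
    proof (cases "f x = 0")
      case True
      then show ?thesis using z[of x] \<xi>(2)[of x] by simp
    next
      case False
      then have "x \<in> K" using K(3) by blast
      have "(\<Sum>j<J. \<theta> j x) \<le> (\<Sum>j<J. max 0 (min 1 (N * f x + 1 - real j)))"
      proof (intro sum_mono)
        fix j
        show "\<theta> j x \<le> max 0 (min 1 (N * f x + 1 - real j))"
          using \<theta>01(2)[of j x] z[of x j] by (cases "N * f x \<le> j") auto
      qed
      also have "\<dots> = min (N * f x + 1) J" using f(2)[of x] by (intro sum_clamp) simp
      finally show ?thesis using \<xi>(4)[OF \<open>x \<in> K\<close>] by simp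
    qed
    have e: "N * f x \<le> (\<Sum>j<J. indicator (L j) x)" for x
    proof -
      have "N * f x = (\<Sum>j<J. max 0 (min 1 (N * f x - real j)))"
        using f(2)[of x] J[of x] by (subst sum_clamp) auto
      also have "\<dots> \<le> (\<Sum>j<J. indicator (L j) x)"
        by (intro sum_mono) (auto simp: L_def indicator_def)
      finally show ?thesis .
    qed
    have g: "(\<Sum>j<J. indicator (L (Suc j)) x) \<le> N * f x" for x
    proof -
      have "(\<Sum>j<J. indicator (L (Suc j)) x) \<le> (\<Sum>j<J. max 0 (min 1 (N * f x - real j)))"
        by (intro sum_mono) (auto simp: L_def indicator_def)
      also have "\<dots> \<le> N * f x" using f(2)[of x] by (subst sum_clamp) auto
      finally show ?thesis .
    qed
    have mf: "f \<in> borel_measurable rep_measure"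
      using test_measurable[OF f(1)] by simp
    have NI: "of_nat N * ?I = (\<integral>\<^sup>+x. ennreal (N * f x) \<partial>rep_measure)"
      using mf by (subst nn_integral_cmult[symmetric]) (auto simp: ennreal_mult' ennreal_of_nat_eq_real_of_nat)
    have sum_ind: "(\<integral>\<^sup>+x. ennreal (\<Sum>j<J. indicator (L (h j)) x) \<partial>rep_measure) = (\<Sum>j<J. open_mass (L (h j)))" for h
    proof -
      have LS: "L j \<in> sets rep_measure" for j using oL by simp
      have "(\<integral>\<^sup>+x. ennreal (\<Sum>j<J. indicator (L (h j)) x) \<partial>rep_measure)
          = (\<integral>\<^sup>+x. (\<Sum>j<J. indicator (L (h j)) x) \<partial>rep_measure)"
        by (intro nn_integral_cong) (simp add: sum_ennreal[symmetric] ennreal_indicator)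
      also have "\<dots> = (\<Sum>j<J. \<integral>\<^sup>+x. indicator (L (h j)) x \<partial>rep_measure)"
        using LS by (intro nn_integral_sum) auto
      finally show ?thesis using LS by (simp add: mL)
    qed
    have E: "of_nat N * ?I \<le> (\<Sum>j<J. open_mass (L j))"
      unfolding NI using sum_ind[of "\<lambda>j. j"] nn_integral_mono[of rep_measure "\<lambda>x. ennreal (N * f x)", OF ennreal_leI[OF e]]
      by simp
    have G: "(\<Sum>j<J. open_mass (L (Suc j))) \<le> of_nat N * ?I"
      unfolding NI using sum_ind[of Suc] nn_integral_mono[of rep_measure _ "\<lambda>x. ennreal (N * f x)", OF ennreal_leI[OF g]]
      by simp
    have TS: "T (\<lambda>x. \<Sum>j<J. \<theta> j x) = (\<Sum>j<J. T (\<theta> j))" "(\<lambda>x. \<Sum>j<J. \<theta> j x) \<in> test_functions \<Omega>"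
      by (auto intro!: T_sum test_sum TF)
    have C: "N * T f \<le> T \<xi> + (\<Sum>j<J. T (\<theta> j))"
    proof -
      have "T (\<lambda>x. N * f x) \<le> T (\<lambda>x. \<xi> x + (\<Sum>j<J. \<theta> j x))"
        by (intro T_mono test_scale test_add f \<xi> TS c)
      then show ?thesis by (simp add: T_scale[OF f(1)] T_add[OF \<xi>(1) TS(2)] TS(1))
    qed
    have D: "(\<Sum>j<J. T (\<theta> j)) \<le> N * T f + T \<xi>"
    proof -
      have "T (\<lambda>x. \<Sum>j<J. \<theta> j x) \<le> T (\<lambda>x. N * f x + \<xi> x)"
        by (intro T_mono test_scale test_add f \<xi> TS d)
      then show ?thesis by (simp add: T_scale[OF f(1)] T_add[OF test_scale[OF f(1)] \<xi>(1)] TS(1))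
    qed
    have shift: "(\<Sum>j<J. F j) \<le> F 0 + (\<Sum>j<J. F (Suc j))" for F :: "nat \<Rightarrow> ennreal"
    proof (cases J)
      case (Suc m)
      have "(\<Sum>j<J. F j) = F 0 + (\<Sum>j<m. F (Suc j))" unfolding Suc by (rule sum.lessThan_Suc_shift)
      also have "\<dots> \<le> F 0 + (\<Sum>j<J. F (Suc j))" unfolding Suc by (intro add_left_mono sum_mono2) auto
      finally show ?thesis .
    qed simp
    have "of_nat N * ?I \<le> open_mass (L 0) + (\<Sum>j<J. open_mass (L (Suc j)))"
      using E shift[of "\<lambda>j. open_mass (L j)"] by (rule order_trans)
    also have "\<dots> \<le> ennreal (T \<xi>) + (\<Sum>j<J. ennreal (T (\<theta> j)))"
      by (intro add_mono \<xi>L sum_mono b)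
    also have "\<dots> = ennreal (T \<xi> + (\<Sum>j<J. T (\<theta> j)))"
      using T\<theta> T\<xi> by (simp add: sum_ennreal ennreal_plus sum_nonneg)
    also have "\<dots> \<le> ennreal (N * T f + 3 * T \<xi>)" using D T\<xi> by (intro ennreal_leI) simp
    finally have 1: "of_nat N * ?I \<le> ennreal (N * T f + 3 * T \<xi>)" .
    have "ennreal (N * T f) \<le> ennreal (T \<xi> + (\<Sum>j<J. T (\<theta> j)))" using C by (rule ennreal_leI)
    also have "\<dots> = ennreal (T \<xi>) + (\<Sum>j<J. ennreal (T (\<theta> j)))"
      using T\<theta> T\<xi> by (simp add: sum_ennreal ennreal_plus sum_nonneg)
    also have "\<dots> \<le> ennreal (T \<xi>) + (ennreal (T (\<theta> 0)) + (\<Sum>j<J. ennreal (T (\<theta> (Suc j)))))"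
      by (intro add_left_mono shift)
    also have "\<dots> \<le> ennreal (T \<xi>) + (ennreal (T \<xi>) + (\<Sum>j<J. open_mass (L j)))"
    proof (intro add_left_mono add_mono sum_mono a ennreal_leI T_mono TF \<xi>)
      show "\<theta> 0 x \<le> \<xi> x" for x
        using \<theta>01(2)[of 0 x] \<xi>(2,4)[of x] K(3)[of x] z[of x 0] by (cases "x \<in> K") auto
    qed
    also have "\<dots> \<le> ennreal (T \<xi>) + (ennreal (T \<xi>) + (open_mass (L 0) + (\<Sum>j<J. open_mass (L (Suc j)))))"
      by (intro add_left_mono shift)
    also have "\<dots> \<le> ennreal (T \<xi>) + (ennreal (T \<xi>) + (ennreal (T \<xi>) + of_nat N * ?I))"
      by (intro add_left_mono add_mono \<xi>L G)
    also have "\<dots> = of_nat N * ?I + ennreal (3 * T \<xi>)"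
    proof -
      have "ennreal (3 * T \<xi>) = ennreal (T \<xi>) + (ennreal (T \<xi>) + ennreal (T \<xi>))"
        using T\<xi> by (simp flip: ennreal_plus)
      then show ?thesis by (simp add: ac_simps)
    qed
    finally show ?thesis using 1 by simp
  qed
  have Tf: "T f \<ge> 0" using f by (rule T_nonneg)
  have T\<xi>: "T \<xi> \<ge> 0" using \<xi> by (intro T_nonneg)
  have "?I < \<infinity>" using main[of 1] le_less_trans[of ?I "ennreal (T f + 3 * T \<xi>)" top] by simp
  then obtain r where r: "?I = ennreal r" "r \<ge> 0" by (cases ?I) auto
  have bd: "real N * \<bar>r - T f\<bar> \<le> 3 * T \<xi>" if "N > 0" for N :: nat
  proof -
    have "ennreal (N * r) \<le> ennreal (N * T f + 3 * T \<xi>)" "ennreal (N * T f) \<le> ennreal (N * r + 3 * T \<xi>)"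
      using main[OF that] r T\<xi> by (simp_all add: ennreal_mult ennreal_of_nat_eq_real_of_nat ennreal_plus)
    then have "N * r \<le> N * T f + 3 * T \<xi>" "N * T f \<le> N * r + 3 * T \<xi>"
      using r(2) Tf T\<xi> by (auto simp: ennreal_le_iff simp flip: ennreal_plus)
    then show ?thesis by (auto simp: abs_if algebra_simps)
  qed
  have "r = T f"
  proof (rule ccontr)
    assume "r \<noteq> T f"
    then obtain N where "3 * T \<xi> < real N * \<bar>r - T f\<bar>"
      using reals_Archimedean3[of "\<bar>r - T f\<bar>"] by auto
    moreover have "N > 0"
    proof (rule ccontr)
      assume "\<not> N > 0" with calculation T\<xi> show False by simp
    qed
    ultimately show False using bd[of N] by simp
  qed
  then show ?thesis using r by simp
qed

lemma rep_measure_integral: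
  assumes f: "f \<in> test_functions \<Omega>"
  shows "integrable rep_measure f" "(\<integral>x. f x \<partial>rep_measure) = T f"
proof -
  have pos: "integrable rep_measure g \<and> (\<integral>x. g x \<partial>rep_measure) = T g"
    if g: "g \<in> test_functions \<Omega>" "\<And>x. 0 \<le> g x" for g
  proof -
    have "has_bochner_integral rep_measure g (T g)"
      using test_measurable[OF g(1)] rep_measure_nn_integral[OF g] T_nonneg[OF g] g(2)
      by (intro has_bochner_integral_nn_integral) auto
    then show ?thesis by (simp add: has_bochner_integral_iff)
  qed
  obtain K where K: "compact K" "K \<subseteq> \<Omega>" "\<And>x. x \<notin> K \<Longrightarrow> f x = 0"
    using test_support[OF f(1)] by blast
  obtain B where B: "0 \<le> B" "\<And>x. \<bar>f x\<bar> \<le> B" using test_bounded[OF f(1)] by blast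
  obtain \<xi> where \<xi>: "\<xi> \<in> test_functions \<Omega>" "\<And>x. 0 \<le> \<xi> x" "\<And>x. x \<in> K \<Longrightarrow> \<xi> x = 1"
    using test_urysohn[OF K(1) open_domain K(2)] by metis
  have B\<xi>: "(\<lambda>x. B * \<xi> x) \<in> test_functions \<Omega>" "\<And>x. 0 \<le> B * \<xi> x"
    using \<xi> B by (auto intro: test_scale)
  \<comment> \<open>A multiple of \<open>\<xi>\<close> lifts \<open>f\<close> to a nonnegative test
    function: |f| <= B, and \<open>\<xi>\<close> is 1 on the support of \<open>f\<close>.\<close>
  have g: "(\<lambda>x. f x + B * \<xi> x) \<in> test_functions \<Omega>" "\<And>x. 0 \<le> f x + B * \<xi> x"
  proof -
    show "0 \<le> f x + B * \<xi> x" for x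
      using B(2)[of x] B\<xi>(2)[of x] K(3)[of x] \<xi>(3)[of x] by (cases "x \<in> K") auto
  qed (intro test_add f B\<xi>)
  have "has_bochner_integral rep_measure (\<lambda>x. (f x + B * \<xi> x) - B * \<xi> x) (T (\<lambda>x. f x + B * \<xi> x) - T (\<lambda>x. B * \<xi> x))"
    using pos[OF g] pos[OF B\<xi>] by (intro has_bochner_integral_diff) (auto simp: has_bochner_integral_iff)
  then have "has_bochner_integral rep_measure f (T f)"
    by (simp add: T_add[OF f B\<xi>(1)])
  then show "integrable rep_measure f" "(\<integral>x. f x \<partial>rep_measure) = T f"
    by (auto simp: has_bochner_integral_iff)
qed

text \<open>The number \<open>a\<close> is the mass of \<open>rep_measure\<close> at
  \<open>p\<close>, and \<open>\<mu>\<close> is the rest of that measure. The total mass of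
  \<open>\<mu>\<close> may be infinite, so inner regularity is obtained from finite pieces along a
  compact exhaustion of \<open>\<Omega>\<close>.\<close>

lemma radon_decomposition:
  assumes p: "p \<in> \<Omega>"
  obtains a \<mu> where "0 \<le> a" "radon_measure_on \<Omega> \<mu>" "emeasure \<mu> {p} = 0"
    "\<And>f. f \<in> test_functions \<Omega> \<Longrightarrow> T f = measure_distr \<mu> f + a * dirac_distr p f"
proof -
  define \<rho> where "\<rho> = density rep_measure (indicator (- {p}))"
  define \<mu> where "\<mu> = restrict_space \<rho> \<Omega>"
  have \<Omega>: "\<Omega> \<in> sets borel" using open_domain by simp
  have s\<rho>: "sets \<rho> = sets borel" by (simp add: \<rho>_def)
  have \<rho>: "emeasure \<rho> A = emeasure rep_measure (A - {p})" if "A \<in> sets borel" for A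
    using that unfolding \<rho>_def
    by (subst emeasure_density) (auto simp: indicator_inter_arith[symmetric] Diff_eq Int_commute)
  have s\<mu>: "sets \<mu> = sets (restrict_space borel \<Omega>)"
    unfolding \<mu>_def by (rule sets_restrict_space_cong[OF s\<rho>])
  have \<mu>: "emeasure \<mu> A = emeasure rep_measure (A - {p})" if "A \<in> sets borel" "A \<subseteq> \<Omega>" for A
    using that \<Omega> unfolding \<mu>_def by (subst emeasure_restrict_space) (auto simp: s\<rho> \<rho>)
  have in_\<mu>: "A \<in> sets \<mu> \<longleftrightarrow> A \<in> sets borel \<and> A \<subseteq> \<Omega>" for A
    unfolding s\<mu> using \<Omega> by (subst sets_restrict_space_iff) auto
  have fin: "emeasure \<mu> K < \<infinity>" if "compact K" "K \<subseteq> \<Omega>" for K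
  proof -
    have "emeasure \<mu> K \<le> emeasure rep_measure K"
      using that by (subst \<mu>) (auto intro!: emeasure_mono borel_compact)
    then show ?thesis using rep_measure_compact[OF that] by (rule le_less_trans)
  qed
  obtain C where C: "\<And>n. compact (C n)" "\<And>n::nat. C n \<subseteq> \<Omega>" "\<And>n. C n \<subseteq> interior (C (Suc n))" "\<Union>(range C) = \<Omega>"
    using open_Union_compact_subsets[OF open_domain] by metis
  have C_inc: "incseq C" by (rule incseq_SucI) (use C(3) interior_subset in blast)
  have Cb: "C n \<in> sets borel" for n using C(1) by (rule borel_compact)
  have inner: "emeasure \<mu> A = (SUP K\<in>{K. compact K \<and> K \<subseteq> A}. emeasure \<mu> K)" if A: "A \<in> sets \<mu>" for A
  proof (rule antisym)
    have Ab: "A \<in> sets borel" "A \<subseteq> \<Omega>" using A in_\<mu> by auto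
    have "A = (\<Union>n. A \<inter> C n)" using Ab C(4) by blast
    moreover have "emeasure \<mu> (\<Union>n. A \<inter> C n) = (SUP n. emeasure \<mu> (A \<inter> C n))"
    proof (rule SUP_emeasure_incseq[symmetric])
      show "range (\<lambda>n. A \<inter> C n) \<subseteq> sets \<mu>" using Ab Cb by (auto simp: in_\<mu>)
      show "incseq (\<lambda>n. A \<inter> C n)" using C_inc by (auto simp: mono_def)
    qed
    ultimately have "emeasure \<mu> A = (SUP n. emeasure \<mu> (A \<inter> C n))" by simp
    also have "\<dots> \<le> (SUP K\<in>{K. compact K \<and> K \<subseteq> A}. emeasure \<mu> K)"
    proof (rule SUP_least)
      fix n
      \<comment> \<open>The theorem \<open>inner_regular\<close> is about finite measures on all
        Borel sets. \<open>M\<close> is such a measure: the part of \<open>\<mu>\<close> in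
        \<open>C n\<close>, extended by zero.\<close>
      define M where "M = density rep_measure (indicator (C n - {p}))"
      have sM: "sets M = sets borel" by (simp add: M_def)
      have M: "emeasure M B = emeasure rep_measure (B \<inter> (C n - {p}))" if "B \<in> sets borel" for B
        using that Cb[of n] unfolding M_def
        by (subst emeasure_density) (auto simp: indicator_inter_arith[symmetric] Int_commute)
      have M\<mu>: "emeasure M B = emeasure \<mu> B" if "B \<in> sets borel" "B \<subseteq> C n" for B
        using that C(2)[of n] by (subst M, simp, subst \<mu>) (auto intro!: arg_cong[of _ _ "emeasure rep_measure"])
      have "emeasure M (space M) \<noteq> \<infinity>"
      proof -
        have "emeasure M (space M) = emeasure \<mu> (C n)"
          using M[of UNIV] M[OF Cb[of n]] M\<mu>[OF Cb[of n]] sets_eq_imp_space_eq[OF sM] by (simp add: Int_absorb1 Int_absorb2)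
        then show ?thesis using fin[OF C(1)[of n] C(2)[of n]] by simp
      qed
      from inner_regular[OF sM this, of "A \<inter> C n"]
      have "emeasure M (A \<inter> C n) = (SUP K\<in>{K. K \<subseteq> A \<inter> C n \<and> compact K}. emeasure M K)"
        using Ab Cb by auto
      also have "\<dots> \<le> (SUP K\<in>{K. compact K \<and> K \<subseteq> A}. emeasure \<mu> K)"
        by (intro SUP_mono) (auto intro!: exI simp: M\<mu> borel_compact)
      finally show "emeasure \<mu> (A \<inter> C n) \<le> (SUP K\<in>{K. compact K \<and> K \<subseteq> A}. emeasure \<mu> K)"
        using M\<mu>[of "A \<inter> C n"] Ab Cb by auto
    qed
    finally show "emeasure \<mu> A \<le> (SUP K\<in>{K. compact K \<and> K \<subseteq> A}. emeasure \<mu> K)" .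
  next
    show "(SUP K\<in>{K. compact K \<and> K \<subseteq> A}. emeasure \<mu> K) \<le> emeasure \<mu> A"
      using A by (auto intro!: SUP_least emeasure_mono)
  qed
  show ?thesis
  proof (rule that)
    show "0 \<le> measure rep_measure {p}" by simp
    show "radon_measure_on \<Omega> \<mu>" using s\<mu> fin inner by (auto simp: radon_measure_on_def)
    show "emeasure \<mu> {p} = 0" using p by (simp add: \<mu>)
    fix f assume f: "f \<in> test_functions \<Omega>"
    have fin_p: "emeasure rep_measure {p} < \<infinity>" using rep_measure_compact[of "{p}"] p by simp
    have meas: "f \<in> borel_measurable borel" by (rule test_measurable[OF f])
    have f0: "f x = 0" if "x \<notin> \<Omega>" for x using test_support[OF f] that by (metis subsetD)
    have "measure_distr \<mu> f = (\<integral>x. indicator \<Omega> x *\<^sub>R f x \<partial>\<rho>)"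
      unfolding measure_distr_def \<mu>_def using \<Omega> by (subst integral_restrict_space) (auto simp: s\<rho>)
    also have "\<dots> = (\<integral>x. indicator (- {p}) x *\<^sub>R (indicator \<Omega> x *\<^sub>R f x) \<partial>rep_measure)"
      unfolding \<rho>_def using meas \<Omega>
      by (subst integral_density[symmetric]) (auto simp: ennreal_indicator)
    \<comment> \<open>\<open>f\<close> vanishes off \<open>\<Omega>\<close>, and deleting the point
      \<open>p\<close> amounts to subtracting the value there times its indicator.\<close>
    also have "\<dots> = (\<integral>x. f x - f p * indicator {p} x \<partial>rep_measure)"
      using f0 p by (intro Bochner_Integration.integral_cong) (auto simp: indicator_def)
    also have "\<dots> = T f - f p * measure rep_measure {p}"
      using rep_measure_integral[OF f] fin_p by (subst Bochner_Integration.integral_diff) auto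
    finally show "T f = measure_distr \<mu> f + measure rep_measure {p} * dirac_distr p f"
      by (simp add: dirac_distr_def)
  qed
qed

end

section \<open>Kernel integrals\<close>

text \<open>Dyadic shells: between the radii r/2^(j+1) and r/2^j the integrand is at most its value
  at the inner radius, since the exponent is nonpositive, and the enclosing ball has volume of order
  (r/2^j)^n. The products form a geometric series with ratio 2^(-\<alpha>).\<close>

lemma nn_integral_norm_powr_ball:
  fixes \<alpha> :: real
  assumes "0 < \<alpha>" "\<alpha> \<le> DIM('a::euclidean_space)"
  obtains C where "0 \<le> C"
    "\<And>r. 0 < r \<Longrightarrow> (\<integral>\<^sup>+(z::'a). ennreal (norm z powr (\<alpha> - real DIM('a))) * indicator (ball 0 r) z \<partial>lborel)
       \<le> ennreal (C * r powr \<alpha>)"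
proof (rule that)
  let ?n = "real DIM('a)" and ?V = "unit_ball_vol (real DIM('a))"
  let ?C = "?V * 2 powr (?n - \<alpha>) * (1 / (1 - 2 powr (- \<alpha>)))"
  have q: "0 < 2 powr (- \<alpha>)" "2 powr (- \<alpha>) < 1"
    using assms powr_less_mono[of "-\<alpha>" 0 2] by auto
  show "0 \<le> ?C" using q by simp
  fix r :: real assume r: "0 < r"
  let ?c = "\<lambda>j. (r / 2 ^ Suc j) powr (\<alpha> - ?n)"
  have pt: "ennreal (norm z powr (\<alpha> - ?n)) * indicator (ball 0 r) z
      \<le> (\<Sum>j. ennreal (?c j) * indicator (cball 0 (r / 2 ^ j)) z)" for z :: 'a
  \<comment> \<open>The origin belongs to the trivial case because
    \<open>0 powr a = 0\<close>.\<close>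
  proof (cases "z \<in> ball 0 r \<and> z \<noteq> 0")
    case True
    then have z: "0 < norm z" "norm z < r" by auto
    define j where "j = nat \<lfloor>log 2 (r / norm z)\<rfloor>"
    have "0 \<le> log 2 (r / norm z)" using z r by (subst zero_le_log_cancel_iff) auto
    then have j: "real j \<le> log 2 (r / norm z)" "log 2 (r / norm z) < real (Suc j)"
      unfolding j_def by linarith+
    have "2 ^ j \<le> r / norm z" using j(1) z r by (simp add: le_log_iff powr_realpow)
    then have 1: "norm z \<le> r / 2 ^ j" using z by (simp add: field_simps)
    have "r / norm z < 2 ^ Suc j" using j(2) z r by (simp add: log_less_iff powr_realpow del: power_Suc of_nat_Suc)
    then have 2: "r / 2 ^ Suc j \<le> norm z" using z by (simp add: field_simps)
    have "norm z powr (\<alpha> - ?n) \<le> ?c j"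
      using 2 r assms by (intro powr_mono2') auto
    then have "ennreal (norm z powr (\<alpha> - ?n)) * indicator (ball 0 r) z
        \<le> (\<Sum>j\<in>{j}. ennreal (?c j) * indicator (cball 0 (r / 2 ^ j)) z)"
      using 1 True by (simp add: ennreal_leI)
    also have "\<dots> \<le> (\<Sum>j. ennreal (?c j) * indicator (cball 0 (r / 2 ^ j)) z)"
      by (rule sum_le_suminf) auto
    finally show ?thesis .
  qed (auto simp: indicator_def)
  have "(\<integral>\<^sup>+(z::'a). ennreal (norm z powr (\<alpha> - ?n)) * indicator (ball 0 r) z \<partial>lborel)
      \<le> (\<integral>\<^sup>+(z::'a). (\<Sum>j. ennreal (?c j) * indicator (cball 0 (r / 2 ^ j)) z) \<partial>lborel)"
    by (intro nn_integral_mono pt)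
  also have "\<dots> = (\<Sum>j. \<integral>\<^sup>+(z::'a). ennreal (?c j) * indicator (cball 0 (r / 2 ^ j)) z \<partial>lborel)"
    by (rule nn_integral_suminf) (intro borel_measurable_times_ennreal borel_measurable_const borel_measurable_indicator, simp)
  also have "\<dots> = (\<Sum>j. ennreal (?V * 2 powr (?n - \<alpha>) * r powr \<alpha> * (2 powr (- \<alpha>)) ^ j))"
  proof (intro suminf_cong)
    fix j
    define x where "x = r / 2 ^ j"
    have x: "x > 0" using r by (simp add: x_def)
    have "(\<integral>\<^sup>+(z::'a). ennreal (?c j) * indicator (cball 0 (r / 2 ^ j)) z \<partial>lborel)
        = ennreal (?c j) * ennreal (?V * x ^ DIM('a))"
      using x by (subst nn_integral_cmult_indicator) (auto simp: x_def[symmetric] emeasure_cball)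
    also have "\<dots> = ennreal ((x / 2) powr (\<alpha> - ?n) * (?V * x powr ?n))"
      using x by (subst ennreal_mult[symmetric]) (auto simp: x_def powr_realpow field_simps)
    also have "(x / 2) powr (\<alpha> - ?n) * (?V * x powr ?n) = ?V * 2 powr (?n - \<alpha>) * x powr \<alpha>"
      using x by (simp add: powr_divide powr_diff field_simps)
    also have "x powr \<alpha> = r powr \<alpha> * (2 powr (- \<alpha>)) ^ j"
    proof -
      have "(2 powr (- \<alpha>)) ^ j = 2 powr (- \<alpha> * real j)" by (simp add: powr_realpow[symmetric] powr_powr)
      also have "\<dots> = inverse ((2 ^ j) powr \<alpha>)"
        by (simp add: powr_realpow[symmetric] powr_powr powr_minus mult.commute)
      finally show ?thesis using r by (simp add: x_def powr_divide field_simps)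
    qed
    finally show "(\<integral>\<^sup>+(z::'a). ennreal (?c j) * indicator (cball 0 (r / 2 ^ j)) z \<partial>lborel)
      = ennreal (?V * 2 powr (?n - \<alpha>) * r powr \<alpha> * (2 powr (- \<alpha>)) ^ j)"
      by (simp add: mult.assoc)
  qed
  also have "\<dots> = ennreal (?V * 2 powr (?n - \<alpha>) * r powr \<alpha> * (1 / (1 - 2 powr (- \<alpha>))))"
    using q by (intro suminf_ennreal_eq sums_mult geometric_sums) auto
  also have "?V * 2 powr (?n - \<alpha>) * r powr \<alpha> * (1 / (1 - 2 powr (- \<alpha>))) = ?C * r powr \<alpha>" by simp
  finally show "(\<integral>\<^sup>+(z::'a). ennreal (norm z powr (\<alpha> - ?n)) * indicator (ball 0 r) z \<partial>lborel)
    \<le> ennreal (?C * r powr \<alpha>)" .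
qed

text \<open>Shells between the radii 2^j and 2^(j+1); the ratio is now 2^(-\<beta>).\<close>

lemma nn_integral_norm_powr_outside:
  fixes \<beta> :: real
  assumes "0 < \<beta>"
  shows "(\<integral>\<^sup>+(z::'a::euclidean_space). ennreal (norm z powr (- \<beta> - real DIM('a))) * indicator (- ball 0 1) z \<partial>lborel) < \<infinity>"
proof -
  let ?n = "real DIM('a)" and ?V = "unit_ball_vol (real DIM('a))"
  have q: "0 < 2 powr (- \<beta>)" "2 powr (- \<beta>) < 1"
    using assms powr_less_mono[of "-\<beta>" 0 2] by auto
  let ?c = "\<lambda>j::nat. (2 ^ j) powr (- \<beta> - ?n) :: real"
  have pt: "ennreal (norm z powr (- \<beta> - ?n)) * indicator (- ball 0 1) z
      \<le> (\<Sum>j. ennreal (?c j) * indicator (cball 0 (2 ^ Suc j)) z)" for z :: 'a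
  proof (cases "z \<in> - ball 0 1")
    case True
    then have z: "1 \<le> norm z" by auto
    define j where "j = nat \<lfloor>log 2 (norm z)\<rfloor>"
    have "0 \<le> log 2 (norm z)" using z by (subst zero_le_log_cancel_iff) auto
    then have j: "real j \<le> log 2 (norm z)" "log 2 (norm z) < real (Suc j)"
      unfolding j_def by linarith+
    have 1: "2 ^ j \<le> norm z" using j(1) z by (subst (asm) le_log_iff) (auto simp: powr_realpow)
    have 2: "norm z < 2 ^ Suc j" using j(2) z by (subst (asm) log_less_iff) (auto simp: powr_realpow powr_add)
    have "norm z powr (- \<beta> - ?n) \<le> ?c j"
      using 1 assms by (intro powr_mono2') auto
    then have "ennreal (norm z powr (- \<beta> - ?n)) * indicator (- ball 0 1) z
        \<le> (\<Sum>j\<in>{j}. ennreal (?c j) * indicator (cball 0 (2 ^ Suc j)) z)"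
      using 2 True by (simp add: ennreal_leI)
    also have "\<dots> \<le> (\<Sum>j. ennreal (?c j) * indicator (cball 0 (2 ^ Suc j)) z)"
      by (rule sum_le_suminf) auto
    finally show ?thesis .
  qed (auto simp: indicator_def)
  have "(\<integral>\<^sup>+(z::'a). ennreal (norm z powr (- \<beta> - ?n)) * indicator (- ball 0 1) z \<partial>lborel)
      \<le> (\<integral>\<^sup>+(z::'a). (\<Sum>j. ennreal (?c j) * indicator (cball 0 (2 ^ Suc j)) z) \<partial>lborel)"
    by (intro nn_integral_mono pt)
  also have "\<dots> = (\<Sum>j. \<integral>\<^sup>+(z::'a). ennreal (?c j) * indicator (cball 0 (2 ^ Suc j)) z \<partial>lborel)"
    by (rule nn_integral_suminf) (intro borel_measurable_times_ennreal borel_measurable_const borel_measurable_indicator, simp)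
  also have "\<dots> = (\<Sum>j. ennreal (?V * 2 ^ DIM('a) * (2 powr (- \<beta>)) ^ j))"
  proof (intro suminf_cong)
    fix j
    define x :: real where "x = 2 ^ j"
    have x: "x > 0" by (simp add: x_def)
    have "(\<integral>\<^sup>+(z::'a). ennreal (?c j) * indicator (cball 0 (2 ^ Suc j)) z \<partial>lborel)
        = ennreal (?c j) * ennreal (?V * (2 * x) ^ DIM('a))"
      using x by (subst nn_integral_cmult_indicator) (auto simp: x_def[symmetric] emeasure_cball)
    also have "\<dots> = ennreal (x powr (- \<beta> - ?n) * (?V * (2 ^ DIM('a) * x powr ?n)))"
      using x by (subst ennreal_mult[symmetric]) (auto simp: x_def powr_realpow power_mult_distrib)
    also have "x powr (- \<beta> - ?n) * (?V * (2 ^ DIM('a) * x powr ?n)) = ?V * 2 ^ DIM('a) * x powr (- \<beta>)"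
      using x by (simp add: powr_diff field_simps)
    also have "x powr (- \<beta>) = (2 powr (- \<beta>)) ^ j"
    proof -
      have "(2 powr (- \<beta>)) ^ j = 2 powr (- \<beta> * real j)" by (simp add: powr_realpow[symmetric] powr_powr)
      then show ?thesis by (simp add: x_def powr_realpow[symmetric] powr_powr mult.commute)
    qed
    finally show "(\<integral>\<^sup>+(z::'a). ennreal (?c j) * indicator (cball 0 (2 ^ Suc j)) z \<partial>lborel)
      = ennreal (?V * 2 ^ DIM('a) * (2 powr (- \<beta>)) ^ j)" .
  qed
  also have "\<dots> = ennreal (?V * 2 ^ DIM('a) * (1 / (1 - 2 powr (- \<beta>))))"
    using q by (intro suminf_ennreal_eq sums_mult geometric_sums) auto
  also have "\<dots> < \<infinity>" by simp
  finally show ?thesis .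
qed

section \<open>The kernel and its integrable weight\<close>

abbreviation jump_denom :: "real \<Rightarrow> 'a::euclidean_space \<Rightarrow> real" where
  "jump_denom s z \<equiv> norm z powr (real DIM('a) + 2 * s)"

text \<open>The weight of a Levy measure: min(1, |z|^2) is the size of the second difference of a
  test function, so a multiple of this weight dominates the kernel integrals below.\<close>

definition levy_weight :: "real \<Rightarrow> 'a::euclidean_space \<Rightarrow> real" where
  "levy_weight s z = min 1 ((norm z)\<^sup>2) / jump_denom s z"

lemma levy_weight_nonneg: "0 \<le> levy_weight s z"
  by (simp add: levy_weight_def)

lemma levy_weight_measurable [measurable]: "levy_weight s \<in> borel_measurable borel"
  unfolding levy_weight_def[abs_def] by measurable

text \<open>In the unit ball the weight is |z|^(\<alpha> - n) with \<alpha> = 2 - 2s, which is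
  positive since s < 1 and below n since n >= 2. Outside it is |z|^(-2s - n), integrable since s >
  0.\<close>

lemma integrable_levy_weight:
  assumes "0 < s" "s < 1" "2 \<le> DIM('a::euclidean_space)"
  shows "integrable lborel (levy_weight s :: 'a \<Rightarrow> real)"
proof (rule integrableI_nonneg)
  obtain C where C: "0 \<le> C" "\<And>r. 0 < r \<Longrightarrow> (\<integral>\<^sup>+(z::'a). ennreal (norm z powr ((2 - 2 * s) - real DIM('a))) * indicator (ball 0 r) z \<partial>lborel)
       \<le> ennreal (C * r powr (2 - 2 * s))"
    by (rule nn_integral_norm_powr_ball[of "2 - 2 * s", where 'a='a]) (use assms in auto)
  have "ennreal (levy_weight s z) \<le> ennreal (norm z powr ((2 - 2 * s) - real DIM('a))) * indicator (ball 0 1) z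
     + ennreal (norm z powr (- (2 * s) - real DIM('a))) * indicator (- ball 0 1) z" for z :: 'a
  proof (cases "norm z < 1")
    case True
    then have "(norm z)\<^sup>2 \<le> 1" by (simp add: power_le_one)
    moreover have "(norm z)\<^sup>2 / jump_denom s z = norm z powr ((2 - 2 * s) - real DIM('a))"
    proof (cases "z = 0")
      case False
      then have "(norm z)\<^sup>2 = norm z powr 2" by simp
      then show ?thesis by (simp only: powr_diff[symmetric]) (simp add: algebra_simps)
    qed simp
    ultimately show ?thesis using True by (simp add: levy_weight_def)
  next
    case False
    then have "1 \<le> (norm z)\<^sup>2" by simp
    then have "levy_weight s z = 1 / jump_denom s z" by (simp add: levy_weight_def)
    also have "\<dots> = norm z powr (- (real DIM('a) + 2 * s))" by (rule powr_minus_divide[symmetric])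
    also have "- (real DIM('a) + 2 * s) = - (2 * s) - real DIM('a)" by simp
    finally show ?thesis using False by simp
  qed
  then have "(\<integral>\<^sup>+(z::'a). ennreal (levy_weight s z) \<partial>lborel)
    \<le> (\<integral>\<^sup>+(z::'a). ennreal (norm z powr ((2 - 2 * s) - real DIM('a))) * indicator (ball 0 1) z
     + ennreal (norm z powr (- (2 * s) - real DIM('a))) * indicator (- ball 0 1) z \<partial>lborel)"
    by (intro nn_integral_mono)
  also have "\<dots> = (\<integral>\<^sup>+(z::'a). ennreal (norm z powr ((2 - 2 * s) - real DIM('a))) * indicator (ball 0 1) z \<partial>lborel)
     + (\<integral>\<^sup>+(z::'a). ennreal (norm z powr (- (2 * s) - real DIM('a))) * indicator (- ball 0 1) z \<partial>lborel)"
    by (rule nn_integral_add) (intro borel_measurable_times_ennreal borel_measurable_indicator; simp)+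
  also have "\<dots> < \<infinity>"
    using C(2)[of 1] nn_integral_norm_powr_outside[of "2 * s", where 'a='a] assms
    by (simp add: ennreal_add_less_top le_less_trans[OF _ ennreal_less_top])
  finally show "(\<integral>\<^sup>+(z::'a). ennreal (levy_weight s z) \<partial>lborel) < \<infinity>" .
qed (auto simp: levy_weight_nonneg)

section \<open>Translation and reflection invariance\<close>

lemma distr_lborel_reflect: "distr lborel borel (\<lambda>z. c - z) = (lborel :: 'a::euclidean_space measure)"
  using lborel_affine[of "-1" c] by (simp add: density_1)

lemma lborel_integral_shift:
  fixes f :: "'a::euclidean_space \<Rightarrow> real"
  assumes "f \<in> borel_measurable borel"
  shows "(\<integral>z. f (c + z) \<partial>lborel) = (\<integral>z. f z \<partial>lborel)"
    "(\<integral>z. f (c - z) \<partial>lborel) = (\<integral>z. f z \<partial>lborel)"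
    "integrable lborel (\<lambda>z. f (c + z)) \<longleftrightarrow> integrable lborel f"
    "integrable lborel (\<lambda>z. f (c - z)) \<longleftrightarrow> integrable lborel f"
  using assms integral_distr[of "\<lambda>z. c + z" lborel borel f] integral_distr[of "\<lambda>z. c - z" lborel borel f]
    integrable_distr_eq[of "\<lambda>z. c + z" lborel borel f] integrable_distr_eq[of "\<lambda>z. c - z" lborel borel f]
  by (simp_all add: distr_lborel_reflect lborel_distr_plus)

lemma lborel_nn_integral_shift:
  fixes f :: "'a::euclidean_space \<Rightarrow> ennreal"
  assumes "f \<in> borel_measurable borel"
  shows "(\<integral>\<^sup>+z. f (c + z) \<partial>lborel) = (\<integral>\<^sup>+z. f z \<partial>lborel)"
    "(\<integral>\<^sup>+z. f (c - z) \<partial>lborel) = (\<integral>\<^sup>+z. f z \<partial>lborel)"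
  using assms nn_integral_distr[of "\<lambda>z. c + z" lborel borel f] nn_integral_distr[of "\<lambda>z. c - z" lborel borel f]
  by (simp_all add: distr_lborel_reflect lborel_distr_plus)

section \<open>The mixed operator on test functions\<close>

lemma test_has_derivative:
  assumes "f \<in> test_functions \<Omega>"
  shows "(f has_derivative (\<lambda>v. \<Sum>i\<in>Basis. (v \<bullet> i) * partial_deriv i f x)) (at x)"
  by (rule Ck_on_has_derivative[of 0 UNIV]) (use test_Ck[OF assms, of "Suc 0"] in auto)

lemma test_lipschitz:
  assumes f: "f \<in> test_functions \<Omega>"
  obtains L where "0 \<le> L" "\<And>x y. \<bar>f x - f y\<bar> \<le> L * norm (x - y)"
proof -
  have "\<exists>B\<ge>0. \<forall>x. \<bar>partial_deriv i f x\<bar> \<le> B" if "i \<in> Basis" for i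
    using test_bounded[OF test_partial_deriv[OF f that]] by metis
  then obtain B where B: "\<And>i. i \<in> Basis \<Longrightarrow> B i \<ge> 0 \<and> (\<forall>x. \<bar>partial_deriv i f x\<bar> \<le> B i)" by metis
  let ?L = "\<Sum>i\<in>Basis. B i"
  have on: "onorm (\<lambda>v. \<Sum>i\<in>Basis. (v \<bullet> i) * partial_deriv i f x) \<le> ?L" for x
  proof (rule onorm_le)
    fix v
    have "norm (\<Sum>i\<in>Basis. (v \<bullet> i) * partial_deriv i f x) \<le> (\<Sum>i\<in>Basis. norm v * B i)"
      by (rule order_trans[OF norm_sum]) (use B in \<open>auto intro!: sum_mono mult_mono simp: abs_mult Basis_le_norm\<close>)
    then show "norm (\<Sum>i\<in>Basis. (v \<bullet> i) * partial_deriv i f x) \<le> ?L * norm v"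
      by (simp add: sum_distrib_left mult.commute)
  qed
  have "norm (f x - f y) \<le> ?L * norm (x - y)" for x y
    by (rule differentiable_bound[OF convex_UNIV test_has_derivative[OF f] on]) auto
  then show ?thesis using B by (intro that[of ?L]) (auto intro: sum_nonneg)
qed

text \<open>The second difference, with the sign of the fractional Laplacian. Pairing z with -z
  cancels the first-order part, which makes the kernel integral absolutely convergent and removes
  the principal value.\<close>

definition sdiff :: "('a::euclidean_space \<Rightarrow> real) \<Rightarrow> 'a \<Rightarrow> 'a \<Rightarrow> real" where
  "sdiff f x z = 2 * f x - f (x + z) - f (x - z)"

lemma test_line_derivative:
  assumes f: "f \<in> test_functions \<Omega>"
  shows "((\<lambda>t. f (x + t *\<^sub>R z)) has_real_derivative (\<Sum>i\<in>Basis. (z \<bullet> i) * partial_deriv i f (x + t *\<^sub>R z))) (at t)"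
proof -
  have "((\<lambda>t. x + t *\<^sub>R z) has_derivative (\<lambda>h. h *\<^sub>R z)) (at t)"
    by (auto intro!: derivative_eq_intros)
  from has_derivative_compose[OF this test_has_derivative[OF f]]
  show ?thesis
    unfolding has_field_derivative_def
    by (rule has_derivative_eq_rhs) (auto simp: fun_eq_iff sum_distrib_left mult_ac)
qed

text \<open>The derivative of f(x + tz) + f(x - tz) in t contains differences of partial derivatives
  at two points 2t|z| apart. These are Lipschitz, so the mean value theorem on [0,1] yields the
  order |z|^2.\<close>

lemma sdiff_bound:
  assumes f: "f \<in> test_functions \<Omega>"
  obtains C where "0 \<le> C" "\<And>x z. \<bar>sdiff f x z\<bar> \<le> C * min 1 ((norm z)\<^sup>2)"
proof -
  obtain B where B: "0 \<le> B" "\<And>x. \<bar>f x\<bar> \<le> B" using test_bounded[OF f] by metis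
  have "\<exists>L\<ge>0. \<forall>x y. \<bar>partial_deriv i f x - partial_deriv i f y\<bar> \<le> L * norm (x - y)" if "i \<in> Basis" for i
    using test_lipschitz[OF test_partial_deriv[OF f that]] by metis
  then obtain L where L: "\<And>i. i \<in> Basis \<Longrightarrow> L i \<ge> 0 \<and> (\<forall>x y. \<bar>partial_deriv i f x - partial_deriv i f y\<bar> \<le> L i * norm (x - y))"
    by metis
  let ?L = "\<Sum>i\<in>Basis. L i"
  have L0: "?L \<ge> 0" using L by (auto intro: sum_nonneg)
  have 1: "\<bar>sdiff f x z\<bar> \<le> 4 * B" for x z
    using B(2)[of x] B(2)[of "x + z"] B(2)[of "x - z"] by (simp add: sdiff_def)
  have 2: "\<bar>sdiff f x z\<bar> \<le> 2 * ?L * (norm z)\<^sup>2" for x z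
  proof -
    let ?h = "\<lambda>t. f (x + t *\<^sub>R z) + f (x + t *\<^sub>R (- z))"
    let ?h' = "\<lambda>t. (\<Sum>i\<in>Basis. (z \<bullet> i) * partial_deriv i f (x + t *\<^sub>R z)) + (\<Sum>i\<in>Basis. ((- z) \<bullet> i) * partial_deriv i f (x + t *\<^sub>R (- z)))"
    have "(?h has_real_derivative ?h' t) (at t)" for t
      by (intro DERIV_add test_line_derivative[OF f])
    then obtain t where t: "0 < t" "t < 1" "?h 1 - ?h 0 = (1 - 0) * ?h' t"
      using MVT2[of 0 1 ?h ?h'] by auto
    have "?h' t = (\<Sum>i\<in>Basis. (z \<bullet> i) * (partial_deriv i f (x + t *\<^sub>R z) - partial_deriv i f (x + t *\<^sub>R (- z))))"
      by (simp add: sum_subtractf right_diff_distrib sum_negf)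
    then have "\<bar>?h' t\<bar> \<le> (\<Sum>i\<in>Basis. norm z * (L i * (2 * norm z)))"
    proof (simp only:, intro order_trans[OF sum_abs] sum_mono)
      fix i :: 'a assume i: "i \<in> Basis"
      have "norm ((x + t *\<^sub>R z) - (x + t *\<^sub>R (- z))) = norm ((2 * t) *\<^sub>R z)" by (simp add: scaleR_2[symmetric] flip: scaleR_add_left)
      also have "\<dots> \<le> 2 * norm z" using t by (simp add: mult_left_le_one_le)
      finally have n: "norm ((x + t *\<^sub>R z) - (x + t *\<^sub>R (- z))) \<le> 2 * norm z" .
      have "\<bar>partial_deriv i f (x + t *\<^sub>R z) - partial_deriv i f (x + t *\<^sub>R (- z))\<bar> \<le> L i * norm ((x + t *\<^sub>R z) - (x + t *\<^sub>R (- z)))"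
        using L[OF i] by blast
      also have "\<dots> \<le> L i * (2 * norm z)" using L[OF i] n by (intro mult_left_mono) auto
      finally show "\<bar>(z \<bullet> i) * (partial_deriv i f (x + t *\<^sub>R z) - partial_deriv i f (x + t *\<^sub>R (- z)))\<bar> \<le> norm z * (L i * (2 * norm z))"
        using Basis_le_norm[OF i, of z] by (subst abs_mult) (intro mult_mono, auto)
    qed
    also have "\<dots> = 2 * ?L * (norm z)\<^sup>2"
      by (simp add: sum_distrib_left sum_distrib_right power2_eq_square ac_simps)
    finally show ?thesis using t(3) by (simp add: sdiff_def)
  qed
  show ?thesis
  proof (rule that[of "4 * B + 2 * ?L"])
    show "\<bar>sdiff f x z\<bar> \<le> (4 * B + 2 * ?L) * min 1 ((norm z)\<^sup>2)" for x z
    proof (cases "1 \<le> (norm z)\<^sup>2")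
      case True
      then show ?thesis using 1[of x z] L0 by simp
    next
      case False
      have "0 \<le> 4 * B * (norm z)\<^sup>2" using B(1) by simp
      then show ?thesis using False 2[of x z] by (simp add: distrib_right)
    qed
  qed (use B(1) L0 in simp)
qed

lemma sdiff_measurable:
  assumes "f \<in> borel_measurable borel"
  shows "(\<lambda>z. sdiff f x z) \<in> borel_measurable borel"
  unfolding sdiff_def using assms by measurable

lemma integrable_sdiff:
  assumes s: "0 < s" "s < 1" "2 \<le> DIM('a::euclidean_space)" and f: "(f :: 'a \<Rightarrow> real) \<in> test_functions \<Omega>"
  shows "integrable lborel (\<lambda>z. sdiff f x z / jump_denom s z)"
proof -
  obtain C where C: "0 \<le> C" "\<And>x z. \<bar>sdiff f x z\<bar> \<le> C * min 1 ((norm z)\<^sup>2)" using sdiff_bound[OF f] by metis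
  note [measurable] = sdiff_measurable[OF test_measurable[OF f]]
  show ?thesis
  proof (rule Bochner_Integration.integrable_bound)
    show "integrable lborel (\<lambda>z::'a. C * levy_weight s z)" using integrable_levy_weight[OF s] by simp
    show "AE z in lborel. norm (sdiff f x z / jump_denom s z) \<le> norm (C * levy_weight s z)"
      using C by (intro AE_I2) (auto simp: levy_weight_def divide_right_mono)
  qed simp
qed

text \<open>The substitutions y = x + z and y = x - z give the same truncated integral. Their
  average is the integral of the second difference, and the truncation is removed by dominated
  convergence.\<close>

lemma frac_laplacian_sdiff:
  assumes s: "0 < s" "s < 1" "2 \<le> DIM('a::euclidean_space)" and f: "(f :: 'a \<Rightarrow> real) \<in> test_functions \<Omega>"
  shows "frac_laplacian s f x = frac_const DIM('a) s / 2 *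
    (\<integral>z. sdiff f x z / jump_denom s z \<partial>lborel)"
proof -
  define p where "p = real DIM('a) + 2 * s"
  note [measurable] = test_measurable[OF f]
  note [measurable] = sdiff_measurable[OF test_measurable[OF f]]
  obtain B where B: "0 \<le> B" "\<And>x. \<bar>f x\<bar> \<le> B" using test_bounded[OF f] by metis
  obtain C where C: "0 \<le> C" "\<And>x z. \<bar>sdiff f x z\<bar> \<le> C * min 1 ((norm z)\<^sup>2)" using sdiff_bound[OF f] by metis
  let ?S = "\<lambda>z. sdiff f x z / norm z powr p"
  have eq: "(LINT y : - ball x \<epsilon> | lebesgue. (f x - f y) / norm (x - y) powr p)
      = (\<integral>z. indicator (- ball 0 \<epsilon>) z * ?S z \<partial>lborel) / 2" if e: "0 < \<epsilon>" "\<epsilon> < 1" for \<epsilon>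
  proof -
    let ?F = "\<lambda>y. indicator (- ball x \<epsilon>) y *\<^sub>R ((f x - f y) / norm (x - y) powr p)"
    have [measurable]: "?F \<in> borel_measurable borel" by measurable
    have 1: "(LINT y : - ball x \<epsilon> | lebesgue. (f x - f y) / norm (x - y) powr p) = (\<integral>y. ?F y \<partial>lborel)"
      unfolding set_lebesgue_integral_def by (rule integral_completion) measurable
    have 2: "(\<integral>y. ?F y \<partial>lborel) = (\<integral>z. ?F (x + z) \<partial>lborel)" "(\<integral>y. ?F y \<partial>lborel) = (\<integral>z. ?F (x - z) \<partial>lborel)"
      by (simp_all only: lborel_integral_shift[OF \<open>?F \<in> borel_measurable borel\<close>])
    have F: "integrable lborel ?F"
    proof -
      have "integrable lborel (\<lambda>z. ?F (x + z))"
      proof (rule Bochner_Integration.integrable_bound)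
        \<comment> \<open>Off the ball of radius \<epsilon> < 1 one has \<epsilon>^2 <= min(1,
          |z|^2); hence the bound 2 B for a difference of values is at most 2 B / \<epsilon>^2 times
          the numerator of the weight.\<close>
        show "integrable lborel (\<lambda>z::'a. (2 * B / \<epsilon>\<^sup>2) * levy_weight s z)" using integrable_levy_weight[OF s] by simp
        have "\<bar>?F (x + z)\<bar> \<le> (2 * B / \<epsilon>\<^sup>2) * levy_weight s z" for z
        proof (cases "norm z < \<epsilon>")
          case True
          then show ?thesis using B e by (simp add: levy_weight_nonneg dist_norm)
        next
          case False
          then have "\<epsilon>\<^sup>2 \<le> min 1 ((norm z)\<^sup>2)" using e by (simp add: power_le_one power_mono)
          then have "2 * B \<le> (2 * B / \<epsilon>\<^sup>2) * min 1 ((norm z)\<^sup>2)"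
            using B(1) e mult_left_mono[of "\<epsilon>\<^sup>2" "min 1 ((norm z)\<^sup>2)" "2 * B / \<epsilon>\<^sup>2"] by simp
          moreover have "\<bar>f x - f (x + z)\<bar> \<le> 2 * B" using B(2)[of x] B(2)[of "x + z"] by simp
          ultimately have "\<bar>f x - f (x + z)\<bar> / norm z powr p \<le> (2 * B / \<epsilon>\<^sup>2) * min 1 ((norm z)\<^sup>2) / norm z powr p"
            by (intro divide_right_mono) auto
          then show ?thesis using False by (simp add: levy_weight_def p_def dist_norm)
        qed
        then show "AE z in lborel. norm (?F (x + z)) \<le> norm ((2 * B / \<epsilon>\<^sup>2) * levy_weight s z)"
          by (intro AE_I2) (metis real_norm_def abs_ge_self order_trans)
      qed measurable
      then show ?thesis by (simp only: lborel_integral_shift[OF \<open>?F \<in> borel_measurable borel\<close>])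
    qed
    have F2: "integrable lborel (\<lambda>z. ?F (x + z))" "integrable lborel (\<lambda>z. ?F (x - z))"
      using F by (simp_all only: lborel_integral_shift[OF \<open>?F \<in> borel_measurable borel\<close>])
    have "(\<integral>z. ?F (x + z) \<partial>lborel) + (\<integral>z. ?F (x - z) \<partial>lborel) = (\<integral>z. ?F (x + z) + ?F (x - z) \<partial>lborel)"
      by (rule Bochner_Integration.integral_add[symmetric, OF F2])
    also have "\<dots> = (\<integral>z. indicator (- ball 0 \<epsilon>) z * ?S z \<partial>lborel)"
      by (intro Bochner_Integration.integral_cong)
        (auto simp: sdiff_def indicator_def dist_norm add_divide_distrib[symmetric])
    finally have "2 * (\<integral>y. ?F y \<partial>lborel) = (\<integral>z. indicator (- ball 0 \<epsilon>) z * ?S z \<partial>lborel)"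
      using 2 by linarith
    with 1 show ?thesis by linarith
  qed
  let ?I = "\<lambda>\<epsilon>. LINT y : - ball x \<epsilon> | lebesgue. (f x - f y) / norm (x - y) powr p"
  have "(?I \<longlongrightarrow> (\<integral>z. ?S z \<partial>lborel) / 2) (at_right 0)"
  proof (rule tendsto_at_right_sequentially[where b=1])
    fix S :: "nat \<Rightarrow> real" assume S: "\<And>n. 0 < S n" "\<And>n. S n < 1" "decseq S" "S \<longlonglongrightarrow> 0"
    have "(\<lambda>n. \<integral>z. indicator (- ball 0 (S n)) z * ?S z \<partial>lborel) \<longlonglongrightarrow> (\<integral>z. ?S z \<partial>lborel)"
    proof (rule integral_dominated_convergence)
      show "integrable lborel (\<lambda>z::'a. C * levy_weight s z)" using integrable_levy_weight[OF s] by simp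
      have "\<bar>indicator (- ball 0 (S n)) z * ?S z\<bar> \<le> C * levy_weight s z" for n z
      proof -
        have "\<bar>indicator (- ball 0 (S n)) z * ?S z\<bar> \<le> \<bar>?S z\<bar>" by (simp add: indicator_def)
        also have "\<dots> \<le> C * min 1 ((norm z)\<^sup>2) / norm z powr p"
          using C(2)[of x z] by (simp add: divide_right_mono)
        finally show ?thesis by (simp add: levy_weight_def p_def)
      qed
      then show "AE z in lborel. norm (indicator (- ball 0 (S n)) z * ?S z) \<le> C * levy_weight s z" for n
        by auto
      have "(\<lambda>n. indicator (- ball 0 (S n)) z * ?S z) \<longlonglongrightarrow> ?S z" for z
      proof (cases "z = 0")
        case False
        then have "eventually (\<lambda>n. S n < norm z) sequentially" using S(4) order_tendstoD(2) by fastforce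
        then have "eventually (\<lambda>n. indicator (- ball 0 (S n)) z * ?S z = ?S z) sequentially"
          by eventually_elim (auto simp: indicator_def)
        then show ?thesis by (rule tendsto_eventually)
      qed simp
      then show "AE z in lborel. (\<lambda>n. indicator (- ball 0 (S n)) z * ?S z) \<longlonglongrightarrow> ?S z" by auto
    qed measurable
    then show "(\<lambda>n. ?I (S n)) \<longlonglongrightarrow> (\<integral>z. ?S z \<partial>lborel) / 2"
      using S by (simp add: eq tendsto_divide)
  qed simp
  then have "Lim (at_right 0) ?I = (\<integral>z. ?S z \<partial>lborel) / 2"
    by (intro tendsto_Lim) auto
  then show ?thesis by (simp add: frac_laplacian_def p_def)
qed

section \<open>Linearity, measurability and decay of the operator\<close>

lemma partial_deriv_add:
  assumes "f \<in> test_functions \<Omega>" "g \<in> test_functions \<Omega>"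
  shows "partial_deriv i (\<lambda>x. f x + g x) = (\<lambda>x. partial_deriv i f x + partial_deriv i g x)"
proof
  fix x
  have "(f has_derivative frechet_derivative f (at x)) (at x)" "(g has_derivative frechet_derivative g (at x)) (at x)"
    unfolding frechet_derivative_works[symmetric]
    by (rule differentiableI, rule test_has_derivative, rule assms)+
  from partial_deriv_eq[OF has_derivative_add[OF this]]
  show "partial_deriv i (\<lambda>x. f x + g x) x = partial_deriv i f x + partial_deriv i g x"
    by (simp add: partial_deriv_def)
qed

lemma partial_deriv_scale:
  assumes "f \<in> test_functions \<Omega>"
  shows "partial_deriv i (\<lambda>x. c * f x) = (\<lambda>x. c * partial_deriv i f x)"
proof
  fix x
  have "(f has_derivative frechet_derivative f (at x)) (at x)"
    unfolding frechet_derivative_works[symmetric]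
    by (rule differentiableI, rule test_has_derivative, rule assms)
  from partial_deriv_eq[OF has_derivative_mult_right[OF this]]
  show "partial_deriv i (\<lambda>x. c * f x) x = c * partial_deriv i f x"
    by (simp add: partial_deriv_def)
qed

lemma laplacian_add:
  assumes "f \<in> test_functions \<Omega>" "g \<in> test_functions \<Omega>"
  shows "laplacian (\<lambda>x. f x + g x) x = laplacian f x + laplacian g x"
  unfolding laplacian_def sum.distrib[symmetric]
proof (rule sum.cong[OF refl])
  fix i :: 'a assume i: "i \<in> Basis"
  show "partial_deriv i (partial_deriv i (\<lambda>x. f x + g x)) x = partial_deriv i (partial_deriv i f) x + partial_deriv i (partial_deriv i g) x"
    by (simp only: partial_deriv_add[OF assms]
        partial_deriv_add[OF test_partial_deriv[OF assms(1) i] test_partial_deriv[OF assms(2) i]])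
qed

lemma laplacian_scale:
  assumes "f \<in> test_functions \<Omega>"
  shows "laplacian (\<lambda>x. c * f x) x = c * laplacian f x"
  unfolding laplacian_def sum_distrib_left
proof (rule sum.cong[OF refl])
  fix i :: 'a assume i: "i \<in> Basis"
  show "partial_deriv i (partial_deriv i (\<lambda>x. c * f x)) x = c * partial_deriv i (partial_deriv i f) x"
    by (simp only: partial_deriv_scale[OF assms] partial_deriv_scale[OF test_partial_deriv[OF assms(1) i]])
qed

lemma test_laplacian:
  assumes "f \<in> test_functions \<Omega>"
  shows "laplacian f \<in> test_functions \<Omega>"
  unfolding laplacian_def[abs_def]
  by (intro test_sum test_partial_deriv assms)

lemma L1_loc_measurable:
  assumes "u \<in> L1_loc"
  shows "u \<in> borel_measurable lebesgue"
proof -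
  \<comment> \<open>Local integrability speaks of the truncations to balls; \<open>u\<close> is
    their pointwise limit.\<close>
  have "(\<lambda>x. indicator (cball 0 (real k)) x *\<^sub>R u x) \<in> borel_measurable lebesgue" for k
    using assms by (auto simp: L1_loc_def set_integrable_def dest!: spec[of _ "cball 0 (real k)"])
  then show ?thesis
  proof (rule borel_measurable_LIMSEQ_real[rotated])
    fix x
    have "eventually (\<lambda>k. indicator (cball 0 (real k)) x *\<^sub>R u x = u x) sequentially"
      using eventually_ge_at_top[of "nat \<lceil>norm x\<rceil>"] by eventually_elim (auto simp: indicator_def nat_ceiling_le_eq)
    then show "(\<lambda>k. indicator (cball 0 (real k)) x *\<^sub>R u x) \<longlonglongrightarrow> u x" by (rule tendsto_eventually)
  qed
qed

context
  fixes s :: real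
  assumes s: "0 < s" "s < 1"
begin

lemma mixed_op_sdiff:
  assumes n: "2 \<le> DIM('a::euclidean_space)" and f: "(f :: 'a \<Rightarrow> real) \<in> test_functions \<Omega>"
  shows "mixed_op s f x = - laplacian f x + frac_const DIM('a) s / 2 *
    (\<integral>z. sdiff f x z / jump_denom s z \<partial>lborel)"
  by (simp add: mixed_op_def frac_laplacian_sdiff[OF s n f])

lemma mixed_op_add:
  assumes n: "2 \<le> DIM('a::euclidean_space)"
    and f: "(f :: 'a \<Rightarrow> real) \<in> test_functions \<Omega>" and g: "g \<in> test_functions \<Omega>"
  shows "mixed_op s (\<lambda>x. f x + g x) x = mixed_op s f x + mixed_op s g x"
proof -
  have "(\<lambda>z. sdiff (\<lambda>x. f x + g x) x z / jump_denom s z)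
    = (\<lambda>z. sdiff f x z / jump_denom s z + sdiff g x z / jump_denom s z)"
    by (auto simp: sdiff_def add_divide_distrib[symmetric])
  then show ?thesis
    by (simp add: mixed_op_sdiff[OF n f] mixed_op_sdiff[OF n g] mixed_op_sdiff[OF n test_add[OF f g]]
        integrable_sdiff[OF s n f] integrable_sdiff[OF s n g] laplacian_add[OF f g] add_divide_distrib distrib_left)
qed

lemma mixed_op_scale:
  assumes n: "2 \<le> DIM('a::euclidean_space)" and f: "(f :: 'a \<Rightarrow> real) \<in> test_functions \<Omega>"
  shows "mixed_op s (\<lambda>x. c * f x) x = c * mixed_op s f x"
proof -
  have "(\<lambda>z. sdiff (\<lambda>x. c * f x) x z / jump_denom s z)
    = (\<lambda>z. c * (sdiff f x z / jump_denom s z))"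
    by (auto simp: sdiff_def algebra_simps diff_divide_distrib)
  then show ?thesis
    by (simp add: mixed_op_sdiff[OF n f] mixed_op_sdiff[OF n test_scale[OF f]]
        laplacian_scale[OF f] right_diff_distrib mult.left_commute[of c] del: times_divide_eq_right)
qed

text \<open>In the second-difference form the nonlocal part is an integral of a jointly measurable
  function depending on a parameter, with no limit in \<epsilon> left.\<close>

lemma mixed_op_measurable:
  assumes n: "2 \<le> DIM('a::euclidean_space)" and f: "(f :: 'a \<Rightarrow> real) \<in> test_functions \<Omega>"
  shows "mixed_op s f \<in> borel_measurable borel"
proof -
  note [measurable] = test_measurable[OF f] test_measurable[OF test_laplacian[OF f]]
  have "(\<lambda>(x::'a, z). sdiff f x z / jump_denom s z) \<in> borel_measurable (borel \<Otimes>\<^sub>M lborel)"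
    unfolding sdiff_def by measurable
  then have "(\<lambda>x::'a. \<integral>z. sdiff f x z / jump_denom s z \<partial>lborel) \<in> borel_measurable borel"
    by (rule lborel.borel_measurable_lebesgue_integral)
  note [measurable] = this
  have "mixed_op s f = (\<lambda>x. - laplacian f x + frac_const DIM('a) s / 2 *
    (\<integral>z. sdiff f x z / jump_denom s z \<partial>lborel))"
    using mixed_op_sdiff[OF n f] by blast
  then show ?thesis by simp
qed

lemma frac_const_nonneg: "0 \<le> frac_const n s"
  using s by (auto simp: frac_const_def intro!: divide_nonneg_nonneg mult_nonneg_nonneg Gamma_real_nonneg)

text \<open>This decay matches the weight in \<open>weighted_L1\<close> and makes the pairing with
  \<open>u\<close> converge. For |x| >= 2 only |z| >= |x|/2 contributes, since for smaller z the
  points x, x + z and x - z all lie outside the unit ball; there the kernel is at most 2^p |x|^(-p),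
  and \<open>f\<close> is integrable.\<close>

lemma mixed_op_decay:
  assumes n: "2 \<le> DIM('a::euclidean_space)" and f: "(f :: 'a \<Rightarrow> real) \<in> test_functions (ball 0 1)"
  obtains C where "0 \<le> C" "\<And>x. \<bar>mixed_op s f x\<bar> \<le> C / (1 + norm x powr (real DIM('a) + 2 * s))"
proof -
  define p where "p = real DIM('a) + 2 * s"
  have p: "p > 0" using s n by (simp add: p_def)
  let ?c = "frac_const DIM('a) s / 2"
  let ?J = "\<lambda>x. \<integral>z. sdiff f x z / norm z powr p \<partial>lborel"
  note f_meas = test_measurable[OF f]
  note [measurable] = f_meas sdiff_measurable[OF f_meas]
  have c: "0 \<le> ?c" using frac_const_nonneg by simp
  obtain A where A: "0 \<le> A" "\<And>x. \<bar>laplacian f x\<bar> \<le> A"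
    using test_bounded[OF test_laplacian[OF f]] by metis
  obtain D where D: "0 \<le> D" "\<And>x z. \<bar>sdiff f x z\<bar> \<le> D * min 1 ((norm z)\<^sup>2)" using sdiff_bound[OF f] by metis
  have eq: "mixed_op s f x = - laplacian f x + ?c * ?J x" for x
    unfolding p_def by (rule mixed_op_sdiff[OF n f])
  define W where "W = (\<integral>(z::'a). levy_weight s z \<partial>lborel)"
  have W: "W \<ge> 0" unfolding W_def by (simp add: levy_weight_nonneg)
  have J1: "\<bar>?J x\<bar> \<le> D * W" for x
  proof -
    have "\<bar>?J x\<bar> \<le> (\<integral>(z::'a). D * levy_weight s z \<partial>lborel)"
    proof (rule Bochner_Integration.integral_abs_bound_integral)
      show "integrable lborel (\<lambda>z. sdiff f x z / norm z powr p)"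
        unfolding p_def by (rule integrable_sdiff[OF s n f])
      show "integrable lborel (\<lambda>z::'a. D * levy_weight s z)" using integrable_levy_weight[OF s n] by simp
      show "\<bar>sdiff f x z / norm z powr p\<bar> \<le> D * levy_weight s z" for z
        using D(2)[of x z] by (simp add: levy_weight_def p_def divide_right_mono)
    qed
    then show ?thesis by (simp add: W_def)
  qed
  have f0: "f y = 0" if "1 \<le> norm y" for y
    using test_support[OF f] that by (metis mem_ball_0 not_le subsetD)
  define N where "N = (\<integral>y. \<bar>f y\<bar> \<partial>lborel)"
  have intf: "integrable lborel (\<lambda>y. \<bar>f y\<bar>)"
  proof -
    obtain K where K: "compact K" "\<And>x. x \<notin> K \<Longrightarrow> f x = 0" using test_support[OF f] by metis
    have "integrable lborel (\<lambda>y. indicator K y *\<^sub>R f y)"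
      using borel_integrable_compact[OF K(1) test_continuous[OF f]] by simp
    moreover have "(\<lambda>y. indicator K y *\<^sub>R f y) = f" using K(2) by (auto simp: fun_eq_iff indicator_def)
    ultimately show ?thesis by simp
  qed
  have N: "N \<ge> 0" unfolding N_def by simp
  have J2: "\<bar>?J x\<bar> \<le> 2 * N * 2 powr p / norm x powr p" if x: "2 \<le> norm x" for x
  proof -
    have i: "integrable lborel (\<lambda>z. \<bar>f (x + z)\<bar>)" "integrable lborel (\<lambda>z. \<bar>f (x - z)\<bar>)"
      using intf lborel_integral_shift(3,4)[of "\<lambda>y. \<bar>f y\<bar>" x] by simp_all
    have "\<bar>?J x\<bar> \<le> (\<integral>z. (\<bar>f (x + z)\<bar> + \<bar>f (x - z)\<bar>) * (2 powr p / norm x powr p) \<partial>lborel)"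
    proof (rule Bochner_Integration.integral_abs_bound_integral)
      show "integrable lborel (\<lambda>z. sdiff f x z / norm z powr p)"
        unfolding p_def by (rule integrable_sdiff[OF s n f])
      show "integrable lborel (\<lambda>z. (\<bar>f (x + z)\<bar> + \<bar>f (x - z)\<bar>) * (2 powr p / norm x powr p))"
        by (intro integrable_mult_left Bochner_Integration.integrable_add i)
      fix z
      show "\<bar>sdiff f x z / norm z powr p\<bar> \<le> (\<bar>f (x + z)\<bar> + \<bar>f (x - z)\<bar>) * (2 powr p / norm x powr p)"
      proof (cases "norm z < norm x / 2")
        case True
        then have "1 \<le> norm (x + z)" "1 \<le> norm (x - z)"
          using x norm_triangle_ineq2[of x "- z"] norm_triangle_ineq2[of x z] by auto
        then show ?thesis using x f0[of x] f0[of "x + z"] f0[of "x - z"] by (simp add: sdiff_def)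
      next
        case False
        have "(norm x / 2) powr p \<le> norm z powr p" using False p by (intro powr_mono2) auto
        then have "1 / norm z powr p \<le> 1 / (norm x / 2) powr p"
          using x by (intro divide_left_mono mult_pos_pos) (auto intro!: powr_gt_zero[THEN iffD2])
        also have "\<dots> = 2 powr p / norm x powr p" using x by (simp add: powr_divide)
        finally have "1 / norm z powr p \<le> 2 powr p / norm x powr p" .
        moreover have "\<bar>sdiff f x z\<bar> \<le> \<bar>f (x + z)\<bar> + \<bar>f (x - z)\<bar>"
          using f0[of x] x by (simp add: sdiff_def)
        ultimately have "\<bar>sdiff f x z\<bar> * (1 / norm z powr p) \<le> (\<bar>f (x + z)\<bar> + \<bar>f (x - z)\<bar>) * (2 powr p / norm x powr p)"
          by (intro mult_mono) auto
        then show ?thesis by simp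
      qed
    qed
    also have "\<dots> = (N + N) * (2 powr p / norm x powr p)"
      unfolding N_def using i lborel_integral_shift(1,2)[of "\<lambda>y. \<bar>f y\<bar>" x] by simp
    finally show ?thesis by simp
  qed
  have lap0: "laplacian f x = 0" if "2 \<le> norm x" for x
    using test_support[OF test_laplacian[OF f]] that
    by (metis mem_ball_0 not_le subsetD one_le_numeral order_trans)
  \<comment> \<open>The first summand serves |x| < 2, where 1 + |x|^p <= 1 + 2^p; the second serves
    |x| >= 2, where 1 + |x|^p <= 2 |x|^p.\<close>
  define C where "C = (A + ?c * (D * W)) * (1 + 2 powr p) + ?c * (2 * N * 2 powr p) * 2"
  have C0: "0 \<le> A + ?c * (D * W)" "0 \<le> ?c * (2 * N * 2 powr p)"
    by (intro add_nonneg_nonneg mult_nonneg_nonneg A c D W N powr_ge_zero zero_le_numeral)+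
  show ?thesis
  proof (rule that[of C])
    show "0 \<le> C" unfolding C_def using mult_nonneg_nonneg[OF C0(1), of "1 + 2 powr p"] C0(2) by (simp add: add_nonneg_nonneg)
    fix x :: 'a
    have pos: "0 < 1 + norm x powr p" by (simp add: add_pos_nonneg)
    have "\<bar>mixed_op s f x\<bar> * (1 + norm x powr p) \<le> C"
    proof (cases "norm x < 2")
      case True
      have "\<bar>mixed_op s f x\<bar> \<le> A + ?c * (D * W)"
        using A(2)[of x] mult_left_mono[OF J1[of x] c] abs_mult[of ?c "?J x"] abs_of_nonneg[OF c] unfolding eq by linarith
      moreover have "norm x powr p \<le> 2 powr p" using True p by (intro powr_mono2) auto
      ultimately have "\<bar>mixed_op s f x\<bar> * (1 + norm x powr p) \<le> (A + ?c * (D * W)) * (1 + 2 powr p)"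
        using C0 by (intro mult_mono) auto
      then show ?thesis unfolding C_def using C0 by linarith
    next
      case False
      then have x: "2 \<le> norm x" by simp
      then have x1: "1 \<le> norm x powr p" using p by (intro ge_one_powr_ge_zero) auto
      have "\<bar>mixed_op s f x\<bar> \<le> ?c * (2 * N * 2 powr p / norm x powr p)"
        using mult_left_mono[OF J2[OF x] c] abs_mult[of ?c "?J x"] abs_of_nonneg[OF c] lap0[OF x] unfolding eq by linarith
      then have "\<bar>mixed_op s f x\<bar> * (1 + norm x powr p) \<le> ?c * (2 * N * 2 powr p / norm x powr p) * (2 * norm x powr p)"
        using x1 by (intro mult_mono) auto
      also have "\<dots> = ?c * (2 * N * 2 powr p) * 2" using x1 x by (auto simp: field_simps)
      also have "\<dots> \<le> C" unfolding C_def using C0 by simp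
      finally show ?thesis .
    qed
    then show "\<bar>mixed_op s f x\<bar> \<le> C / (1 + norm x powr (real DIM('a) + 2 * s))"
      using pos by (simp add: p_def pos_le_divide_eq)
  qed
qed

lemma integrable_mixed_op:
  assumes n: "2 \<le> DIM('a::euclidean_space)" and f: "(f :: 'a \<Rightarrow> real) \<in> test_functions (ball 0 1)"
    and u: "u \<in> weighted_L1 s"
  shows "integrable lebesgue (\<lambda>x. u x * mixed_op s f x)"
proof -
  obtain C where C: "0 \<le> C" "\<And>x. \<bar>mixed_op s f x\<bar> \<le> C / (1 + norm x powr (real DIM('a) + 2 * s))"
    using mixed_op_decay[OF n f] by metis
  have u_meas: "u \<in> borel_measurable lebesgue"
    using u by (auto simp: weighted_L1_def L1_loc_def intro: L1_loc_measurable)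
  show ?thesis
  proof (rule Bochner_Integration.integrable_bound)
    show "integrable lebesgue (\<lambda>x. C * (\<bar>u x\<bar> / (1 + norm x powr (real DIM('a) + 2 * s))))"
      using u by (intro integrable_mult_right) (simp add: weighted_L1_def)
    show "(\<lambda>x. u x * mixed_op s f x) \<in> borel_measurable lebesgue"
      using measurable_completion[of "mixed_op s f" lborel borel] mixed_op_measurable[OF n f]
      by (intro borel_measurable_times u_meas) auto
    show "AE x in lebesgue. norm (u x * mixed_op s f x) \<le> norm (C * (\<bar>u x\<bar> / (1 + norm x powr (real DIM('a) + 2 * s))))"
    proof (intro AE_I2)
      fix x
      have "\<bar>u x\<bar> * \<bar>mixed_op s f x\<bar> \<le> \<bar>u x\<bar> * (C / (1 + norm x powr (real DIM('a) + 2 * s)))"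
        by (intro mult_left_mono C) simp
      then show "norm (u x * mixed_op s f x) \<le> norm (C * (\<bar>u x\<bar> / (1 + norm x powr (real DIM('a) + 2 * s))))"
        using C(1) by (simp add: abs_mult mult.commute add_nonneg_nonneg)
    qed
  qed
qed

end

section \<open>Logarithmic cutoffs\<close>

text \<open>The factor t makes the second derivative exactly \<open>flat 3\<close>, hence
  nonnegative; exp (-1/t) by itself is not convex on the positive half-line.\<close>

definition ramp :: "real \<Rightarrow> real" where "ramp t = t * flat 0 t"
definition ramp' :: "real \<Rightarrow> real" where "ramp' t = flat 0 t + flat 1 t"

lemma DERIV_ramp: "(ramp has_real_derivative ramp' t) (at t)"
proof -
  have "t * flat 2 t = flat 1 t" by (auto simp: flat_def power2_eq_square)
  then show ?thesis
    unfolding ramp_def[abs_def] ramp'_def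
    using DERIV_mult[OF DERIV_ident DERIV_flat[of 0 t]] by (simp add: numeral_2_eq_2 algebra_simps)
qed

lemma DERIV_ramp': "(ramp' has_real_derivative flat 3 t) (at t)"
  unfolding ramp'_def[abs_def]
  using DERIV_add[OF DERIV_flat[of 0 t] DERIV_flat[of 1 t]] by (simp add: eval_nat_numeral)

text \<open>The upper bound is 1 + y <= exp y at y = 1/t.\<close>

lemma ramp'_bounds: "0 \<le> ramp' t" "ramp' t \<le> 1"
proof -
  show "0 \<le> ramp' t" by (simp add: ramp'_def flat_nonneg)
  show "ramp' t \<le> 1"
  proof (cases "t > 0")
    case True
    then have "ramp' t = (1 + 1 / t) / exp (1 / t)" by (simp add: ramp'_def flat_def exp_minus field_simps)
    also have "\<dots> \<le> 1" using exp_ge_add_one_self[of "1 / t"] by (simp add: add.commute)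
    finally show ?thesis .
  qed (simp add: ramp'_def flat_def)
qed

lemma ramp_eq_0: "t \<le> 0 \<Longrightarrow> ramp t = 0"
  by (simp add: ramp_def flat_def)

lemma ramp_bounds: "0 \<le> ramp t" "ramp t \<le> max 0 t"
proof -
  show "0 \<le> ramp t" by (cases "t > 0") (auto simp: ramp_def flat_def)
  show "ramp t \<le> max 0 t" by (cases "t > 0") (auto simp: ramp_def flat_def)
qed

lemma Ck_on_ident: "Ck_on k S (\<lambda>t::real. t)"
  using Ck_on_inner_left[of k S "1::real"] by simp

lemma Ck_on_ramp: "Ck_on k UNIV ramp"
  unfolding ramp_def[abs_def] by (intro Ck_on_mult Ck_on_ident Ck_on_flat open_UNIV)

section \<open>The convex profile and its cutoff\<close>

locale log_profile =
  fixes \<epsilon> \<gamma> :: real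
  assumes eps: "0 < \<epsilon>" and gam: "0 < \<gamma>"
begin

definition \<Phi> :: "real \<Rightarrow> real" where "\<Phi> t = ramp (1 + \<epsilon> * (t + exp (\<gamma> * t)))"
definition \<Phi>1 :: "real \<Rightarrow> real" where
  "\<Phi>1 t = ramp' (1 + \<epsilon> * (t + exp (\<gamma> * t))) * (\<epsilon> * (1 + \<gamma> * exp (\<gamma> * t)))"
definition \<Phi>2 :: "real \<Rightarrow> real" where
  "\<Phi>2 t = flat 3 (1 + \<epsilon> * (t + exp (\<gamma> * t))) * (\<epsilon> * (1 + \<gamma> * exp (\<gamma> * t)))\<^sup>2
     + ramp' (1 + \<epsilon> * (t + exp (\<gamma> * t))) * (\<epsilon> * \<gamma>\<^sup>2 * exp (\<gamma> * t))"

lemma DERIV_\<Phi>: "(\<Phi> has_real_derivative \<Phi>1 t) (at t)"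
  unfolding \<Phi>_def[abs_def] \<Phi>1_def
  by (rule DERIV_chain2[OF DERIV_ramp]) (auto intro!: derivative_eq_intros simp: algebra_simps)

lemma DERIV_\<Phi>1: "(\<Phi>1 has_real_derivative \<Phi>2 t) (at t)"
proof -
  let ?v = "\<lambda>t. 1 + \<epsilon> * (t + exp (\<gamma> * t))" and ?w = "\<lambda>t. \<epsilon> * (1 + \<gamma> * exp (\<gamma> * t))"
  have v: "(?v has_real_derivative ?w t) (at t)" by (auto intro!: derivative_eq_intros simp: algebra_simps)
  have w: "(?w has_real_derivative \<epsilon> * \<gamma>\<^sup>2 * exp (\<gamma> * t)) (at t)"
    by (auto intro!: derivative_eq_intros simp: algebra_simps power2_eq_square)
  show ?thesis
    unfolding \<Phi>1_def[abs_def] \<Phi>2_def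
    using DERIV_mult[OF DERIV_chain2[OF DERIV_ramp' v] w] by (simp add: algebra_simps power2_eq_square)
qed

lemma \<Phi>1_nonneg: "0 \<le> \<Phi>1 t"
  using eps gam by (auto simp: \<Phi>1_def ramp'_bounds intro!: mult_nonneg_nonneg add_nonneg_nonneg)

text \<open>The part dropped comes from F'' >= 0. What remains has the same factor
  \<open>ramp'\<close> as \<open>\<Phi>1\<close>, so the two can be compared even where that factor
  is tiny.\<close>

lemma \<Phi>2_ge: "ramp' (1 + \<epsilon> * (t + exp (\<gamma> * t))) * (\<epsilon> * \<gamma>\<^sup>2 * exp (\<gamma> * t)) \<le> \<Phi>2 t"
  by (simp add: \<Phi>2_def flat_nonneg)

lemma \<Phi>2_nonneg: "0 \<le> \<Phi>2 t"
  using eps by (intro order_trans[OF _ \<Phi>2_ge]) (simp add: ramp'_bounds)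

lemma \<Phi>_convex: "\<Phi> a - \<Phi> b \<le> \<Phi>1 a * (a - b)"
proof -
  have mono: "x \<le> y \<Longrightarrow> \<Phi>1 x \<le> \<Phi>1 y" for x y
    by (rule DERIV_nonneg_imp_nondecreasing) (use DERIV_\<Phi>1 \<Phi>2_nonneg in auto)
  consider "a = b" | "a < b" | "b < a" by linarith
  then show ?thesis
  proof cases
    case 2
    then obtain z where z: "a < z" "z < b" "\<Phi> b - \<Phi> a = (b - a) * \<Phi>1 z" using MVT2[OF 2, of \<Phi> \<Phi>1] DERIV_\<Phi> by auto
    have "(b - a) * \<Phi>1 a \<le> (b - a) * \<Phi>1 z" using mono[of a z] z by (intro mult_left_mono) auto
    then show ?thesis using z(3) by (simp add: algebra_simps)
  next
    case 3
    then obtain z where z: "b < z" "z < a" "\<Phi> a - \<Phi> b = (a - b) * \<Phi>1 z" using MVT2[OF 3, of \<Phi> \<Phi>1] DERIV_\<Phi> by auto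
    have "(a - b) * \<Phi>1 z \<le> (a - b) * \<Phi>1 a" using mono[of z a] z by (intro mult_left_mono) auto
    then show ?thesis using z(3) by (simp add: algebra_simps)
  qed simp
qed

definition \<eta> :: "'a::euclidean_space \<Rightarrow> real" where
  "\<eta> x = (if x = 0 then 0 else \<Phi> (ln (x \<bullet> x)))"

lemma \<eta>_nonneg: "0 \<le> \<eta> x"
  by (simp add: \<eta>_def \<Phi>_def ramp_bounds)

text \<open>In the unit ball ln |x|^2 is negative, so the exponential is at most 1 and the argument
  of \<open>ramp\<close> is at most 1 + \<epsilon>.\<close>

lemma \<eta>_le:
  assumes "norm x < 1" "\<epsilon> \<le> 1"
  shows "\<eta> x \<le> 2"
proof (cases "x = 0")
  case False
  then have q: "0 < x \<bullet> x" "x \<bullet> x < 1" using assms by (auto simp: dot_square_norm power_less_one_iff)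
  let ?t = "ln (x \<bullet> x)"
  have "?t < 0" using q by (simp add: ln_less_zero_iff)
  then have "exp (\<gamma> * ?t) \<le> 1" "?t \<le> 0" using gam by (auto simp: mult_le_0_iff)
  then have "?t + exp (\<gamma> * ?t) \<le> 1" by linarith
  then have "\<epsilon> * (?t + exp (\<gamma> * ?t)) \<le> \<epsilon> * 1" using eps by (intro mult_left_mono) auto
  then have "1 + \<epsilon> * (?t + exp (\<gamma> * ?t)) \<le> 2" using assms by linarith
  then show ?thesis using ramp_bounds(2)[of "1 + \<epsilon> * (?t + exp (\<gamma> * ?t))"] False by (simp add: \<eta>_def \<Phi>_def)
qed (simp add: \<eta>_def)

lemma \<eta>_eq_0_near:
  obtains \<delta> where "0 < \<delta>" "\<And>x::'a::euclidean_space. norm x < \<delta> \<Longrightarrow> \<eta> x = 0"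
proof -
  \<comment> \<open>Then |x| < \<delta> means ln |x|^2 < -(1/\<epsilon> + 1). As the exponential is
    at most 1, the argument of \<open>ramp\<close> is not positive.\<close>
  define \<delta> where "\<delta> = exp (- (1 / \<epsilon> + 1) / 2)"
  have "\<eta> x = 0" if x: "norm x < \<delta>" for x :: 'a
  proof (cases "x = 0")
    case False
    then have "ln (norm x) < ln \<delta>" using x by (subst ln_less_cancel_iff) (auto simp: \<delta>_def)
    moreover have l: "ln (x \<bullet> x) = 2 * ln (norm x)" using False by (simp add: dot_square_norm ln_realpow)
    ultimately have t: "ln (x \<bullet> x) < - (1 / \<epsilon> + 1)" by (simp add: \<delta>_def)
    then have "ln (x \<bullet> x) \<le> 0" using eps by (smt (verit) divide_pos_pos)
    then have "exp (\<gamma> * ln (x \<bullet> x)) \<le> 1" using gam by (simp add: mult_le_0_iff)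
    then have "ln (x \<bullet> x) + exp (\<gamma> * ln (x \<bullet> x)) \<le> - (1 / \<epsilon>)" using t by linarith
    then have "\<epsilon> * (ln (x \<bullet> x) + exp (\<gamma> * ln (x \<bullet> x))) \<le> \<epsilon> * - (1 / \<epsilon>)" using eps by (intro mult_left_mono) auto
    then show ?thesis using eps by (simp add: \<eta>_def \<Phi>_def ramp_eq_0)
  qed (simp add: \<eta>_def)
  then show ?thesis by (intro that[of \<delta>]) (auto simp: \<delta>_def)
qed

lemma Ck_on_\<Phi>: "Ck_on k UNIV \<Phi>"
proof -
  have "Ck_on k UNIV (\<lambda>t. exp (\<gamma> * t))"
    by (rule Ck_on_compose[OF open_UNIV open_UNIV _ Ck_on_exp]) (auto intro!: Ck_on_mult Ck_on_const Ck_on_ident)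
  then show ?thesis unfolding \<Phi>_def[abs_def]
    by (intro Ck_on_compose[OF open_UNIV open_UNIV _ Ck_on_ramp]) (auto intro!: Ck_on_add Ck_on_mult Ck_on_const Ck_on_ident)
qed

text \<open>Two open pieces cover the space: off the origin \<eta> is a composite of smooth
  functions, and near the origin it is identically 0.\<close>

lemma Ck_on_\<eta>: "Ck_on k UNIV (\<eta> :: 'a::euclidean_space \<Rightarrow> real)"
proof -
  obtain \<delta> where \<delta>: "0 < \<delta>" "\<And>x::'a. norm x < \<delta> \<Longrightarrow> \<eta> x = 0" using \<eta>_eq_0_near by metis
  have o: "open (- {0::'a})" by auto
  have "Ck_on k (- {0::'a}) (\<lambda>x. ln (x \<bullet> x))"
    by (rule Ck_on_compose[OF o, of "{0<..}"]) (auto intro!: Ck_on_ln Ck_on_inner_self)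
  then have "Ck_on k (- {0::'a}) (\<lambda>x. \<Phi> (ln (x \<bullet> x)))"
    by (intro Ck_on_compose[OF o open_UNIV _ Ck_on_\<Phi>]) auto
  then have 1: "Ck_on k (- {0::'a}) \<eta>"
    by (rule Ck_on_cong[OF o, rotated]) (simp add: \<eta>_def)
  have 2: "Ck_on k (ball (0::'a) \<delta>) \<eta>"
    by (rule Ck_on_cong[OF open_ball _ Ck_on_const[of _ _ 0]]) (simp add: \<delta>)
  have "- {0::'a} \<union> ball 0 \<delta> = UNIV" using \<delta>(1) by auto
  then show ?thesis using Ck_on_Un[OF o open_ball 1 2] by simp
qed

lemma test_mult_\<eta>:
  assumes "f \<in> test_functions \<Omega>"
  shows "(\<lambda>x. f x * \<eta> x) \<in> test_functions (\<Omega> - {0})" "(\<lambda>x. f x * \<eta> x) \<in> test_functions \<Omega>"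
proof -
  show TF: "(\<lambda>x. f x * \<eta> x) \<in> test_functions \<Omega>" by (intro test_mult assms Ck_on_\<eta>)
  obtain \<delta> where \<delta>: "0 < \<delta>" "\<And>x::'a. norm x < \<delta> \<Longrightarrow> \<eta> x = 0" using \<eta>_eq_0_near by metis
  obtain K where K: "compact K" "K \<subseteq> \<Omega>" "\<And>x. x \<notin> K \<Longrightarrow> f x = 0"
    using test_support[OF assms] by metis
  show "(\<lambda>x. f x * \<eta> x) \<in> test_functions (\<Omega> - {0})"
  proof (rule test_functionI[OF test_Ck[OF TF]])
    show "compact (K - ball 0 \<delta>)" using K by (intro compact_diff) auto
    show "K - ball 0 \<delta> \<subseteq> \<Omega> - {0}" using K(2) \<delta>(1) by auto
    show "f x * \<eta> x = 0" if "x \<notin> K - ball 0 \<delta>" for x using that K(3) \<delta>(2)[of x] by auto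
  qed
qed

text \<open>Product and chain rule for ell = ln |x|^2, whose gradient is 2x/|x|^2. Hence |grad
  ell|^2 = 4/|x|^2 multiplies \<open>\<Phi>2\<close>, and the Laplacian (2n - 4)/|x|^2 of ell
  multiplies \<open>\<Phi>1\<close>.\<close>

lemma laplacian_mult_\<eta>:
  fixes f :: "'a::euclidean_space \<Rightarrow> real"
  assumes f: "f \<in> test_functions \<Omega>" and x: "x \<noteq> 0"
  shows "laplacian (\<lambda>x. f x * \<eta> x) x = \<eta> x * laplacian f x
    + 4 * \<Phi>1 (ln (x \<bullet> x)) / (x \<bullet> x) * (\<Sum>i\<in>Basis. (x \<bullet> i) * partial_deriv i f x)
    + f x * (4 * \<Phi>2 (ln (x \<bullet> x)) / (x \<bullet> x) + \<Phi>1 (ln (x \<bullet> x)) * (2 * real DIM('a) - 4) / (x \<bullet> x))"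
proof -
  have fd: "(g has_derivative (\<lambda>v. \<Sum>j\<in>Basis. (v \<bullet> j) * partial_deriv j g y)) (at y)" if "g \<in> test_functions \<Omega>" for g y
    by (rule test_has_derivative[OF that])
  have basis: "(\<Sum>j\<in>Basis. (i \<bullet> j) * h j) = h i" if "i \<in> Basis" for i :: 'a and h :: "'a \<Rightarrow> real"
    using that by (simp add: inner_Basis if_distrib[of "\<lambda>a. a * _"] sum.If_cases cong: if_cong)
  have sq: "((\<lambda>y. y \<bullet> y) has_derivative (\<lambda>h. 2 * (y \<bullet> h))) (at y)" for y :: 'a
    by (auto intro!: derivative_eq_intros simp: inner_commute)
  have lnd: "((\<lambda>y. ln (y \<bullet> y)) has_derivative (\<lambda>h. 2 * (y \<bullet> h) / (y \<bullet> y))) (at y)" if "y \<noteq> 0" for y :: 'a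
    using that has_derivative_ln[OF _ sq[of y]] by (simp add: divide_inverse mult.commute)
  have d0: "((\<lambda>y. \<Phi> (ln (y \<bullet> y))) has_derivative (\<lambda>h. \<Phi>1 (ln (y \<bullet> y)) * (2 * (y \<bullet> h) / (y \<bullet> y)))) (at y)"
    if "y \<noteq> 0" for y :: 'a
    using has_derivative_compose[OF lnd[OF that] DERIV_\<Phi>[unfolded has_field_derivative_def]] .
  have d1: "((\<lambda>y. \<Phi>1 (ln (y \<bullet> y))) has_derivative (\<lambda>h. \<Phi>2 (ln (y \<bullet> y)) * (2 * (y \<bullet> h) / (y \<bullet> y)))) (at y)"
    if "y \<noteq> 0" for y :: 'a
    using has_derivative_compose[OF lnd[OF that] DERIV_\<Phi>1[unfolded has_field_derivative_def]] .
  have d2: "((\<lambda>y. 2 * (y \<bullet> i) / (y \<bullet> y)) has_derivative (\<lambda>h. 2 * (h \<bullet> i) / (y \<bullet> y) - 4 * (y \<bullet> i) * (y \<bullet> h) / (y \<bullet> y)\<^sup>2)) (at y)"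
    if "y \<noteq> 0" for y i :: 'a
    using that
    by (auto intro!: derivative_eq_intros simp: inner_commute divide_simps power2_eq_square)
  have first: "partial_deriv i (\<lambda>x. f x * \<eta> x) y
      = f y * (\<Phi>1 (ln (y \<bullet> y)) * (2 * (y \<bullet> i) / (y \<bullet> y))) + partial_deriv i f y * \<Phi> (ln (y \<bullet> y))"
    if y: "y \<noteq> 0" and i: "i \<in> Basis" for y i
  proof -
    have "((\<lambda>y. f y * \<Phi> (ln (y \<bullet> y))) has_derivative (\<lambda>h. f y * (\<Phi>1 (ln (y \<bullet> y)) * (2 * (y \<bullet> h) / (y \<bullet> y)))
       + (\<Sum>j\<in>Basis. (h \<bullet> j) * partial_deriv j f y) * \<Phi> (ln (y \<bullet> y)))) (at y)"
      by (rule has_derivative_mult[OF fd[OF f] d0[OF y]])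
    then have "((\<lambda>y. f y * \<eta> y) has_derivative (\<lambda>h. f y * (\<Phi>1 (ln (y \<bullet> y)) * (2 * (y \<bullet> h) / (y \<bullet> y)))
       + (\<Sum>j\<in>Basis. (h \<bullet> j) * partial_deriv j f y) * \<Phi> (ln (y \<bullet> y)))) (at y)"
      by (rule has_derivative_transform_within_open[of _ _ _ _ "- {0}"]) (use y in \<open>auto simp: \<eta>_def\<close>)
    from partial_deriv_eq[OF this, of i] show ?thesis by (simp add: basis[OF i])
  qed
  have second: "partial_deriv i (partial_deriv i (\<lambda>x. f x * \<eta> x)) x
    = \<eta> x * partial_deriv i (partial_deriv i f) x
      + 4 * \<Phi>1 (ln (x \<bullet> x)) / (x \<bullet> x) * ((x \<bullet> i) * partial_deriv i f x)
      + f x * (4 * \<Phi>2 (ln (x \<bullet> x)) / (x \<bullet> x)\<^sup>2 * (x \<bullet> i)\<^sup>2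
          + \<Phi>1 (ln (x \<bullet> x)) * (2 / (x \<bullet> x) - 4 * (x \<bullet> i)\<^sup>2 / (x \<bullet> x)\<^sup>2))" if i: "i \<in> Basis" for i
  proof -
    let ?l = "ln (x \<bullet> x)"
    have A: "((\<lambda>y. \<Phi>1 (ln (y \<bullet> y)) * (2 * (y \<bullet> i) / (y \<bullet> y))) has_derivative
       (\<lambda>h. \<Phi>1 ?l * (2 * (h \<bullet> i) / (x \<bullet> x) - 4 * (x \<bullet> i) * (x \<bullet> h) / (x \<bullet> x)\<^sup>2)
          + \<Phi>2 ?l * (2 * (x \<bullet> h) / (x \<bullet> x)) * (2 * (x \<bullet> i) / (x \<bullet> x)))) (at x)"
      by (rule has_derivative_mult[OF d1[OF x] d2[OF x]])
    have "((\<lambda>y. f y * (\<Phi>1 (ln (y \<bullet> y)) * (2 * (y \<bullet> i) / (y \<bullet> y))) + partial_deriv i f y * \<Phi> (ln (y \<bullet> y))) has_derivative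
      (\<lambda>h. (f x * (\<Phi>1 ?l * (2 * (h \<bullet> i) / (x \<bullet> x) - 4 * (x \<bullet> i) * (x \<bullet> h) / (x \<bullet> x)\<^sup>2)
          + \<Phi>2 ?l * (2 * (x \<bullet> h) / (x \<bullet> x)) * (2 * (x \<bullet> i) / (x \<bullet> x)))
        + (\<Sum>j\<in>Basis. (h \<bullet> j) * partial_deriv j f x) * (\<Phi>1 ?l * (2 * (x \<bullet> i) / (x \<bullet> x))))
        + (partial_deriv i f x * (\<Phi>1 ?l * (2 * (x \<bullet> h) / (x \<bullet> x)))
        + (\<Sum>j\<in>Basis. (h \<bullet> j) * partial_deriv j (partial_deriv i f) x) * \<Phi> ?l))) (at x)"
      by (intro has_derivative_add has_derivative_mult[OF fd[OF f] A]
          has_derivative_mult[OF fd[OF test_partial_deriv[OF f i]] d0[OF x]])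
    then have "(partial_deriv i (\<lambda>x. f x * \<eta> x) has_derivative
      (\<lambda>h. (f x * (\<Phi>1 ?l * (2 * (h \<bullet> i) / (x \<bullet> x) - 4 * (x \<bullet> i) * (x \<bullet> h) / (x \<bullet> x)\<^sup>2)
          + \<Phi>2 ?l * (2 * (x \<bullet> h) / (x \<bullet> x)) * (2 * (x \<bullet> i) / (x \<bullet> x)))
        + (\<Sum>j\<in>Basis. (h \<bullet> j) * partial_deriv j f x) * (\<Phi>1 ?l * (2 * (x \<bullet> i) / (x \<bullet> x))))
        + (partial_deriv i f x * (\<Phi>1 ?l * (2 * (x \<bullet> h) / (x \<bullet> x)))
        + (\<Sum>j\<in>Basis. (h \<bullet> j) * partial_deriv j (partial_deriv i f) x) * \<Phi> ?l))) (at x)"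
      by (rule has_derivative_transform_within_open[of _ _ _ _ "- {0}"]) (use x i in \<open>auto simp: first\<close>)
    from partial_deriv_eq[OF this, of i]
    show ?thesis using x i by (simp add: basis[OF i] \<eta>_def power2_eq_square field_simps)
  qed
  have S: "(\<Sum>i\<in>Basis. (x \<bullet> i)\<^sup>2) = x \<bullet> x"
    by (simp add: euclidean_inner[of x x] power2_eq_square)
  have "laplacian (\<lambda>x. f x * \<eta> x) x = (\<Sum>i\<in>Basis. \<eta> x * partial_deriv i (partial_deriv i f) x
      + 4 * \<Phi>1 (ln (x \<bullet> x)) / (x \<bullet> x) * ((x \<bullet> i) * partial_deriv i f x)
      + f x * (4 * \<Phi>2 (ln (x \<bullet> x)) / (x \<bullet> x)\<^sup>2 * (x \<bullet> i)\<^sup>2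
          + \<Phi>1 (ln (x \<bullet> x)) * (2 / (x \<bullet> x) - 4 * (x \<bullet> i)\<^sup>2 / (x \<bullet> x)\<^sup>2)))"
    unfolding laplacian_def by (intro sum.cong second refl)
  also have "\<dots> = \<eta> x * laplacian f x
    + 4 * \<Phi>1 (ln (x \<bullet> x)) / (x \<bullet> x) * (\<Sum>i\<in>Basis. (x \<bullet> i) * partial_deriv i f x)
    + f x * (4 * \<Phi>2 (ln (x \<bullet> x)) / (x \<bullet> x)\<^sup>2 * (\<Sum>i\<in>Basis. (x \<bullet> i)\<^sup>2)
          + \<Phi>1 (ln (x \<bullet> x)) * (real DIM('a) * (2 / (x \<bullet> x)) - 4 * (\<Sum>i\<in>Basis. (x \<bullet> i)\<^sup>2) / (x \<bullet> x)\<^sup>2))"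
    unfolding laplacian_def
    by (simp add: sum.distrib sum_distrib_left[symmetric] sum_subtractf sum_divide_distrib[symmetric])
  also have "\<dots> = \<eta> x * laplacian f x
    + 4 * \<Phi>1 (ln (x \<bullet> x)) / (x \<bullet> x) * (\<Sum>i\<in>Basis. (x \<bullet> i) * partial_deriv i f x)
    + f x * (4 * \<Phi>2 (ln (x \<bullet> x)) / (x \<bullet> x) + \<Phi>1 (ln (x \<bullet> x)) * (2 * real DIM('a) - 4) / (x \<bullet> x))"
    unfolding S using x by (simp add: power2_eq_square divide_simps)
  finally show ?thesis .
qed

end

text \<open>A majorant of ln |x|^2 - ln |y|^2 for r = |x|, obtained from 4 ln((r/|y|)^(1/2)) <= 4
  (r/|y|)^(1/2). It is cut off at |y| = r because the difference is not positive beyond. The square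
  root keeps the singularity integrable.\<close>

definition log_singularity :: "real \<Rightarrow> 'a::euclidean_space \<Rightarrow> real" where
  "log_singularity r y = 4 * (r powr (1/2) * norm y powr (- (1/2))) * indicator (ball 0 r) y"

lemma log_singularity_nonneg: "0 \<le> log_singularity r y"
  by (simp add: log_singularity_def)

lemma log_singularity_measurable [measurable]: "log_singularity r \<in> borel_measurable borel"
proof -
  have "(\<lambda>y::'a. norm y powr (- (1/2))) \<in> borel_measurable borel" by measurable
  then show ?thesis unfolding log_singularity_def[abs_def]
    by (intro borel_measurable_times borel_measurable_const borel_measurable_indicator) auto
qed

abbreviation log_diff_pair :: "('a::euclidean_space \<Rightarrow> real) \<Rightarrow> 'a \<Rightarrow> 'a \<Rightarrow> real" where
  "log_diff_pair \<phi> x z \<equiv> \<phi> (x + z) * (ln (x \<bullet> x) - ln ((x + z) \<bullet> (x + z)))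
     + \<phi> (x - z) * (ln (x \<bullet> x) - ln ((x - z) \<bullet> (x - z)))"

lemma log_diff_le_log_singularity:
  assumes "x \<noteq> 0" "y \<noteq> 0"
  shows "ln (x \<bullet> x) - ln (y \<bullet> y) \<le> log_singularity (norm x) y"
proof (cases "norm y < norm x")
  case True
  have "ln (x \<bullet> x) - ln (y \<bullet> y) = 4 * ((1/2) * ln (norm x / norm y))"
    using assms by (simp add: dot_square_norm ln_realpow ln_div)
  also have "(1/2) * ln (norm x / norm y) = ln ((norm x / norm y) powr (1/2))"
    using assms by (subst ln_powr) auto
  also have "\<dots> \<le> (norm x / norm y) powr (1/2)"
    using assms by (intro order_trans[OF ln_le_minus_one]) auto
  also have "(norm x / norm y) powr (1/2) = norm x powr (1/2) * norm y powr (- (1/2))"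
    using assms by (simp add: powr_divide powr_minus_divide)
  finally show ?thesis using True by (simp add: log_singularity_def)
next
  case False
  then have "x \<bullet> x \<le> y \<bullet> y" by (simp add: dot_square_norm power_mono)
  then have "ln (x \<bullet> x) \<le> ln (y \<bullet> y)" using assms by (subst ln_le_cancel_iff) auto
  then show ?thesis using log_singularity_nonneg[of "norm x" y] by linarith
qed

lemma neg_log_le:
  fixes t :: real
  assumes "\<bar>t\<bar> \<le> 1/2"
  shows "- ln (1 + t) \<le> - t + 2 * t\<^sup>2"
  using abs_ln_one_plus_x_minus_x_bound[OF assms] by simp

text \<open>For small \<open>z\<close> the first-order terms of the two logarithms cancel up to the difference of the two
  values of \<open>\<phi>\<close>, which is \<open>O(\<bar>z\<bar>)\<close>.\<close>

lemma log_diff_pair_near: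
  fixes x z :: "'a::euclidean_space"
  assumes x: "x \<noteq> 0" "norm x < 1" and z: "norm z < norm x / 8"
    and \<phi>: "\<And>y. 0 \<le> \<phi> y" "\<And>y. \<phi> y \<le> M" "\<And>y y'. \<bar>\<phi> y - \<phi> y'\<bar> \<le> L * norm (y - y')" and L: "0 \<le> L"
  shows "log_diff_pair \<phi> x z
    \<le> (36 * M + 4 * L) * ((norm z)\<^sup>2 / (norm x)\<^sup>2)"
proof -
  let ?r = "norm x" and ?q = "x \<bullet> x"
  have r: "0 < ?r" using x by simp
  have q: "?q = ?r\<^sup>2" by (rule dot_square_norm)
  then have q0: "0 < ?q" using r by simp
  \<comment> \<open>\<open>a\<close> and \<open>b\<close> are relative changes: |x + z|^2 = |x|^2 (1
    + a) and |x - z|^2 = |x|^2 (1 + b). The restriction |z| < |x|/8 keeps both below 3/8 in size,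
    within the range of \<open>neg_log_le\<close>.\<close>
  define a where "a = (2 * (x \<bullet> z) + (norm z)\<^sup>2) / ?q"
  define b where "b = (- 2 * (x \<bullet> z) + (norm z)\<^sup>2) / ?q"
  have cs: "\<bar>x \<bullet> z\<bar> \<le> ?r * norm z" by (rule Cauchy_Schwarz_ineq2)
  have zz: "(norm z)\<^sup>2 \<le> ?r * norm z" using z norm_ge_zero[of z] unfolding power2_eq_square by (intro mult_right_mono) linarith+
  have abs: "\<bar>2 * (x \<bullet> z) + (norm z)\<^sup>2\<bar> \<le> 3 * (?r * norm z)" "\<bar>- 2 * (x \<bullet> z) + (norm z)\<^sup>2\<bar> \<le> 3 * (?r * norm z)"
    using cs zz zero_le_power2[of "norm z"] by linarith+
  have "3 * (?r * norm z) / ?q = 3 * (norm z / ?r)" using r by (simp add: q power2_eq_square)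
  then have ab: "\<bar>a\<bar> \<le> 3 * (norm z / ?r)" "\<bar>b\<bar> \<le> 3 * (norm z / ?r)"
    using abs q0 divide_right_mono[OF abs(1), of ?q] divide_right_mono[OF abs(2), of ?q] unfolding a_def b_def by (simp_all add: abs_divide)
  have zr: "norm z / ?r < 1 / 8" using z r by (simp add: field_simps)
  have half: "\<bar>a\<bar> \<le> 1/2" "\<bar>b\<bar> \<le> 1/2" using ab zr by linarith+
  have xz: "(x + z) \<bullet> (x + z) = ?q * (1 + a)" "(x - z) \<bullet> (x - z) = ?q * (1 + b)"
  proof -
    have "?q * a = 2 * (x \<bullet> z) + z \<bullet> z" "?q * b = - 2 * (x \<bullet> z) + z \<bullet> z"
      using q0 by (simp_all add: a_def b_def power2_norm_eq_inner)
    then show "(x + z) \<bullet> (x + z) = ?q * (1 + a)" "(x - z) \<bullet> (x - z) = ?q * (1 + b)"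
      by (simp_all add: inner_add inner_diff inner_commute distrib_left)
  qed
  have la: "ln ?q - ln ((x + z) \<bullet> (x + z)) \<le> - a + 2 * a\<^sup>2"
    using neg_log_le[OF half(1)] half(1) q0 unfolding xz by (subst ln_mult) auto
  have lb: "ln ?q - ln ((x - z) \<bullet> (x - z)) \<le> - b + 2 * b\<^sup>2"
    using neg_log_le[OF half(2)] half(2) q0 unfolding xz by (subst ln_mult) auto
  have sq: "a\<^sup>2 \<le> 9 * ((norm z)\<^sup>2 / ?q)" "b\<^sup>2 \<le> 9 * ((norm z)\<^sup>2 / ?q)"
    using power_mono[OF ab(1) abs_ge_zero, of 2] power_mono[OF ab(2) abs_ge_zero, of 2]
    by (simp_all add: q power_mult_distrib power_divide)
  have M: "0 \<le> M" using \<phi>(1,2) order_trans by blast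
  have "\<phi> (x + z) * (ln ?q - ln ((x + z) \<bullet> (x + z))) + \<phi> (x - z) * (ln ?q - ln ((x - z) \<bullet> (x - z)))
    \<le> \<phi> (x + z) * (- a + 2 * a\<^sup>2) + \<phi> (x - z) * (- b + 2 * b\<^sup>2)"
    by (intro add_mono mult_left_mono la lb \<phi>)
  \<comment> \<open>The first-order parts of \<open>a\<close> and \<open>b\<close> are opposite, so
    they meet only the difference of the two values of \<phi>. The common part |z|^2/|x|^2 enters
    with a favourable sign.\<close>
  also have "\<dots> = (\<phi> (x + z) * (2 * a\<^sup>2) + \<phi> (x - z) * (2 * b\<^sup>2))
      + (- (\<phi> (x + z) - \<phi> (x - z)) * (2 * (x \<bullet> z) / ?q)) - (\<phi> (x + z) + \<phi> (x - z)) * ((norm z)\<^sup>2 / ?q)"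
    by (simp add: a_def b_def add_divide_distrib diff_divide_distrib algebra_simps)
  also have "\<dots> \<le> (M * (2 * (9 * ((norm z)\<^sup>2 / ?q))) + M * (2 * (9 * ((norm z)\<^sup>2 / ?q)))) + 4 * L * ((norm z)\<^sup>2 / ?q) - 0"
  proof -
    have P: "\<phi> (x + z) * (2 * a\<^sup>2) \<le> M * (2 * (9 * ((norm z)\<^sup>2 / ?q)))"
      "\<phi> (x - z) * (2 * b\<^sup>2) \<le> M * (2 * (9 * ((norm z)\<^sup>2 / ?q)))"
      using sq by (intro mult_mono \<phi> M; simp)+
    have N: "0 \<le> (\<phi> (x + z) + \<phi> (x - z)) * ((norm z)\<^sup>2 / ?q)"
      by (intro mult_nonneg_nonneg add_nonneg_nonneg \<phi>) simp
    have "- (\<phi> (x + z) - \<phi> (x - z)) * (2 * (x \<bullet> z) / ?q) \<le> \<bar>\<phi> (x + z) - \<phi> (x - z)\<bar> * \<bar>2 * (x \<bullet> z) / ?q\<bar>"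
      by (metis abs_ge_self abs_mult abs_minus_cancel)
    also have "\<dots> \<le> (L * (2 * norm z)) * (2 * (norm z / ?r))"
    proof (intro mult_mono)
      have "norm ((x + z) - (x - z)) = 2 * norm z" by (simp add: scaleR_2[symmetric])
      then show "\<bar>\<phi> (x + z) - \<phi> (x - z)\<bar> \<le> L * (2 * norm z)" using \<phi>(3)[of "x + z" "x - z"] by metis
      have "\<bar>2 * (x \<bullet> z) / ?q\<bar> = 2 * \<bar>x \<bullet> z\<bar> / ?q" by (simp add: abs_mult)
      also have "\<dots> \<le> 2 * (?r * norm z) / ?q" using cs q0 by (intro divide_right_mono) auto
      also have "\<dots> = 2 * (norm z / ?r)" using r by (simp add: q power2_eq_square)
      finally show "\<bar>2 * (x \<bullet> z) / ?q\<bar> \<le> 2 * (norm z / ?r)" .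
    qed (use L in auto)
    also have "\<dots> = 4 * L * ((norm z)\<^sup>2 * (1 / ?r))" by (simp add: power2_eq_square)
    \<comment> \<open>Here |x| < 1 enters, to pass from 1/|x| to 1/|x|^2.\<close>
    also have "\<dots> \<le> 4 * L * ((norm z)\<^sup>2 * (1 / ?q))"
    proof (intro mult_left_mono)
      have "?q \<le> ?r" unfolding q power2_eq_square using x(2) by (simp add: mult_left_le)
      then show "1 / ?r \<le> 1 / ?q" using q0 by (intro divide_left_mono) auto
    qed (use L in auto)
    finally have "- (\<phi> (x + z) - \<phi> (x - z)) * (2 * (x \<bullet> z) / ?q) \<le> 4 * L * ((norm z)\<^sup>2 / ?q)" by simp
    with P N show ?thesis by linarith
  qed
  also have "\<dots> = (36 * M + 4 * L) * ((norm z)\<^sup>2 / ?r\<^sup>2)" by (simp add: q algebra_simps)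
  finally show ?thesis .
qed

text \<open>Split at |z| = |x|/8. Near, \<open>log_diff_pair_near\<close> leaves |x|^(-2) |z|^(2 -
  2s - n), whose integral over the small ball is of order |x|^(-2s). Far, the kernel is at most
  (8/|x|)^(n + 2s), and the two logarithmic singularities have integrals of order |x|^n. The
  estimate is one-sided, which is why it is stated through an integrable majorant
  \<open>B\<close>.\<close>

lemma log_diff_pair_bound:
  assumes s: "0 < s" "s < 1" and n: "2 \<le> DIM('a::euclidean_space)"
    and \<phi>: "(\<phi> :: 'a \<Rightarrow> real) \<in> test_functions \<Omega>" "\<And>y. 0 \<le> \<phi> y"
  obtains C where "0 \<le> C" "\<And>x. x \<noteq> 0 \<Longrightarrow> norm x < 1 \<Longrightarrow>
    \<exists>B. integrable lborel B \<and> (\<integral>z. B z \<partial>lborel) \<le> C * norm x powr (- 2 * s) \<and>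
      (\<forall>z. x + z \<noteq> 0 \<longrightarrow> x - z \<noteq> 0 \<longrightarrow>
        log_diff_pair \<phi> x z / jump_denom s z \<le> B z)"
proof -
  let ?n = "real DIM('a)"
  define p where "p = ?n + 2 * s"
  have p: "0 < p" using s n by (simp add: p_def)
  obtain M where M: "0 \<le> M" "\<And>y. \<bar>\<phi> y\<bar> \<le> M" using test_bounded[OF \<phi>(1)] by metis
  have \<phi>M: "\<phi> y \<le> M" for y using M(2)[of y] by simp
  obtain L where L: "0 \<le> L" "\<And>x y. \<bar>\<phi> x - \<phi> y\<bar> \<le> L * norm (x - y)" using test_lipschitz[OF \<phi>(1)] by metis
  obtain Ca where Ca: "0 \<le> Ca" "\<And>r. 0 < r \<Longrightarrow> (\<integral>\<^sup>+(z::'a). ennreal (norm z powr ((2 - 2 * s) - real DIM('a))) * indicator (ball 0 r) z \<partial>lborel)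
       \<le> ennreal (Ca * r powr (2 - 2 * s))"
    by (rule nn_integral_norm_powr_ball[of "2 - 2 * s", where 'a='a]) (use s n in auto)
  \<comment> \<open>The choice \<alpha> = n - 1/2 gives the exponent -1/2 of
    \<open>log_singularity\<close>.\<close>
  obtain Cb where Cb: "0 \<le> Cb" "\<And>r. 0 < r \<Longrightarrow> (\<integral>\<^sup>+(z::'a). ennreal (norm z powr ((?n - 1/2) - real DIM('a))) * indicator (ball 0 r) z \<partial>lborel)
       \<le> ennreal (Cb * r powr (?n - 1/2))"
    by (rule nn_integral_norm_powr_ball[of "?n - 1/2", where 'a='a]) (use n in auto)
  define C1 where "C1 = 36 * M + 4 * L"
  have C1: "0 \<le> C1" using M L by (simp add: C1_def)
  define C where "C = C1 * Ca + 8 powr p * M * (2 * (4 * Cb))"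
  show ?thesis
  proof (rule that[of C])
    show "0 \<le> C" unfolding C_def using C1 Ca Cb M by simp
    fix x :: 'a assume x: "x \<noteq> 0" "norm x < 1"
    let ?r = "norm x"
    have r: "0 < ?r" using x by simp
    define A1 where "A1 = (\<lambda>z::'a. C1 / ?r\<^sup>2 * (norm z powr ((2 - 2 * s) - ?n) * indicator (ball 0 (?r / 8)) z))"
    define A2 where "A2 = (\<lambda>z. (8 / ?r) powr p * M * (log_singularity ?r (x + z) + log_singularity ?r (x - z)))"
    have A10: "0 \<le> A1 z" for z using C1 by (simp add: A1_def)
    have A20: "0 \<le> A2 z" for z using M by (simp add: A2_def log_singularity_nonneg)
    have meas1: "(\<lambda>z::'a. norm z powr ((2 - 2 * s) - ?n) * indicator (ball 0 (?r / 8)) z) \<in> borel_measurable borel"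
    proof (rule borel_measurable_times)
      show "(\<lambda>z::'a. norm z powr ((2 - 2 * s) - ?n)) \<in> borel_measurable borel" by measurable
    qed (auto intro: borel_measurable_indicator)
    have A1m: "A1 \<in> borel_measurable borel" unfolding A1_def
      by (intro borel_measurable_times borel_measurable_const meas1)
    have A2m: "A2 \<in> borel_measurable borel" unfolding A2_def by measurable
    have "(\<integral>\<^sup>+z. ennreal (A1 z) \<partial>lborel)
        = ennreal (C1 / ?r\<^sup>2) * (\<integral>\<^sup>+(z::'a). ennreal (norm z powr ((2 - 2 * s) - ?n)) * indicator (ball 0 (?r / 8)) z \<partial>lborel)"
    proof (subst nn_integral_cmult[symmetric])
      show "(\<lambda>z::'a. ennreal (norm z powr ((2 - 2 * s) - ?n)) * indicator (ball 0 (?r / 8)) z) \<in> borel_measurable lborel"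
        by (intro borel_measurable_times_ennreal borel_measurable_indicator; simp)
      show "(\<integral>\<^sup>+z. ennreal (A1 z) \<partial>lborel) = (\<integral>\<^sup>+(z::'a). ennreal (C1 / ?r\<^sup>2) *
         (ennreal (norm z powr ((2 - 2 * s) - ?n)) * indicator (ball 0 (?r / 8)) z) \<partial>lborel)"
        using C1 by (intro nn_integral_cong) (auto simp: A1_def indicator_def ennreal_mult[symmetric])
    qed
    also have "\<dots> \<le> ennreal (C1 / ?r\<^sup>2) * ennreal (Ca * (?r / 8) powr (2 - 2 * s))"
      using Ca(2)[of "?r / 8"] r by (intro mult_left_mono) auto
    also have "\<dots> = ennreal (C1 / ?r\<^sup>2 * (Ca * (?r / 8) powr (2 - 2 * s)))"
      using C1 Ca(1) by (intro ennreal_mult[symmetric]) auto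
    also have "\<dots> \<le> ennreal (C1 * Ca * ?r powr (- 2 * s))"
    proof (rule ennreal_leI)
      have "(?r / 8) powr (2 - 2 * s) \<le> ?r powr (2 - 2 * s)" using r s by (intro powr_mono2) auto
      then have "C1 / ?r\<^sup>2 * (Ca * (?r / 8) powr (2 - 2 * s)) \<le> C1 / ?r\<^sup>2 * (Ca * ?r powr (2 - 2 * s))"
        using C1 Ca by (intro mult_left_mono) auto
      also have "?r powr (2 - 2 * s) = ?r\<^sup>2 * ?r powr (- 2 * s)"
      proof -
        have "?r\<^sup>2 = ?r powr 2" using r by simp
        then show ?thesis by (simp only: powr_add[symmetric]) simp
      qed
      finally show "C1 / ?r\<^sup>2 * (Ca * (?r / 8) powr (2 - 2 * s)) \<le> C1 * Ca * ?r powr (- 2 * s)" using r by simp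
    qed
    finally have I1: "(\<integral>\<^sup>+z. ennreal (A1 z) \<partial>lborel) \<le> ennreal (C1 * Ca * ?r powr (- 2 * s))" .
    have "(\<integral>\<^sup>+y. ennreal (log_singularity ?r (y::'a)) \<partial>lborel)
        = ennreal (4 * ?r powr (1/2)) * (\<integral>\<^sup>+(z::'a). ennreal (norm z powr ((?n - 1/2) - ?n)) * indicator (ball 0 ?r) z \<partial>lborel)"
    proof (subst nn_integral_cmult[symmetric])
      show "(\<lambda>z::'a. ennreal (norm z powr ((?n - 1/2) - ?n)) * indicator (ball 0 ?r) z) \<in> borel_measurable lborel"
        by (intro borel_measurable_times_ennreal borel_measurable_indicator; simp)
      show "(\<integral>\<^sup>+y. ennreal (log_singularity ?r (y::'a)) \<partial>lborel) = (\<integral>\<^sup>+(z::'a). ennreal (4 * ?r powr (1/2)) *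
         (ennreal (norm z powr ((?n - 1/2) - ?n)) * indicator (ball 0 ?r) z) \<partial>lborel)"
        by (intro nn_integral_cong) (auto simp: log_singularity_def indicator_def ennreal_mult[symmetric] mult.assoc)
    qed
    also have "\<dots> \<le> ennreal (4 * ?r powr (1/2)) * ennreal (Cb * ?r powr (?n - 1/2))"
      using Cb(2)[OF r] by (intro mult_left_mono) auto
    also have "\<dots> = ennreal (4 * ?r powr (1/2) * (Cb * ?r powr (?n - 1/2)))"
      using Cb(1) by (intro ennreal_mult[symmetric]) auto
    also have "4 * ?r powr (1/2) * (Cb * ?r powr (?n - 1/2)) = 4 * Cb * ?r powr ?n"
      using r by (simp add: powr_add[symmetric] mult.left_commute[of "?r powr _"])
    finally have Is: "(\<integral>\<^sup>+y. ennreal (log_singularity ?r (y::'a)) \<partial>lborel) \<le> ennreal (4 * Cb * ?r powr ?n)" .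
    have "(\<integral>\<^sup>+z. ennreal (A2 z) \<partial>lborel)
      = ennreal ((8 / ?r) powr p * M) * (\<integral>\<^sup>+z. ennreal (log_singularity ?r (x + z)) + ennreal (log_singularity ?r (x - z)) \<partial>lborel)"
      using M by (subst nn_integral_cmult[symmetric])
        (auto simp: A2_def ennreal_mult' ennreal_plus log_singularity_nonneg intro!: nn_integral_cong)
    also have "(\<integral>\<^sup>+z. ennreal (log_singularity ?r (x + z)) + ennreal (log_singularity ?r (x - z)) \<partial>lborel)
      = (\<integral>\<^sup>+z. ennreal (log_singularity ?r (x + z)) \<partial>lborel) + (\<integral>\<^sup>+z. ennreal (log_singularity ?r (x - z)) \<partial>lborel)"
      by (rule nn_integral_add) auto
    also have "\<dots> = (\<integral>\<^sup>+y. ennreal (log_singularity ?r (y::'a)) \<partial>lborel) + (\<integral>\<^sup>+y. ennreal (log_singularity ?r (y::'a)) \<partial>lborel)"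
      using lborel_nn_integral_shift[of "\<lambda>y::'a. ennreal (log_singularity ?r y)" x] by simp
    also have "ennreal ((8 / ?r) powr p * M) * \<dots> \<le> ennreal ((8 / ?r) powr p * M) * (ennreal (4 * Cb * ?r powr ?n) + ennreal (4 * Cb * ?r powr ?n))"
      by (intro mult_left_mono add_mono Is) auto
    also have "\<dots> = ennreal ((8 / ?r) powr p * M * (4 * Cb * ?r powr ?n + 4 * Cb * ?r powr ?n))"
      using M(1) Cb(1) by (subst ennreal_plus[symmetric], simp, simp, intro ennreal_mult[symmetric]) auto
    also have "(8 / ?r) powr p * M * (4 * Cb * ?r powr ?n + 4 * Cb * ?r powr ?n) = 8 powr p * M * (2 * (4 * Cb)) * ?r powr (- 2 * s)"
    proof -
      have "(8 / ?r) powr p = 8 powr p * ?r powr (- p)" using r by (simp add: powr_divide powr_minus_divide)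
      moreover have "?r powr (- p) * ?r powr ?n = ?r powr (- 2 * s)" by (simp add: powr_add[symmetric] p_def)
      ultimately show ?thesis by (simp add: algebra_simps)
    qed
    finally have I2: "(\<integral>\<^sup>+z. ennreal (A2 z) \<partial>lborel) \<le> ennreal (8 powr p * M * (2 * (4 * Cb)) * ?r powr (- 2 * s))" .
    have "(\<integral>\<^sup>+z. ennreal (A1 z + A2 z) \<partial>lborel) = (\<integral>\<^sup>+z. ennreal (A1 z) \<partial>lborel) + (\<integral>\<^sup>+z. ennreal (A2 z) \<partial>lborel)"
      using A1m A2m A10 A20 by (subst nn_integral_add[symmetric]) (auto simp: ennreal_plus)
    also have "\<dots> \<le> ennreal (C1 * Ca * ?r powr (- 2 * s)) + ennreal (8 powr p * M * (2 * (4 * Cb)) * ?r powr (- 2 * s))"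
      by (rule add_mono[OF I1 I2])
    also have "\<dots> = ennreal (C * ?r powr (- 2 * s))"
      using C1 Ca Cb M by (subst ennreal_plus[symmetric]) (auto simp: C_def distrib_right)
    finally have I: "(\<integral>\<^sup>+z. ennreal (A1 z + A2 z) \<partial>lborel) \<le> ennreal (C * ?r powr (- 2 * s))" .
    have int: "integrable lborel (\<lambda>z. A1 z + A2 z)"
      using A1m A2m A10 A20 I by (intro integrableI_nonneg) (auto intro: le_less_trans)
    have "ennreal (\<integral>z. A1 z + A2 z \<partial>lborel) \<le> ennreal (C * ?r powr (- 2 * s))"
      using nn_integral_eq_integral[OF int] A10 A20 I by simp
    then have intle: "(\<integral>z. A1 z + A2 z \<partial>lborel) \<le> C * ?r powr (- 2 * s)"
      using \<open>0 \<le> C\<close> by (subst (asm) ennreal_le_iff) auto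
    have pt: "log_diff_pair \<phi> x z / jump_denom s z \<le> A1 z + A2 z" (is "?D / _ \<le> _") if z: "x + z \<noteq> 0" "x - z \<noteq> 0" for z
    proof (cases "norm z < ?r / 8")
      case True
      have "?D \<le> C1 * ((norm z)\<^sup>2 / ?r\<^sup>2)"
        unfolding C1_def by (rule log_diff_pair_near[OF x True \<phi>(2) \<phi>M L(2,1)])
      then have "?D / norm z powr p \<le> C1 * ((norm z)\<^sup>2 / ?r\<^sup>2) / norm z powr p" by (rule divide_right_mono) simp
      also have "\<dots> = A1 z"
      proof (cases "z = 0")
        case False
        then have "(norm z)\<^sup>2 = norm z powr 2" by simp
        then have "(norm z)\<^sup>2 / norm z powr p = norm z powr (2 - p)" by (simp only: powr_diff)
        also have "2 - p = (2 - 2 * s) - ?n" by (simp add: p_def)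
        finally have *: "(norm z)\<^sup>2 / norm z powr p = norm z powr ((2 - 2 * s) - ?n)" .
        have "C1 * ((norm z)\<^sup>2 / ?r\<^sup>2) / norm z powr p = C1 / ?r\<^sup>2 * ((norm z)\<^sup>2 / norm z powr p)" by simp
        then show ?thesis using True unfolding A1_def * by simp
      qed (simp add: A1_def)
      finally show ?thesis using A20[of z] by (simp add: p_def)
    next
      case False
      have D: "\<phi> y * (ln (x \<bullet> x) - ln (y \<bullet> y)) \<le> M * log_singularity ?r y" if "y \<noteq> 0" for y
      proof -
        have "\<phi> y * (ln (x \<bullet> x) - ln (y \<bullet> y)) \<le> \<phi> y * log_singularity ?r y"
          by (intro mult_left_mono log_diff_le_log_singularity x that \<phi>)
        also have "\<dots> \<le> M * log_singularity ?r y" by (intro mult_right_mono \<phi>M log_singularity_nonneg)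
        finally show ?thesis .
      qed
      have "?D \<le> M * log_singularity ?r (x + z) + M * log_singularity ?r (x - z)"
        by (intro add_mono D z)
      then have "?D / norm z powr p \<le> (M * log_singularity ?r (x + z) + M * log_singularity ?r (x - z)) / norm z powr p"
        by (rule divide_right_mono) simp
      also have "\<dots> \<le> (M * log_singularity ?r (x + z) + M * log_singularity ?r (x - z)) / (?r / 8) powr p"
      proof (rule divide_left_mono)
        show "(?r / 8) powr p \<le> norm z powr p" using False p r by (intro powr_mono2) auto
        have "z \<noteq> 0" using False r by auto
        then show "0 < norm z powr p * (?r / 8) powr p" using r by simp
        show "0 \<le> M * log_singularity ?r (x + z) + M * log_singularity ?r (x - z)"
          using M by (intro add_nonneg_nonneg mult_nonneg_nonneg log_singularity_nonneg)
      qed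
      also have "\<dots> = A2 z" using r by (simp add: A2_def powr_divide field_simps)
      finally show ?thesis using A10[of z] by (simp add: p_def)
    qed
    show "\<exists>B. integrable lborel B \<and> (\<integral>z. B z \<partial>lborel) \<le> C * norm x powr (- 2 * s) \<and>
      (\<forall>z. x + z \<noteq> 0 \<longrightarrow> x - z \<noteq> 0 \<longrightarrow>
        log_diff_pair \<phi> x z / jump_denom s z \<le> B z)"
      using int intle pt by (intro exI[of _ "\<lambda>z. A1 z + A2 z"]) auto
  qed
qed

section \<open>The operator applied to the cut-off test function\<close>

context log_profile
begin

lemma \<eta>_diff_le:
  assumes "x \<noteq> 0" "y \<noteq> 0"
  shows "\<eta> x - \<eta> y \<le> \<Phi>1 (ln (x \<bullet> x)) * (ln (x \<bullet> x) - ln (y \<bullet> y))"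
  using \<Phi>_convex assms by (simp add: \<eta>_def)

text \<open>A discrete product rule: the second difference of \<phi> \<eta> is \<eta>(x) times that
  of \<phi> plus the terms \<phi>(x+z) (\<eta>(x) - \<eta>(x+z)) and the same with -z. Since \<phi>
  >= 0, convexity bounds these from above and the factor \<open>\<Phi>1\<close> comes out of the
  integral. On the local side the term with the Laplacian of ell has a favourable sign for n >= 2
  and is dropped.\<close>

lemma mixed_op_mult_\<eta>_le:
  fixes \<phi> :: "'a::euclidean_space \<Rightarrow> real"
  assumes s: "0 < s" "s < 1" and n: "2 \<le> DIM('a)"
    and \<phi>: "\<phi> \<in> test_functions \<Omega>" "\<And>y. 0 \<le> \<phi> y"
    and x: "x \<noteq> 0"
    and L: "\<bar>\<Sum>i\<in>Basis. (x \<bullet> i) * partial_deriv i \<phi> x\<bar> \<le> L * norm x"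
    and B: "integrable lborel B" "(\<integral>z. B z \<partial>lborel) \<le> D"
      "\<And>z. x + z \<noteq> 0 \<Longrightarrow> x - z \<noteq> 0 \<Longrightarrow>
        log_diff_pair \<phi> x z / jump_denom s z \<le> B z"
  shows "mixed_op s (\<lambda>x. \<phi> x * \<eta> x) x \<le> \<eta> x * mixed_op s \<phi> x
    + \<Phi>1 (ln (x \<bullet> x)) * (4 * L / norm x + frac_const DIM('a) s / 2 * D) - 4 * \<phi> x * \<Phi>2 (ln (x \<bullet> x)) / (x \<bullet> x)"
proof -
  let ?l = "ln (x \<bullet> x)" and ?c = "frac_const DIM('a) s / 2" and ?p = "real DIM('a) + 2 * s"
  have q: "0 < x \<bullet> x" using x by simp
  have r: "0 < norm x" using x by simp
  have TF: "(\<lambda>x. \<phi> x * \<eta> x) \<in> test_functions \<Omega>" by (rule test_mult_\<eta>(2)[OF \<phi>(1)])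
  have c: "0 \<le> ?c" using frac_const_nonneg[OF s] by simp
  let ?J = "\<lambda>f. \<integral>z. sdiff f x z / norm z powr ?p \<partial>lborel"
  have "?J (\<lambda>x. \<phi> x * \<eta> x) \<le> (\<integral>z. \<eta> x * (sdiff \<phi> x z / norm z powr ?p) + \<Phi>1 ?l * B z \<partial>lborel)"
  proof (rule integral_mono_AE)
    show "integrable lborel (\<lambda>z. sdiff (\<lambda>x. \<phi> x * \<eta> x) x z / norm z powr ?p)" by (rule integrable_sdiff[OF s n TF])
    show "integrable lborel (\<lambda>z. \<eta> x * (sdiff \<phi> x z / norm z powr ?p) + \<Phi>1 ?l * B z)"
      by (intro Bochner_Integration.integrable_add integrable_mult_right integrable_sdiff[OF s n \<phi>(1)] B)
    have pt: "sdiff (\<lambda>x. \<phi> x * \<eta> x) x z / norm z powr ?p \<le> \<eta> x * (sdiff \<phi> x z / norm z powr ?p) + \<Phi>1 ?l * B z"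
      if z: "x + z \<noteq> 0" "x - z \<noteq> 0" for z
    proof -
      let ?E = "\<phi> (x + z) * (?l - ln ((x + z) \<bullet> (x + z))) + \<phi> (x - z) * (?l - ln ((x - z) \<bullet> (x - z)))"
      have "sdiff (\<lambda>x. \<phi> x * \<eta> x) x z = \<eta> x * sdiff \<phi> x z + (\<phi> (x + z) * (\<eta> x - \<eta> (x + z)) + \<phi> (x - z) * (\<eta> x - \<eta> (x - z)))"
        by (simp add: sdiff_def algebra_simps)
      also have "\<dots> \<le> \<eta> x * sdiff \<phi> x z + (\<phi> (x + z) * (\<Phi>1 ?l * (?l - ln ((x + z) \<bullet> (x + z)))) + \<phi> (x - z) * (\<Phi>1 ?l * (?l - ln ((x - z) \<bullet> (x - z)))))"
        by (intro add_left_mono add_mono mult_left_mono \<eta>_diff_le x z \<phi>)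
      also have "\<dots> = \<eta> x * sdiff \<phi> x z + \<Phi>1 ?l * ?E" by (simp add: algebra_simps)
      finally have "sdiff (\<lambda>x. \<phi> x * \<eta> x) x z / norm z powr ?p \<le> (\<eta> x * sdiff \<phi> x z + \<Phi>1 ?l * ?E) / norm z powr ?p"
        by (rule divide_right_mono) simp
      also have "\<dots> = \<eta> x * (sdiff \<phi> x z / norm z powr ?p) + \<Phi>1 ?l * (?E / norm z powr ?p)"
        by (simp add: add_divide_distrib[of "\<eta> x * sdiff \<phi> x z"])
      also have "\<dots> \<le> \<eta> x * (sdiff \<phi> x z / norm z powr ?p) + \<Phi>1 ?l * B z"
        by (intro add_left_mono mult_left_mono B z \<Phi>1_nonneg)
      finally show ?thesis .
    qed
    \<comment> \<open>The tangent inequality for \<eta> holds off the origin only; z = x and z = -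
      x, where one of the two points hits it, form a null set.\<close>
    show "AE z in lborel. sdiff (\<lambda>x. \<phi> x * \<eta> x) x z / norm z powr ?p \<le> \<eta> x * (sdiff \<phi> x z / norm z powr ?p) + \<Phi>1 ?l * B z"
      using AE_lborel_singleton[of x] AE_lborel_singleton[of "- x"]
    proof eventually_elim
      case (elim z)
      have "x + z \<noteq> 0" using elim(2) by (metis add_eq_0_iff)
      moreover have "x - z \<noteq> 0" using elim(1) by simp
      ultimately show ?case by (rule pt)
    qed
  qed
  also have "\<dots> = \<eta> x * ?J \<phi> + \<Phi>1 ?l * (\<integral>z. B z \<partial>lborel)"
    by (subst Bochner_Integration.integral_add)
      (simp_all only: integral_mult_right_zero integrable_mult_right integrable_sdiff[OF s n \<phi>(1)] B(1))
  also have "\<dots> \<le> \<eta> x * ?J \<phi> + \<Phi>1 ?l * D"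
    by (intro add_left_mono mult_left_mono B \<Phi>1_nonneg)
  finally have J: "?c * ?J (\<lambda>x. \<phi> x * \<eta> x) \<le> ?c * (\<eta> x * ?J \<phi> + \<Phi>1 ?l * D)"
    using c by (rule mult_left_mono)
  have "- laplacian (\<lambda>x. \<phi> x * \<eta> x) x \<le> - \<eta> x * laplacian \<phi> x + \<Phi>1 ?l * (4 * L / norm x) - 4 * \<phi> x * \<Phi>2 ?l / (x \<bullet> x)"
  proof -
    let ?G = "\<Sum>i\<in>Basis. (x \<bullet> i) * partial_deriv i \<phi> x"
    have "- (4 * \<Phi>1 ?l / (x \<bullet> x) * ?G) = 4 * \<Phi>1 ?l / (x \<bullet> x) * (- ?G)" by simp
    also have "\<dots> \<le> 4 * \<Phi>1 ?l / (x \<bullet> x) * (L * norm x)"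
      using L \<Phi>1_nonneg[of ?l] q by (intro mult_left_mono) auto
    also have "\<dots> = \<Phi>1 ?l * (4 * L / norm x)" using r by (simp add: dot_square_norm power2_eq_square)
    finally have 1: "- (4 * \<Phi>1 ?l / (x \<bullet> x) * ?G) \<le> \<Phi>1 ?l * (4 * L / norm x)" .
    have "0 \<le> \<phi> x * (\<Phi>1 ?l * (2 * real DIM('a) - 4) / (x \<bullet> x))"
      using n \<phi>(2) \<Phi>1_nonneg[of ?l] q by simp
    then show ?thesis using 1 laplacian_mult_\<eta>[OF \<phi>(1) x] by (simp add: algebra_simps)
  qed
  then have "mixed_op s (\<lambda>x. \<phi> x * \<eta> x) x \<le> - \<eta> x * laplacian \<phi> x + \<Phi>1 ?l * (4 * L / norm x) - 4 * \<phi> x * \<Phi>2 ?l / (x \<bullet> x)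
      + ?c * (\<eta> x * ?J \<phi> + \<Phi>1 ?l * D)"
    using J unfolding mixed_op_sdiff[OF s n TF] by linarith
  also have "\<dots> = \<eta> x * mixed_op s \<phi> x + \<Phi>1 ?l * (4 * L / norm x + ?c * D) - 4 * \<phi> x * \<Phi>2 ?l / (x \<bullet> x)"
    unfolding mixed_op_sdiff[OF s n \<phi>(1)] by (simp add: distrib_left right_diff_distrib mult.left_commute[of "frac_const _ _"])
  finally show ?thesis .
qed

end

text \<open>The errors and the good term share the factor \<rho> \<epsilon>, with \<rho> a value of
  F'. What is left is a bracket free of \<epsilon>: it is nonpositive near the origin and bounded
  elsewhere, so \<open>C\<close> is the same for all \<epsilon>.\<close>

lemma mixed_op_cutoff_le:
  fixes \<phi> :: "'a::euclidean_space \<Rightarrow> real"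
  assumes s: "0 < s" "s < 1" and n: "2 \<le> DIM('a)"
    and \<phi>: "\<phi> \<in> test_functions \<Omega>" "\<And>y. 0 \<le> \<phi> y" "0 < \<phi> 0"
  obtains C where "0 \<le> C" "\<And>\<epsilon> x. 0 < \<epsilon> \<Longrightarrow> x \<noteq> 0 \<Longrightarrow> norm x < 1 \<Longrightarrow>
    mixed_op s (\<lambda>x. \<phi> x * log_profile.\<eta> \<epsilon> ((1 - s) / 2) x) x
      \<le> log_profile.\<eta> \<epsilon> ((1 - s) / 2) x * mixed_op s \<phi> x + \<epsilon> * C"
proof -
  obtain A where A: "0 \<le> A" "\<And>x. x \<noteq> 0 \<Longrightarrow> norm x < 1 \<Longrightarrow>
    \<exists>B. integrable lborel B \<and> (\<integral>z. B z \<partial>lborel) \<le> A * norm x powr (- 2 * s) \<and>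
      (\<forall>z. x + z \<noteq> 0 \<longrightarrow> x - z \<noteq> 0 \<longrightarrow>
        log_diff_pair \<phi> x z / jump_denom s z \<le> B z)"
    by (rule log_diff_pair_bound[OF s n \<phi>(1,2)]) blast
  have "\<exists>b\<ge>0. \<forall>x. \<bar>partial_deriv i \<phi> x\<bar> \<le> b" if "i \<in> Basis" for i
    using test_bounded[OF test_partial_deriv[OF \<phi>(1) that]] by metis
  then obtain b where b: "\<And>i. i \<in> Basis \<Longrightarrow> b i \<ge> 0 \<and> (\<forall>x. \<bar>partial_deriv i \<phi> x\<bar> \<le> b i)" by metis
  define L where "L = (\<Sum>i\<in>Basis. b i)"
  have L0: "0 \<le> L" unfolding L_def using b by (auto intro: sum_nonneg)
  have L: "\<bar>\<Sum>i\<in>Basis. (x \<bullet> i) * partial_deriv i \<phi> x\<bar> \<le> L * norm x" for x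
  proof -
    have "\<bar>\<Sum>i\<in>Basis. (x \<bullet> i) * partial_deriv i \<phi> x\<bar> \<le> (\<Sum>i\<in>Basis. norm x * b i)"
      by (rule order_trans[OF sum_abs]) (use b in \<open>auto intro!: sum_mono mult_mono simp: abs_mult Basis_le_norm\<close>)
    then show ?thesis by (simp add: L_def sum_distrib_left mult.commute)
  qed
  define K where "K = frac_const DIM('a) s / 2 * A"
  have K0: "0 \<le> K" using frac_const_nonneg[OF s] A(1) by (simp add: K_def)
  define \<gamma> where "\<gamma> = (1 - s) / 2"
  have g: "0 < \<gamma>" "\<gamma> \<le> 1" "2 * \<gamma> = 1 - s" using s by (auto simp: \<gamma>_def)
  \<comment> \<open>By continuity this is a lower bound for \<phi> near the origin, where the good
    term must win.\<close>
  define \<kappa> where "\<kappa> = \<phi> 0 / 2"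
  have \<kappa>: "0 < \<kappa>" using \<phi>(3) by (simp add: \<kappa>_def)
  have "continuous (at 0) \<phi>" using test_continuous[OF \<phi>(1), of UNIV] by (simp add: continuous_on_eq_continuous_at)
  then obtain r1 where r1: "0 < r1" "\<And>x. norm x < r1 \<Longrightarrow> \<bar>\<phi> x - \<phi> 0\<bar> < \<kappa>"
    using \<kappa> unfolding continuous_at_eps_delta dist_norm by (auto simp: real_norm_def)
  have lower: "\<kappa> \<le> \<phi> x" if "norm x < r1" for x using r1(2)[OF that] unfolding \<kappa>_def by linarith
  \<comment> \<open>Twice the two errors, divided by the power r^(-1 - s) of the good term. Both
    remaining exponents, s and 1 - s, are positive.\<close>
  have "((\<lambda>r. 8 * L * r powr s + 2 * K * r powr (1 - s)) \<longlongrightarrow> 0) (at_right 0)"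
  proof -
    have "((\<lambda>r::real. r powr a) \<longlongrightarrow> 0 powr a) (at_right 0)" if "0 < a" for a :: real
      by (rule tendsto_powr'[OF tendsto_ident_at tendsto_const])
        (use that in \<open>auto simp: eventually_at_filter\<close>)
    from tendsto_add[OF tendsto_mult_left[OF this[of s], of "8 * L"] tendsto_mult_left[OF this[of "1 - s"], of "2 * K"]]
    show ?thesis using s by simp
  qed
  then have "eventually (\<lambda>r. 8 * L * r powr s + 2 * K * r powr (1 - s) < 4 * \<kappa> * \<gamma>\<^sup>2) (at_right 0)"
    using \<kappa> g by (intro order_tendstoD) auto
  then obtain r2 where r2: "0 < r2" "\<And>r. 0 < r \<Longrightarrow> r < r2 \<Longrightarrow> 8 * L * r powr s + 2 * K * r powr (1 - s) < 4 * \<kappa> * \<gamma>\<^sup>2"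
    by (auto simp: eventually_at_right_field)
  define r0 where "r0 = min r1 r2"
  have r0: "0 < r0" using r1 r2 by (simp add: r0_def)
  \<comment> \<open>The factor 2 bounds 1 + \<gamma> E. The bracketed sum is the error at radius
    \<open>r0\<close>, its largest value for |x| >= r0.\<close>
  define C where "C = 2 * (4 * L / r0 + K * r0 powr (- 2 * s))"
  have C0: "0 \<le> C" unfolding C_def using L0 K0 r0 by simp
  show ?thesis
  proof (rule that[OF C0])
    fix \<epsilon> :: real and x :: 'a assume e: "0 < \<epsilon>" and x: "x \<noteq> 0" "norm x < 1"
    interpret log_profile \<epsilon> \<gamma> using e g by unfold_locales
    let ?l = "ln (x \<bullet> x)" and ?r = "norm x"
    have r: "0 < ?r" using x by simp
    obtain B where B: "integrable lborel B" "(\<integral>z. B z \<partial>lborel) \<le> A * norm x powr (- 2 * s)"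
      "\<And>z. x + z \<noteq> 0 \<Longrightarrow> x - z \<noteq> 0 \<Longrightarrow>
        log_diff_pair \<phi> x z / jump_denom s z \<le> B z"
      using A(2)[OF x] by blast
    define E where "E = ?r powr (1 - s)"
    have E: "exp (\<gamma> * ?l) = E"
    proof -
      have "?l = 2 * ln ?r" using x by (simp add: dot_square_norm ln_realpow)
      then have "\<gamma> * ?l = (1 - s) * ln ?r" using g(3) by (simp add: mult.assoc[symmetric] mult.commute)
      then show ?thesis using r by (simp add: E_def powr_def)
    qed
    have E1: "0 \<le> E" "E \<le> 1" using x r s by (auto simp: E_def intro!: powr_le1)
    define \<rho> where "\<rho> = ramp' (1 + \<epsilon> * (?l + E))"
    have \<rho>: "0 \<le> \<rho>" "\<rho> \<le> 1" by (simp_all add: \<rho>_def ramp'_bounds)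
    have 1: "\<Phi>1 ?l = \<rho> * (\<epsilon> * (1 + \<gamma> * E))" by (simp add: \<Phi>1_def \<rho>_def E)
    have 2: "\<rho> * (\<epsilon> * \<gamma>\<^sup>2 * E) \<le> \<Phi>2 ?l" using \<Phi>2_ge[of ?l] by (simp add: \<rho>_def E)
    let ?V = "4 * L / ?r + K * ?r powr (- 2 * s)"
    have V0: "0 \<le> ?V" using L0 K0 r by simp
    have gE: "1 + \<gamma> * E \<le> 2" using g E1 mult_mono[of \<gamma> 1 E 1] by simp
    have gE0: "0 \<le> 1 + \<gamma> * E" using g E1 by simp
    have bracket: "(1 + \<gamma> * E) * ?V - 4 * \<phi> x * (\<gamma>\<^sup>2 * E) / ?r\<^sup>2 \<le> C"
    proof (cases "?r < r0")
      case True
      have Er: "E / ?r\<^sup>2 = ?r powr (- 1 - s)"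
      proof -
        have "?r\<^sup>2 = ?r powr 2" using r by simp
        then have "E / ?r\<^sup>2 = ?r powr (1 - s - 2)" unfolding E_def by (simp only: powr_diff)
        then show ?thesis by simp
      qed
      have "2 * ?V = ?r powr (- 1 - s) * (8 * L * ?r powr s + 2 * K * ?r powr (1 - s))"
      proof -
        have "?r powr (- 1 - s) * ?r powr s = 1 / ?r" using r by (simp add: powr_add[symmetric] powr_minus_divide)
        moreover have "?r powr (- 1 - s) * ?r powr (1 - s) = ?r powr (- 2 * s)" by (simp add: powr_add[symmetric])
        moreover have "?r powr (- 1 - s) * (8 * L * ?r powr s + 2 * K * ?r powr (1 - s))
          = 8 * L * (?r powr (- 1 - s) * ?r powr s) + 2 * K * (?r powr (- 1 - s) * ?r powr (1 - s))"
          by (simp add: distrib_left)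
        ultimately show ?thesis by simp
      qed
      also have "\<dots> \<le> ?r powr (- 1 - s) * (4 * \<kappa> * \<gamma>\<^sup>2)"
        using r2(2)[OF r] True by (intro mult_left_mono) (auto simp: r0_def)
      also have "\<dots> \<le> ?r powr (- 1 - s) * (4 * \<phi> x * \<gamma>\<^sup>2)"
        using lower[of x] True by (intro mult_left_mono mult_right_mono) (auto simp: r0_def)
      also have "\<dots> = 4 * \<phi> x * (\<gamma>\<^sup>2 * E) / ?r\<^sup>2" unfolding Er[symmetric] by simp
      finally have "2 * ?V \<le> 4 * \<phi> x * (\<gamma>\<^sup>2 * E) / ?r\<^sup>2" .
      moreover have "(1 + \<gamma> * E) * ?V \<le> 2 * ?V" using gE V0 by (intro mult_right_mono)
      ultimately show ?thesis using C0 by linarith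
    next
      case False
      have "4 * L / ?r \<le> 4 * L / r0" using False r r0 L0 by (intro divide_left_mono) auto
      moreover have "?r powr (- 2 * s) \<le> r0 powr (- 2 * s)" using False r0 s by (intro powr_mono2') auto
      ultimately have "?V \<le> 4 * L / r0 + K * r0 powr (- 2 * s)" using K0 by (intro add_mono mult_left_mono)
      then have "(1 + \<gamma> * E) * ?V \<le> C" unfolding C_def using gE gE0 V0 by (intro mult_mono) auto
      moreover have "0 \<le> 4 * \<phi> x * (\<gamma>\<^sup>2 * E) / ?r\<^sup>2" using \<phi>(2) E1 by simp
      ultimately show ?thesis by linarith
    qed
    have "\<Phi>1 ?l * (4 * L / norm x + frac_const DIM('a) s / 2 * (A * ?r powr (- 2 * s))) - 4 * \<phi> x * \<Phi>2 ?l / (x \<bullet> x)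
       \<le> \<rho> * (\<epsilon> * (1 + \<gamma> * E)) * ?V - 4 * \<phi> x * (\<rho> * (\<epsilon> * \<gamma>\<^sup>2 * E)) / (x \<bullet> x)"
    proof -
      have "4 * \<phi> x * (\<rho> * (\<epsilon> * \<gamma>\<^sup>2 * E)) / (x \<bullet> x) \<le> 4 * \<phi> x * \<Phi>2 ?l / (x \<bullet> x)"
        by (intro divide_right_mono mult_left_mono 2) (use \<phi>(2) in auto)
      moreover have "frac_const DIM('a) s / 2 * (A * ?r powr (- 2 * s)) = K * ?r powr (- 2 * s)"
        by (simp add: K_def)
      ultimately show ?thesis by (simp only: 1 diff_left_mono)
    qed
    also have "\<dots> = \<rho> * \<epsilon> * ((1 + \<gamma> * E) * ?V - 4 * \<phi> x * (\<gamma>\<^sup>2 * E) / ?r\<^sup>2)"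
      by (simp add: dot_square_norm right_diff_distrib mult_ac)
    also have "\<dots> \<le> \<rho> * \<epsilon> * C" using bracket \<rho> e by (intro mult_left_mono) auto
    also have "\<dots> \<le> \<epsilon> * C" using \<rho> e C0 by (intro mult_right_mono) (auto simp: mult_left_le_one_le)
    finally have "\<Phi>1 ?l * (4 * L / norm x + frac_const DIM('a) s / 2 * (A * ?r powr (- 2 * s))) - 4 * \<phi> x * \<Phi>2 ?l / (x \<bullet> x) \<le> \<epsilon> * C" .
    with mixed_op_mult_\<eta>_le[OF s n \<phi>(1,2) x(1) L B]
    show "mixed_op s (\<lambda>x. \<phi> x * log_profile.\<eta> \<epsilon> ((1 - s) / 2) x) x
      \<le> log_profile.\<eta> \<epsilon> ((1 - s) / 2) x * mixed_op s \<phi> x + \<epsilon> * C"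
      unfolding \<gamma>_def[symmetric] by linarith
  qed
qed

section \<open>Extension across the origin\<close>

lemma test_ball_outside:
  "f \<in> test_functions (ball 0 1) \<Longrightarrow> 1 \<le> norm x \<Longrightarrow> f x = 0"
  by (metis test_support mem_ball_0 not_le subsetD)

lemma mixed_op_outside:
  fixes f :: "'a::euclidean_space \<Rightarrow> real"
  assumes s: "0 < s" "s < 1" and n: "2 \<le> DIM('a)" and f: "f \<in> test_functions (ball 0 1)" and x: "1 \<le> norm x"
  shows "mixed_op s f x = frac_const DIM('a) s / 2 *
    (\<integral>z. sdiff f x z / jump_denom s z \<partial>lborel)"
  using mixed_op_sdiff[OF s n f] test_ball_outside[OF test_laplacian[OF f] x] by simp

text \<open>Outside the ball the central value vanishes, so the second difference is minus a sum of
  two values and inherits their domination.\<close>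

lemma sdiff_outside_le:
  assumes f: "f \<in> test_functions (ball 0 1)" and g: "g \<in> test_functions (ball 0 1)"
    and gf: "\<And>y. \<bar>g y\<bar> \<le> 2 * f y" and x: "1 \<le> norm x"
  shows "\<bar>sdiff g x z\<bar> \<le> - 2 * sdiff f x z"
  using gf[of "x + z"] gf[of "x - z"] test_ball_outside[OF f x] test_ball_outside[OF g x]
  by (simp add: sdiff_def)

text \<open>A bound uniform in the cutoff, for the region where the sign of u is unknown.\<close>

lemma mixed_op_outside_bound:
  fixes f g :: "'a::euclidean_space \<Rightarrow> real"
  assumes s: "0 < s" "s < 1" and n: "2 \<le> DIM('a)" and f: "f \<in> test_functions (ball 0 1)"
    and g: "g \<in> test_functions (ball 0 1)" and gf: "\<And>y. \<bar>g y\<bar> \<le> 2 * f y" and x: "1 \<le> norm x"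
  shows "\<bar>mixed_op s g x\<bar> \<le> 2 * \<bar>mixed_op s f x\<bar>"
proof -
  let ?p = "real DIM('a) + 2 * s" and ?c = "frac_const DIM('a) s / 2"
  have "\<bar>\<integral>z. sdiff g x z / norm z powr ?p \<partial>lborel\<bar> \<le> (\<integral>z. - 2 * (sdiff f x z / norm z powr ?p) \<partial>lborel)"
  proof (rule integral_abs_bound_integral)
    show "integrable lborel (\<lambda>z. sdiff g x z / norm z powr ?p)" by (rule integrable_sdiff[OF s n g])
    show "integrable lborel (\<lambda>z. - 2 * (sdiff f x z / norm z powr ?p))"
      by (intro integrable_mult_right integrable_sdiff[OF s n f])
    show "\<bar>sdiff g x z / norm z powr ?p\<bar> \<le> - 2 * (sdiff f x z / norm z powr ?p)" for z
      using divide_right_mono[OF sdiff_outside_le[OF f g gf x], of "norm z powr ?p" z] by simp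
  qed
  then have "\<bar>\<integral>z. sdiff g x z / norm z powr ?p \<partial>lborel\<bar> \<le> - 2 * (\<integral>z. sdiff f x z / norm z powr ?p \<partial>lborel)"
    by (simp only: integral_mult_right_zero)
  then have "\<bar>\<integral>z. sdiff g x z / norm z powr ?p \<partial>lborel\<bar> \<le> 2 * \<bar>\<integral>z. sdiff f x z / norm z powr ?p \<partial>lborel\<bar>"
    by linarith
  from mult_left_mono[OF this, of ?c] show ?thesis
    using frac_const_nonneg[OF s] unfolding mixed_op_outside[OF s n f x] mixed_op_outside[OF s n g x]
    by (simp add: abs_mult)
qed

lemma mixed_op_outside_tendsto:
  fixes f :: "'a::euclidean_space \<Rightarrow> real"
  assumes s: "0 < s" "s < 1" and n: "2 \<le> DIM('a)" and f: "f \<in> test_functions (ball 0 1)"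
    and g: "\<And>m. g m \<in> test_functions (ball 0 1)" and gf: "\<And>m y. \<bar>g m y\<bar> \<le> 2 * f y" and x: "1 \<le> norm x"
    and lim: "\<And>y. y \<noteq> 0 \<Longrightarrow> (\<lambda>m. g m y) \<longlonglongrightarrow> k * f y"
  shows "(\<lambda>m::nat. mixed_op s (g m) x) \<longlonglongrightarrow> k * mixed_op s f x"
proof -
  let ?p = "real DIM('a) + 2 * s"
  have "(\<lambda>m. \<integral>z. sdiff (g m) x z / norm z powr ?p \<partial>lborel) \<longlonglongrightarrow> (\<integral>z. k * (sdiff f x z / norm z powr ?p) \<partial>lborel)"
  proof (rule integral_dominated_convergence)
    show "integrable lborel (\<lambda>z. - 2 * (sdiff f x z / norm z powr ?p))"
      by (intro integrable_mult_right integrable_sdiff[OF s n f])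
    show "(\<lambda>z. sdiff (g m) x z / norm z powr ?p) \<in> borel_measurable lborel" for m
      by (rule borel_measurable_integrable[OF integrable_sdiff[OF s n g]])
    show "(\<lambda>z. k * (sdiff f x z / norm z powr ?p)) \<in> borel_measurable lborel"
      by (intro borel_measurable_integrable integrable_mult_right integrable_sdiff[OF s n f])
    show "AE z in lborel. norm (sdiff (g m) x z / norm z powr ?p) \<le> - 2 * (sdiff f x z / norm z powr ?p)" for m
    proof (rule AE_I2)
      fix z show "norm (sdiff (g m) x z / norm z powr ?p) \<le> - 2 * (sdiff f x z / norm z powr ?p)"
        using divide_right_mono[OF sdiff_outside_le[OF f g gf x], of "norm z powr ?p" m z] by simp
    qed
    \<comment> \<open>Convergence of \<open>g m\<close> is given only off the origin, so z = x and z
      = - x are removed.\<close>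
    show "AE z in lborel. (\<lambda>m. sdiff (g m) x z / norm z powr ?p) \<longlonglongrightarrow> k * (sdiff f x z / norm z powr ?p)"
      using AE_lborel_singleton[of x] AE_lborel_singleton[of "- x"]
    proof eventually_elim
      case (elim z)
      have "x + z \<noteq> 0" using elim(2) by (metis add_eq_0_iff)
      moreover have "x - z \<noteq> 0" "x \<noteq> 0" using elim(1) x by auto
      ultimately have "(\<lambda>m. sdiff (g m) x z) \<longlonglongrightarrow> 2 * (k * f x) - k * f (x + z) - k * f (x - z)"
        unfolding sdiff_def by (intro tendsto_diff tendsto_mult tendsto_const lim)
      also have "2 * (k * f x) - k * f (x + z) - k * f (x - z) = k * sdiff f x z"
        by (simp add: sdiff_def algebra_simps)
      finally have "(\<lambda>m. sdiff (g m) x z * (1 / norm z powr ?p)) \<longlonglongrightarrow> k * sdiff f x z * (1 / norm z powr ?p)"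
        by (intro tendsto_mult tendsto_const)
      then show ?case by simp
    qed
  qed
  then have "(\<lambda>m. frac_const DIM('a) s / 2 * (\<integral>z. sdiff (g m) x z / norm z powr ?p \<partial>lborel))
    \<longlonglongrightarrow> frac_const DIM('a) s / 2 * (k * (\<integral>z. sdiff f x z / norm z powr ?p \<partial>lborel))"
    unfolding integral_mult_right_zero by (rule tendsto_mult_left)
  then show ?thesis
    unfolding mixed_op_outside[OF s n f x] mixed_op_outside[OF s n g x] by (simp only: mult.left_commute)
qed

section \<open>Nonnegativity of the functional on the whole ball\<close>

locale punctured_supersolution =
  fixes s :: real and u c :: "'a::euclidean_space \<Rightarrow> real"
  assumes dim: "2 \<le> DIM('a)"
    and s: "0 < s" "s < 1"
    and u: "u \<in> weighted_L1 s"
    and u_nonneg: "AE x in lebesgue_on (ball 0 1). 0 \<le> u x"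
    and c: "c \<in> L_infty (ball 0 1)"
    and supersolution: "distr_nonneg (ball 0 1 - {0})
           (\<lambda>\<phi>. mixed_op_distr s u \<phi> + function_distr (ball 0 1) (\<lambda>x. c x * u x) \<phi>)"
begin

text \<open>\<open>c\<close> is controlled on the ball only; extending it by zero turns
  \<open>T\<close> into a single integral over the whole space.\<close>

definition potential :: "'a \<Rightarrow> real" where
  "potential x = (if x \<in> ball 0 1 then c x else 0)"

definition schroedinger_op :: "('a \<Rightarrow> real) \<Rightarrow> 'a \<Rightarrow> real" where
  "schroedinger_op \<phi> x = mixed_op s \<phi> x + potential x * \<phi> x"

definition T :: "('a \<Rightarrow> real) \<Rightarrow> real" where
  "T \<phi> = mixed_op_distr s u \<phi> + function_distr (ball 0 1) (\<lambda>x. c x * u x) \<phi>"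

lemma u_measurable: "u \<in> borel_measurable lebesgue"
  using u by (auto simp: weighted_L1_def intro: L1_loc_measurable)

lemma potential_measurable: "potential \<in> borel_measurable lebesgue"
proof -
  have "c \<in> borel_measurable (lebesgue_on (ball 0 1))" using c by (simp add: L_infty_def)
  then show ?thesis unfolding potential_def[abs_def] by (subst borel_measurable_if) auto
qed

lemma borel_measurable_lebesgue: "f \<in> borel_measurable borel \<Longrightarrow> f \<in> borel_measurable lebesgue"
  by (rule measurable_completion) simp

lemma u_integrable_cball: "integrable lebesgue (\<lambda>x. indicator (cball 0 1) x * \<bar>u x\<bar>)"
proof -
  have "set_integrable lebesgue (cball 0 1) u" using u by (auto simp: weighted_L1_def L1_loc_def)
  from integrable_norm[OF this[unfolded set_integrable_def]] show ?thesis
    by (simp add: abs_mult)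
qed

lemma integrable_potential_term:
  assumes \<phi>: "\<phi> \<in> test_functions (ball 0 1)"
  shows "integrable lebesgue (\<lambda>x. u x * (potential x * \<phi> x))"
proof -
  obtain M where M: "AE x in lebesgue_on (ball 0 1). \<bar>c x\<bar> \<le> M" using c by (auto simp: L_infty_def)
  obtain B where B: "0 \<le> B" "\<And>x. \<bar>\<phi> x\<bar> \<le> B" using test_bounded[OF \<phi>] by metis
  show ?thesis
  proof (rule Bochner_Integration.integrable_bound)
    show "integrable lebesgue (\<lambda>x. (\<bar>M\<bar> * B) * (indicator (cball 0 1) x * \<bar>u x\<bar>))"
      by (intro integrable_mult_right u_integrable_cball)
    show "(\<lambda>x. u x * (potential x * \<phi> x)) \<in> borel_measurable lebesgue"
      by (intro borel_measurable_times u_measurable potential_measurable borel_measurable_lebesgue test_measurable[OF \<phi>])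
    have "AE x in lebesgue. x \<in> ball 0 1 \<longrightarrow> \<bar>c x\<bar> \<le> M"
      using M by (subst (asm) AE_restrict_space_iff) auto
    then show "AE x in lebesgue. norm (u x * (potential x * \<phi> x)) \<le> norm ((\<bar>M\<bar> * B) * (indicator (cball 0 1) x * \<bar>u x\<bar>))"
    proof eventually_elim
      case (elim x)
      show ?case
      proof (cases "x \<in> ball 0 1")
        case True
        then have "\<bar>potential x\<bar> * \<bar>\<phi> x\<bar> \<le> \<bar>M\<bar> * B"
          using elim B(2)[of x] by (intro mult_mono) (auto simp: potential_def)
        then have "\<bar>u x\<bar> * (\<bar>potential x\<bar> * \<bar>\<phi> x\<bar>) \<le> \<bar>u x\<bar> * (\<bar>M\<bar> * B)" by (rule mult_left_mono) simp
        then show ?thesis using True B by (simp add: abs_mult mult.commute)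
      qed (simp add: potential_def)
    qed
  qed
qed

lemma integrable_schroedinger:
  assumes "\<phi> \<in> test_functions (ball 0 1)"
  shows "integrable lebesgue (\<lambda>x. u x * schroedinger_op \<phi> x)"
  unfolding schroedinger_op_def distrib_left
  by (intro Bochner_Integration.integrable_add integrable_potential_term
      integrable_mixed_op[OF s dim _ u] assms)

lemma T_eq:
  assumes \<phi>: "\<phi> \<in> test_functions (ball 0 1)"
  shows "T \<phi> = (\<integral>x. u x * schroedinger_op \<phi> x \<partial>lebesgue)"
proof -
  have "function_distr (ball 0 1) (\<lambda>x. c x * u x) \<phi> = (\<integral>x. u x * (potential x * \<phi> x) \<partial>lebesgue)"
    unfolding function_distr_def set_lebesgue_integral_def
    by (intro Bochner_Integration.integral_cong) (auto simp: potential_def)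
  then show ?thesis
    unfolding T_def mixed_op_distr_def schroedinger_op_def distrib_left
    using Bochner_Integration.integral_add[OF integrable_mixed_op[OF s dim \<phi> u] integrable_potential_term[OF \<phi>]]
    by simp
qed

lemma T_add:
  assumes \<phi>: "\<phi> \<in> test_functions (ball 0 1)" and \<psi>: "\<psi> \<in> test_functions (ball 0 1)"
  shows "T (\<lambda>x. \<phi> x + \<psi> x) = T \<phi> + T \<psi>"
proof -
  have "schroedinger_op (\<lambda>x. \<phi> x + \<psi> x) x = schroedinger_op \<phi> x + schroedinger_op \<psi> x" for x
    by (simp add: schroedinger_op_def mixed_op_add[OF s dim \<phi> \<psi>] distrib_left)
  then show ?thesis
    using Bochner_Integration.integral_add[OF integrable_schroedinger[OF \<phi>] integrable_schroedinger[OF \<psi>]]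
    by (simp add: T_eq[OF \<phi>] T_eq[OF \<psi>] T_eq[OF test_add[OF \<phi> \<psi>]] distrib_left)
qed

lemma T_scale:
  assumes \<phi>: "\<phi> \<in> test_functions (ball 0 1)"
  shows "T (\<lambda>x. k * \<phi> x) = k * T \<phi>"
proof -
  have "u x * schroedinger_op (\<lambda>x. k * \<phi> x) x = k * (u x * schroedinger_op \<phi> x)" for x
    by (simp add: schroedinger_op_def mixed_op_scale[OF s dim \<phi>] algebra_simps)
  then show ?thesis
    by (simp only: T_eq[OF \<phi>] T_eq[OF test_scale[OF \<phi>]] integral_mult_right_zero)
qed

lemma T_nonneg_if_pos_at_0:
  assumes \<phi>: "\<phi> \<in> test_functions (ball 0 1)" "\<And>x. 0 \<le> \<phi> x" "0 < \<phi> 0"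
  shows "0 \<le> T \<phi>"
proof -
  define \<gamma> where "\<gamma> = (1 - s) / 2"
  have g: "0 < \<gamma>" using s by (simp add: \<gamma>_def)
  define e where "e = (\<lambda>m. inverse (real (Suc m)))"
  have e: "0 < e m" "e m \<le> 1" for m by (auto simp: e_def inverse_le_1_iff)
  have e0: "e \<longlonglongrightarrow> 0" unfolding e_def by (rule LIMSEQ_inverse_real_of_nat)
  have lp: "log_profile (e m) \<gamma>" for m using e g by unfold_locales
  define \<eta> where "\<eta> = (\<lambda>m. log_profile.\<eta> (e m) \<gamma> :: 'a \<Rightarrow> real)"
  define g where "g = (\<lambda>m x. \<phi> x * \<eta> m x)"
  obtain C where C: "0 \<le> C" "\<And>\<epsilon> x. 0 < \<epsilon> \<Longrightarrow> x \<noteq> 0 \<Longrightarrow> norm x < 1 \<Longrightarrow>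
    mixed_op s (\<lambda>x. \<phi> x * log_profile.\<eta> \<epsilon> ((1 - s) / 2) x) x
      \<le> log_profile.\<eta> \<epsilon> ((1 - s) / 2) x * mixed_op s \<phi> x + \<epsilon> * C"
    using mixed_op_cutoff_le[OF s dim \<phi>] by metis
  have \<eta>0: "0 \<le> \<eta> m x" for m x unfolding \<eta>_def by (rule log_profile.\<eta>_nonneg[OF lp])
  have \<eta>2: "\<eta> m x \<le> 2" if "norm x < 1" for m x unfolding \<eta>_def by (rule log_profile.\<eta>_le[OF lp that e(2)])
  have gTF: "g m \<in> test_functions (ball 0 1 - {0})" "g m \<in> test_functions (ball 0 1)" for m
    unfolding g_def \<eta>_def using log_profile.test_mult_\<eta>[OF lp \<phi>(1)] by auto
  have g2: "\<bar>g m y\<bar> \<le> 2 * \<phi> y" for m y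
    using mult_left_mono[OF \<eta>2 \<phi>(2)[of y]] test_ball_outside[OF \<phi>(1), of y] \<phi>(2)[of y] \<eta>0[of m y]
    by (cases "norm y < 1") (auto simp: g_def mult.commute)
  \<comment> \<open>This is F(1), the pointwise limit of the cutoffs; it is positive, and the final
    inequality is divided by it.\<close>
  define k where "k = exp (- 1 :: real)"
  have k: "0 < k" by (simp add: k_def)
  have \<eta>_lim: "(\<lambda>m. \<eta> m x) \<longlonglongrightarrow> k" if x: "x \<noteq> 0" for x
  proof -
    let ?W = "ln (x \<bullet> x) + exp (\<gamma> * ln (x \<bullet> x))"
    have "\<eta> m x = ramp (1 + e m * ?W)" for m
      using x by (simp add: \<eta>_def log_profile.\<eta>_def[OF lp] log_profile.\<Phi>_def[OF lp])
    moreover have "(\<lambda>m. 1 + e m * ?W) \<longlonglongrightarrow> 1 + 0 * ?W"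
      by (intro tendsto_add tendsto_mult tendsto_const e0)
    then have "(\<lambda>m. ramp (1 + e m * ?W)) \<longlonglongrightarrow> ramp (1 + 0 * ?W)"
      by (rule isCont_tendsto_compose[OF DERIV_isCont[OF DERIV_ramp]])
    moreover have "ramp (1 + 0 * ?W) = k" by (simp add: ramp_def flat_def k_def)
    ultimately show ?thesis by simp
  qed
  \<comment> \<open>The integrand of \<open>T (g m)\<close>, with the operator replaced in the ball
    by its upper bound. As u >= 0 there, the integral of \<open>H m\<close> is at least
    \<open>T (g m)\<close>, and \<open>H m\<close> has the majorant \<open>w\<close> independent of
    \<open>m\<close>.\<close>
  define H where "H = (\<lambda>m x. u x * (if x \<in> ball 0 1 then \<eta> m x * schroedinger_op \<phi> x + e m * C else mixed_op s (g m) x))"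
  \<comment> \<open>The factor 2 bounds \<eta> in the ball and the quotient of the two operators
    outside. The constant error occurs in the ball only, where u is integrable.\<close>
  define w where "w = (\<lambda>x. 2 * \<bar>u x * schroedinger_op \<phi> x\<bar> + C * (indicator (cball 0 1) x * \<bar>u x\<bar>))"
  have w: "integrable lebesgue w" unfolding w_def
    by (intro Bochner_Integration.integrable_add integrable_mult_right integrable_abs integrable_schroedinger[OF \<phi>(1)] u_integrable_cball)
  have \<eta>_meas: "\<eta> m \<in> borel_measurable borel" for m
    unfolding \<eta>_def by (intro borel_measurable_continuous_onI Ck_on_imp_continuous_on[OF log_profile.Ck_on_\<eta>[OF lp]])
  have so_meas: "schroedinger_op \<phi> \<in> borel_measurable lebesgue"
    unfolding schroedinger_op_def[abs_def]
    by (intro borel_measurable_add borel_measurable_times potential_measurable borel_measurable_lebesgue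
        mixed_op_measurable[OF s dim \<phi>(1)] test_measurable[OF \<phi>(1)])
  have H_meas: "H m \<in> borel_measurable lebesgue" for m
    unfolding H_def
    by (intro borel_measurable_times u_measurable measurable_If borel_measurable_add borel_measurable_const so_meas
        borel_measurable_lebesgue \<eta>_meas mixed_op_measurable[OF s dim gTF(2)]) simp
  have H_le: "\<bar>H m x\<bar> \<le> w x" for m x
  proof (cases "norm x < 1")
    case True
    have "\<bar>\<eta> m x * schroedinger_op \<phi> x + e m * C\<bar> \<le> \<bar>\<eta> m x * schroedinger_op \<phi> x\<bar> + \<bar>e m * C\<bar>" by (rule abs_triangle_ineq)
    also have "\<dots> \<le> 2 * \<bar>schroedinger_op \<phi> x\<bar> + C"
      using \<eta>0[of m x] \<eta>2[OF True, of m] e[of m] C(1)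
      by (intro add_mono) (auto simp: abs_mult mult_right_mono mult_left_le_one_le)
    finally have "\<bar>u x\<bar> * \<bar>\<eta> m x * schroedinger_op \<phi> x + e m * C\<bar> \<le> \<bar>u x\<bar> * (2 * \<bar>schroedinger_op \<phi> x\<bar> + C)"
      by (rule mult_left_mono) simp
    moreover have "\<bar>H m x\<bar> = \<bar>u x\<bar> * \<bar>\<eta> m x * schroedinger_op \<phi> x + e m * C\<bar>"
      using True by (simp add: H_def abs_mult)
    moreover have "w x = \<bar>u x\<bar> * (2 * \<bar>schroedinger_op \<phi> x\<bar> + C)"
      using True by (simp add: w_def abs_mult algebra_simps)
    ultimately show ?thesis by simp
  next
    case False
    then have x: "1 \<le> norm x" by simp
    have "\<bar>u x\<bar> * \<bar>mixed_op s (g m) x\<bar> \<le> \<bar>u x\<bar> * (2 * \<bar>mixed_op s \<phi> x\<bar>)"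
      by (intro mult_left_mono mixed_op_outside_bound[OF s dim \<phi>(1) gTF(2) g2 x]) simp
    moreover have "0 \<le> C * (indicator (cball 0 1) x * \<bar>u x\<bar>)" using C(1) by simp
    ultimately show ?thesis using False
      by (simp add: H_def w_def abs_mult schroedinger_op_def potential_def)
  qed
  have H_lim: "(\<lambda>m. H m x) \<longlonglongrightarrow> k * (u x * schroedinger_op \<phi> x)" if x: "x \<noteq> 0" for x
  proof (cases "norm x < 1")
    case True
    have "(\<lambda>m. u x * (\<eta> m x * schroedinger_op \<phi> x + e m * C)) \<longlonglongrightarrow> u x * (k * schroedinger_op \<phi> x + 0 * C)"
      by (intro tendsto_mult tendsto_add tendsto_const e0 \<eta>_lim x)
    then show ?thesis using True by (simp add: H_def mult_ac)
  next
    case False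
    then have x: "1 \<le> norm x" by simp
    have "(\<lambda>m. g m y) \<longlonglongrightarrow> k * \<phi> y" if "y \<noteq> 0" for y
      using tendsto_mult[OF tendsto_const \<eta>_lim[OF that], of "\<phi> y"] by (simp add: g_def mult.commute)
    from mixed_op_outside_tendsto[OF s dim \<phi>(1) gTF(2) g2 x this]
    have "(\<lambda>m. u x * mixed_op s (g m) x) \<longlonglongrightarrow> u x * (k * mixed_op s \<phi> x)"
      by (intro tendsto_mult tendsto_const)
    then show ?thesis using False by (simp add: H_def schroedinger_op_def potential_def mult_ac)
  qed
  have AE0: "AE x in lebesgue. x \<noteq> (0::'a)" using AE_lborel_singleton[of 0] by (rule AE_completion)
  have conv: "(\<lambda>m. \<integral>x. H m x \<partial>lebesgue) \<longlonglongrightarrow> (\<integral>x. k * (u x * schroedinger_op \<phi> x) \<partial>lebesgue)"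
  proof (rule integral_dominated_convergence[OF _ H_meas w])
    show "(\<lambda>x. k * (u x * schroedinger_op \<phi> x)) \<in> borel_measurable lebesgue"
      by (intro borel_measurable_times borel_measurable_const u_measurable so_meas)
    show "AE x in lebesgue. (\<lambda>m. H m x) \<longlonglongrightarrow> k * (u x * schroedinger_op \<phi> x)"
      using AE0 by eventually_elim (rule H_lim)
    show "AE x in lebesgue. norm (H m x) \<le> w x" for m using H_le by auto
  qed
  have pos: "0 \<le> (\<integral>x. H m x \<partial>lebesgue)" for m
  proof -
    have "0 \<le> T (g m)"
      using supersolution gTF(1)[of m] \<phi>(2) \<eta>0 unfolding distr_nonneg_def T_def by (auto simp: g_def)
    also have "T (g m) = (\<integral>x. u x * schroedinger_op (g m) x \<partial>lebesgue)" by (rule T_eq[OF gTF(2)])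
    also have "\<dots> \<le> (\<integral>x. H m x \<partial>lebesgue)"
    proof (rule integral_mono_AE)
      show "integrable lebesgue (\<lambda>x. u x * schroedinger_op (g m) x)" by (rule integrable_schroedinger[OF gTF(2)])
      show "integrable lebesgue (H m)"
        by (rule Bochner_Integration.integrable_bound[OF w H_meas]) (use H_le in \<open>auto intro: order_trans[OF _ abs_ge_self]\<close>)
      have "AE x in lebesgue. x \<in> ball 0 1 \<longrightarrow> 0 \<le> u x"
        using u_nonneg by (subst (asm) AE_restrict_space_iff) auto
      then show "AE x in lebesgue. u x * schroedinger_op (g m) x \<le> H m x"
        using AE0
      proof eventually_elim
        case (elim x)
        show ?case
        proof (cases "x \<in> ball 0 1")
          case True
          then have "mixed_op s (g m) x \<le> \<eta> m x * mixed_op s \<phi> x + e m * C"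
            unfolding g_def \<eta>_def \<gamma>_def using elim(2) by (intro C(2) e) auto
          then have "schroedinger_op (g m) x \<le> \<eta> m x * schroedinger_op \<phi> x + e m * C"
            by (simp add: schroedinger_op_def g_def algebra_simps)
          then show ?thesis unfolding H_def using elim(1) True by (simp add: mult_left_mono)
        qed (simp add: H_def schroedinger_op_def potential_def)
      qed
    qed
    finally show ?thesis .
  qed
  have "0 \<le> (\<integral>x. k * (u x * schroedinger_op \<phi> x) \<partial>lebesgue)"
    by (rule LIMSEQ_le_const[OF conv]) (use pos in auto)
  then have "0 \<le> k * T \<phi>" by (simp add: T_eq[OF \<phi>(1)])
  then show ?thesis using k by (simp add: zero_le_mult_iff)
qed

lemma T_nonneg:
  assumes \<phi>: "\<phi> \<in> test_functions (ball 0 1)" "\<And>x. 0 \<le> \<phi> x"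
  shows "0 \<le> T \<phi>"
proof -
  define \<psi> where "\<psi> = bump (0::'a) (1/2)"
  have \<psi>: "\<psi> \<in> test_functions (ball 0 1)" "\<And>x. 0 \<le> \<psi> x" "0 < \<psi> 0"
    unfolding \<psi>_def by (auto intro!: bump_test_function bump_nonneg simp: bump_pos_iff subset_eq)
  have "0 \<le> T \<phi> + e * T \<psi>" if e: "0 < e" for e
  proof -
    have e\<psi>: "(\<lambda>x. e * \<psi> x) \<in> test_functions (ball 0 1)" by (rule test_scale[OF \<psi>(1)])
    have "0 \<le> T (\<lambda>x. \<phi> x + e * \<psi> x)"
      using \<phi> \<psi> e by (intro T_nonneg_if_pos_at_0 test_add e\<psi>) (auto intro: add_nonneg_pos)
    then show ?thesis by (simp add: T_add[OF \<phi>(1) e\<psi>] T_scale[OF \<psi>(1)])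
  qed
  moreover have "((\<lambda>e. T \<phi> + e * T \<psi>) \<longlongrightarrow> T \<phi> + 0 * T \<psi>) (at_right 0)"
    by (intro tendsto_intros)
  ultimately have "0 \<le> T \<phi> + 0 * T \<psi>"
    by (intro tendsto_lowerbound) (auto simp: eventually_at_filter)
  then show ?thesis by simp
qed

sublocale positive_distribution "ball 0 1" T
  by unfold_locales (auto intro: T_add T_scale T_nonneg)

end

theorem theorem1p2:
  fixes s :: real and u c :: "real ^ 'n \<Rightarrow> real"
  assumes "CARD('n) \<ge> 2"
    and "0 < s" and "s < 1"
    and "u \<in> weighted_L1 s"
    and "AE x in lebesgue_on (ball 0 1). 0 \<le> u x"
    and "c \<in> L_infty (ball 0 1)"
    and "distr_nonneg (ball 0 1 - {0})
           (\<lambda>\<phi>. mixed_op_distr s u \<phi> + function_distr (ball 0 1) (\<lambda>x. c x * u x) \<phi>)"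
  shows "\<exists>a \<mu>. 0 \<le> a \<and> radon_measure_on (ball 0 1) \<mu> \<and> emeasure \<mu> {0} = 0 \<and>
           distr_eq (ball 0 1)
             (\<lambda>\<phi>. mixed_op_distr s u \<phi> + function_distr (ball 0 1) (\<lambda>x. c x * u x) \<phi>)
             (\<lambda>\<phi>. measure_distr \<mu> \<phi> + a * dirac_distr 0 \<phi>)"
proof -
  interpret punctured_supersolution s u c
    using assms by unfold_locales auto
  obtain a \<mu> where "0 \<le> a" "radon_measure_on (ball 0 1) \<mu>" "emeasure \<mu> {0} = 0"
    "\<And>f. f \<in> test_functions (ball 0 1) \<Longrightarrow> T f = measure_distr \<mu> f + a * dirac_distr 0 f"
    using radon_decomposition[of 0] by auto
  then show ?thesis unfolding distr_eq_def T_def by blast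
qed

end
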